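(* Let $\sigma^2\ge 0$, let $\mathcal M$ be a spectral function, let $\mu>0$ satisfy the nondegeneracy condition, and let $M_\mu$ be the associated limit log-infinitely divisible measure on $[0,1]$, all as described in the context. Let $n\in\mathbb N$ satisfy $n-\mu\,\phi(-in)>1$, and let $f$ be a non-negative test function on $[0,1]$. Then $$\mathbf E\Bigl[\Bigl(\int_0^1 f(t)\,M_\mu(dt)\Bigr)^n\Bigr]=n!\int_{0<t_1<\cdots<t_n<1}\prod_{i=1}^n f(t_i)\prod_{1\le k<p\le n}|t_p-t_k|^{-\mu\,d(p-k)}\,dt_1\cdots dt_n .$$
   Context: Let $\sigma^2\ge0$ and let $\mathcal M$ be a function that is continuous and non-decreasing on $(-\infty,0)$ and on $(0,\infty)$, with $\int_{[-1,1]\setminus\{0\}}u^2\,d\mathcal M(u)<\infty$ and $\lim_{u\to\pm\infty}\mathcal M(u)=0$; assume $\mathcal M$ decays at infinity fast enough that all integrals with respect to $d\mathcal M$ below converge. Define $$\phi(q)=-\frac{iq\sigma^2}{2}-\frac{q^2\sigma^2}{2}+\int_{\mathbb R\setminus\{0\}}\bigl(e^{iqu}-1-iq(e^u-1)\bigr)\,d\mathcal M(u),$$ so that $\phi(-i)=0$; for $n\in\mathbb N$ this gives $\phi(-in)=\frac{\sigma^2}{2}(n^2-n)+\int_{\mathbb R\setminus\{0\}}\bigl(e^{nu}-1-n(e^u-1)\bigr)d\mathcal M(u)$. Let $\mu>0$ satisfy $1-\mu\bigl(\frac{\sigma^2}{2}+\int_{\mathbb R\setminus\{0\}}(ue^u-e^u+1)\,d\mathcal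 M(u)\bigr)>0$. Let $P$ be an infinitely divisible, independently scattered random measure on $\mathbb H_+=\{(t,l):t\in\mathbb R,\ l>0\}$ with intensity $\rho(dt\,dl)=dt\,dl/l^2$, i.e. $P(A)$ and $P(B)$ are independent for disjoint measurable $A,B$ and $\mathbf E[e^{iqP(A)}]=e^{\mu\phi(q)\rho(A)}$ for $q\in\mathbb R$. For $0<\varepsilon<1$ and $u\in\mathbb R$ let $\mathcal A_\varepsilon(u)=\{(t,l): |t-u|\le l/2 \text{ for } \varepsilon\le l\le 1,\ |t-u|\le 1/2 \text{ for } l\ge1\}$. The limit log-infinitely divisible measure $M_\mu$ on $[0,1]$ is the (weak, almost sure) limit as $\varepsilon\to0$ of the random measures $\exp\bigl(P(\mathcal A_\varepsilon(u))\bigr)\,du$, so that $M_\mu(a,b)=\lim_{\varepsilon\to0}\int_a^b e^{P(\mathcal A_\varepsilon(u))}du$. For $m\in\mathbb N$ define $$d(m)=\sigma^2+\int_{\mathbb R\setminus\{0\}}e^{(m-1)u}(e^u-1)^2\,d\mathcal M(u).$$ *)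

theory Defs
  imports "HOL-Probability.Probability"
begin

definition Hplus :: "(real \<times> real) set" where
  "Hplus = {x. snd x > 0}"

definition rho :: "(real \<times> real) measure" where
  "rho = density lborel (\<lambda>x. indicator Hplus x * ennreal (1 / (snd x)^2))"

definition cone_set :: "real \<Rightarrow> real \<Rightarrow> (real \<times> real) set" where
  "cone_set \<epsilon> u = {(t,l). (\<epsilon> \<le> l \<and> l \<le> 1 \<and> \<bar>t - u\<bar> \<le> l / 2) \<or> (l \<ge> 1 \<and> \<bar>t - u\<bar> \<le> 1 / 2)}"

text \<open>nu is the Lebesgue-Stieltjes measure dM of the spectral function M on R \ {0}
  (it puts no mass at 0 and gives (a,b] the mass M b - M a on each half-line).
  The remaining conditions are the standing assumptions on a spectral function.\<close>
definition spectral_function :: "(real \<Rightarrow> real) \<Rightarrow> real measure \<Rightarrow> bool" where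
  "spectral_function M nu \<longleftrightarrow>
     continuous_on {..<0} M \<and> continuous_on {0<..} M \<and>
     mono_on {..<0} M \<and> mono_on {0<..} M \<and>
     (M \<longlongrightarrow> 0) at_top \<and> (M \<longlongrightarrow> 0) at_bot \<and>
     sets nu = sets borel \<and> emeasure nu {0} = 0 \<and>
     (\<forall>a b. a \<le> b \<and> b < 0 \<longrightarrow> emeasure nu {a<..b} = ennreal (M b - M a)) \<and>
     (\<forall>a b. 0 < a \<and> a \<le> b \<longrightarrow> emeasure nu {a<..b} = ennreal (M b - M a)) \<and>
     (\<integral>\<^sup>+ u. indicator {-1..1} u * ennreal (u^2) \<partial>nu) < \<infinity>"

definition phi_integrand :: "complex \<Rightarrow> real \<Rightarrow> complex" where
  "phi_integrand q u = exp (\<i> * q * of_real u) - 1 - \<i> * q * (exp (of_real u) - 1)"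

definition phi :: "real \<Rightarrow> real measure \<Rightarrow> complex \<Rightarrow> complex" where
  "phi s2 nu q = - \<i> * q * of_real s2 / 2 - q^2 * of_real s2 / 2
                 + integral\<^sup>L nu (phi_integrand q)"

definition dfun :: "real \<Rightarrow> real measure \<Rightarrow> nat \<Rightarrow> real" where
  "dfun s2 nu m = s2 + (\<integral>u. exp ((real m - 1) * u) * (exp u - 1)^2 \<partial>nu)"

definition spectral_integrable :: "real measure \<Rightarrow> nat \<Rightarrow> bool" where
  "spectral_integrable nu n \<longleftrightarrow>
     (\<forall>q::real. integrable nu (phi_integrand (of_real q))) \<and>
     integrable nu (phi_integrand (- \<i> * of_nat n)) \<and>
     integrable nu (\<lambda>u. u * exp u - exp u + 1) \<and>
     (\<forall>m. 1 \<le> m \<and> m < n \<longrightarrow> integrable nu (\<lambda>u. exp ((real m - 1) * u) * (exp u - 1)^2))"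

definition ID_scattered :: "'w measure \<Rightarrow> real \<Rightarrow> real \<Rightarrow> real measure \<Rightarrow>
    ((real \<times> real) set \<Rightarrow> 'w \<Rightarrow> real) \<Rightarrow> bool" where
  "ID_scattered Pr \<mu> s2 nu P \<longleftrightarrow>
     (let adm = {A. A \<in> sets borel \<and> A \<subseteq> Hplus \<and> emeasure rho A < \<infinity>} in
       (\<forall>A\<in>adm. P A \<in> borel_measurable Pr \<and>
           (\<forall>q::real. char (distr Pr borel (P A)) q
                = exp (of_real \<mu> * phi s2 nu (of_real q) * of_real (measure rho A)))) \<and>
       (\<forall>A\<in>adm. \<forall>B\<in>adm. A \<inter> B = {} \<longrightarrow> (AE \<omega> in Pr. P (A \<union> B) \<omega> = P A \<omega> + P B \<omega>)) \<and>
       (\<forall>(I::nat set) F. finite I \<longrightarrow> (\<forall>i\<in>I. F i \<in> adm) \<longrightarrow> disjoint_family_on F I \<longrightarrow>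
           prob_space.indep_vars Pr (\<lambda>_. borel) (\<lambda>i. P (F i)) I))"

definition limit_logID_measure :: "'w measure \<Rightarrow> ((real \<times> real) set \<Rightarrow> 'w \<Rightarrow> real) \<Rightarrow>
    ('w \<Rightarrow> real measure) \<Rightarrow> bool" where
  "limit_logID_measure Pr P Mmu \<longleftrightarrow>
     (\<forall>\<epsilon>\<in>{0<..<1}. (\<lambda>(u, \<omega>). P (cone_set \<epsilon> u) \<omega>) \<in> borel_measurable (lborel \<Otimes>\<^sub>M Pr)) \<and>
     (\<forall>\<omega>\<in>space Pr. sets (Mmu \<omega>) = sets borel \<and> finite_measure (Mmu \<omega>) \<and>
         emeasure (Mmu \<omega>) (- {0..1}) = 0) \<and>
     (\<forall>B\<in>sets borel. (\<lambda>\<omega>. emeasure (Mmu \<omega>) B) \<in> borel_measurable Pr) \<and>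
     (AE \<omega> in Pr. \<forall>g. continuous_on {0..1} g \<longrightarrow>
         ((\<lambda>\<epsilon>. LBINT u:{0..1}. g u * exp (P (cone_set \<epsilon> u) \<omega>))
            \<longlongrightarrow> (LINT u:{0..1}|Mmu \<omega>. g u)) (at_right 0))"

end

theory Submission
  imports Defs "HOL-Complex_Analysis.Complex_Analysis" "HOL-Real_Asymp.Real_Asymp"
begin

text \<open>
  Let \<open>\<Phi> m = \<phi>(- i m)\<close>. Shifting a contour in a Gaussian integral turns the given characteristic function
  into \<open>E exp (m P(A)) = exp (\<mu> \<rho>(A) \<Phi> m)\<close>, and cutting overlapping cones into independent atoms gives
  \<open>E \<Prod> exp (P(C\<^sub>i)) = exp (\<mu> \<integral> \<Phi>(N) d\<rho>)\<close>, where \<open>N(x)\<close> counts the cones containing \<open>x\<close>. For ordered points the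
  cones covering \<open>x\<close> form a block of consecutive indices, \<open>\<Phi>\<close> is the double sum of its second differences \<open>d\<close>, and
  \<open>\<rho>(C(s) \<inter> C(t)) = - ln \<bar>t - s\<bar>\<close>. This yields the integrand of the formula as soon as the truncation
  scales lie below the smallest gap, and as an upper bound always.

  The integrand is at most the product of the \<open>- \<mu> \<Phi>(n) / (n - 1)\<close>-th powers of the consecutive gaps, so it is
  integrable. Hence all mixed moments of order \<open>n\<close> of the approximating masses converge to the same number,
  which makes them Cauchy in \<open>L\<^sup>n\<close>, and the moments pass to the limit.
\<close>

section \<open>Gaps between ordered points\<close>

text \<open>The characteristic function is prescribed at real q only, while the moment of order n
  sits at - i n, on the edge of the strip where \<phi> is known to be given by a convergent
  integral. Exponential moments are therefore obtained from E exp (m X - s^2 X^2 / 2) as s tends to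
  0, which presupposes no finiteness. The same edge shapes the limit. Moments of order above n need
  not exist, so almost sure convergence with bounded moments of order n does not give uniform
  integrability, and Fatou yields one inequality only. The other comes from mixed moments, whose n
  factors carry different truncation scales: all of them lie between the integral of the limiting
  density over well separated configurations and its integral over all configurations, and the
  former tends to the latter. The condition n - \<mu> \<phi>(- i n) > 1 says that \<mu> \<Phi> n /
  (n - 1) < 1, which is what makes a gap to minus this power integrable at 0. The exponent is
  reached by spreading the singularities evenly over the n - 1 gaps; bounding every block by its
  first gap would put a larger exponent on some of them.\<close>

lemma gap_weights_sum:
  fixes L :: "nat \<Rightarrow> real"
  assumes "m \<ge> 1"
  shows "(\<Sum>s\<le>K. (\<Sum>j<m. L (s + j)) + (real K - real s) * L s + real s * L (s + m - 1))
       = (real K + 1) * (\<Sum>i<K + m. L i)"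
proof (induction K)
  case 0
  show ?case by simp
next
  case (Suc K)
  have eq: "{..<Suc K + m} = {..<Suc K} \<union> {Suc K..<Suc K + m}" by auto
  have s1: "(\<Sum>i<Suc K + m. L i) = (\<Sum>s\<le>K. L s) + (\<Sum>j<m. L (Suc K + j))"
  proof -
    have "(\<Sum>i<Suc K + m. L i) = (\<Sum>i<Suc K. L i) + (\<Sum>i\<in>{Suc K..<Suc K + m}. L i)"
      unfolding eq by (rule sum.union_disjoint) auto
    also have "(\<Sum>i\<in>{Suc K..<Suc K + m}. L i) = (\<Sum>j<m. L (Suc K + j))"
      by (rule sum.reindex_bij_witness[of _ "\<lambda>j. Suc K + j" "\<lambda>i. i - Suc K"]) auto
    finally show ?thesis by (simp add: lessThan_Suc_atMost)
  qed
  have s2: "(\<Sum>i<Suc K + m. L i) = (\<Sum>i<K + m. L i) + L (K + m)" by simp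
  \<comment> \<open>From \<open>K\<close> to \<open>Suc K\<close> each old block gains one more
    \<open>L s\<close>, and the new block has weight 0 on its first member and \<open>K + 1\<close>
    on its last. The gained terms and the plain sum of the new block form one full copy of the sum
    over all gaps.\<close>
  have "(\<Sum>s\<le>Suc K. (\<Sum>j<m. L (s + j)) + (real (Suc K) - real s) * L s + real s * L (s + m - 1))
    = (\<Sum>s\<le>K. ((\<Sum>j<m. L (s + j)) + (real K - real s) * L s + real s * L (s + m - 1)) + L s)
      + ((\<Sum>j<m. L (Suc K + j)) + real (Suc K) * L (K + m))"
    by (simp add: algebra_simps)
  also have "\<dots> = (real K + 1) * (\<Sum>i<K + m. L i) + (\<Sum>s\<le>K. L s) + ((\<Sum>j<m. L (Suc K + j)) + real (Suc K) * L (K + m))"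
    by (subst sum.distrib) (simp only: Suc.IH)
  also have "\<dots> = (real K + 1) * (\<Sum>i<K + m. L i) + (\<Sum>i<Suc K + m. L i) + real (Suc K) * L (K + m)"
    unfolding s1 by simp
  also have "\<dots> = (real (Suc K) + 1) * (\<Sum>i<Suc K + m. L i)"
    unfolding s2 by (simp add: algebra_simps)
  finally show ?case .
qed

text \<open>Each block of \<open>m\<close> consecutive gaps dominates each of its members. Averaging these bounds with
  weights that favour the two end members spreads the load evenly over all \<open>N = K + m\<close> gaps.\<close>

lemma sum_ln_blocks_ge:
  fixes x :: "nat \<Rightarrow> real"
  assumes "m \<ge> 1" and pos: "\<And>i. i < K + m \<Longrightarrow> x i > 0"
  shows "(real K + 1) * (\<Sum>i<K + m. ln (x i)) \<le> real (K + m) * (\<Sum>s\<le>K. ln (\<Sum>j<m. x (s + j)))"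
proof -
  have "(\<Sum>j<m. ln (x (s + j))) + (real K - real s) * ln (x s) + real s * ln (x (s + m - 1))
      \<le> real (K + m) * ln (\<Sum>j<m. x (s + j))" if s: "s \<le> K" for s
  proof -
    have le: "ln (x (s + j)) \<le> ln (\<Sum>j<m. x (s + j))" if "j < m" for j
    proof -
      have "x (s + j) \<le> (\<Sum>j<m. x (s + j))"
        by (rule member_le_sum) (use that s in \<open>auto intro!: less_imp_le pos\<close>)
      then show ?thesis using pos[of "s + j"] s that by (intro ln_mono) auto
    qed
    have "(\<Sum>j<m. ln (x (s + j))) \<le> (\<Sum>j<m. ln (\<Sum>j<m. x (s + j)))"
      by (rule sum_mono) (use le in auto)
    moreover have "(real K - real s) * ln (x s) \<le> (real K - real s) * ln (\<Sum>j<m. x (s + j))"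
      using le[of 0] s assms(1) by (intro mult_left_mono) auto
    moreover have "real s * ln (x (s + m - 1)) \<le> real s * ln (\<Sum>j<m. x (s + j))"
      using le[of "m - 1"] assms(1) by (intro mult_left_mono) auto
    ultimately show ?thesis by (simp add: algebra_simps)
  qed
  then have "(\<Sum>s\<le>K. (\<Sum>j<m. ln (x (s + j))) + (real K - real s) * ln (x s) + real s * ln (x (s + m - 1)))
      \<le> (\<Sum>s\<le>K. real (K + m) * ln (\<Sum>j<m. x (s + j)))"
    by (intro sum_mono) auto
  then show ?thesis
    unfolding gap_weights_sum[OF assms(1), where L = "\<lambda>i. ln (x i)"] sum_distrib_left[symmetric] .
qed

section \<open>The cumulant function and its analytic continuation\<close>

text \<open>Cauchy's theorem on a rectangle between Im z = 0 and Im z = - a, expressed through a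
  primitive of the entire integrand: the horizontal integrals are differences of its corner values,
  and the differences along the vertical sides vanish at infinity because \<open>H\<close> is
  bounded on the strip and the Gaussian factor decays.\<close>

lemma exp_gauss_shift:
  fixes H :: "complex \<Rightarrow> complex"
  assumes hol: "H holomorphic_on UNIV" and a: "a \<ge> 0"
    and bd: "\<And>z. - a \<le> Im z \<Longrightarrow> Im z \<le> 0 \<Longrightarrow> norm (H z) \<le> B"
  shows "(\<integral>q. exp (- (complex_of_real q + \<i> * a)\<^sup>2 / 2) * H q \<partial>lborel)
       = (\<integral>w. exp (- (complex_of_real w)\<^sup>2 / 2) * H (complex_of_real w - \<i> * a) \<partial>lborel)"
    and "integrable lborel (\<lambda>q. exp (- (complex_of_real q + \<i> * a)\<^sup>2 / 2) * H q)"
    and "integrable lborel (\<lambda>w. exp (- (complex_of_real w)\<^sup>2 / 2) * H (complex_of_real w - \<i> * a))"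
proof -
  define k where "k z = exp (- (z + \<i> * a)\<^sup>2 / 2) * H z" for z
  have khol: "k holomorphic_on UNIV"
    unfolding k_def by (intro holomorphic_intros hol) auto
  obtain G where G0: "\<And>z. z \<in> UNIV \<Longrightarrow> (G has_field_derivative k z) (at z within UNIV)"
    using holomorphic_convex_primitive'[OF convex_UNIV open_UNIV khol] by blast
  then have G: "(G has_field_derivative k z) (at z)" for z by simp
  have B0: "B \<ge> 0" using order_trans[OF norm_ge_zero bd[of 0]] a by simp
  \<comment> \<open>At depth b the Gaussian exponent has real part ((a - b)^2 - w^2) / 2, so one
    bound serves the whole strip: it gives integrability on the horizontal lines and decay on the
    vertical sides.\<close>
  have nk: "norm (k (complex_of_real w - \<i> * b)) \<le> exp (a\<^sup>2 / 2) * B * exp (- w\<^sup>2 / 2)"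
    if "0 \<le> b" "b \<le> a" for w b :: real
  proof -
    have "norm (exp (- (complex_of_real w - \<i> * b + \<i> * a)\<^sup>2 / 2)) = exp ((a - b)\<^sup>2 / 2 - w\<^sup>2 / 2)"
      by (simp add: power2_eq_square algebra_simps diff_divide_distrib add_divide_distrib)
    also have "\<dots> \<le> exp (a\<^sup>2 / 2 - w\<^sup>2 / 2)"
      using that by (simp add: power_mono divide_right_mono)
    also have "\<dots> = exp (a\<^sup>2 / 2) * exp (- w\<^sup>2 / 2)" by (simp flip: exp_add)
    finally have "norm (k (complex_of_real w - \<i> * b)) \<le> (exp (a\<^sup>2 / 2) * exp (- w\<^sup>2 / 2)) * B"
      unfolding k_def norm_mult using that by (intro mult_mono bd) (auto simp: B0)
    then show ?thesis by (simp add: mult_ac)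
  qed
  have kcont: "continuous_on UNIV k" using khol holomorphic_on_imp_continuous_on by blast
  have km[measurable]: "k \<in> borel_measurable borel"
    using kcont by (rule borel_measurable_continuous_onI)
  have gint: "integrable lborel (\<lambda>w. exp (a\<^sup>2 / 2) * B * exp (- w\<^sup>2 / 2 :: real))"
  proof -
    have "integrable lborel (\<lambda>w. (exp (a\<^sup>2 / 2) * B * sqrt (2 * pi)) * std_normal_density w)"
      by (intro integrable_mult_right) (simp add: integrable_normal_density)
    then show ?thesis by (simp add: std_normal_density_def mult_ac)
  qed
  have int: "integrable lborel (\<lambda>w. k (complex_of_real w - \<i> * b))" if "0 \<le> b" "b \<le> a" for b :: real
  proof (rule Bochner_Integration.integrable_bound[OF gint])
    show "AE x in lborel. norm (k (complex_of_real x - \<i> * complex_of_real b)) \<le> norm (exp (a\<^sup>2 / 2) * B * exp (- x\<^sup>2 / 2))"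
      using nk[OF that] B0 by (auto simp: abs_mult)
  qed measurable
  have lim: "(\<lambda>j::nat. G (complex_of_real (real j) - \<i> * b) - G (complex_of_real (- real j) - \<i> * b))
      \<longlonglongrightarrow> (\<integral>w. k (complex_of_real w - \<i> * b) \<partial>lborel)" if b: "0 \<le> b" "b \<le> a" for b :: real
  proof -
    have "G (complex_of_real (real j) - \<i> * b) - G (complex_of_real (- real j) - \<i> * b)
        = (\<integral>w. indicator {- real j..real j} w *\<^sub>R k (complex_of_real w - \<i> * b) \<partial>lborel)" for j
    proof -
      have "(LBINT w=- real j..real j. k (complex_of_real w - \<i> * b))
         = G (complex_of_real (real j) - \<i> * b) - G (complex_of_real (- real j) - \<i> * b)"
      proof (rule interval_integral_FTC_finite)
        show "continuous_on {min (- real j) (real j)..max (- real j) (real j)} (\<lambda>w. k (complex_of_real w - \<i> * complex_of_real b))"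
          by (intro continuous_on_compose2[OF kcont] continuous_intros) auto
        fix x
        have "((\<lambda>w. complex_of_real w - \<i> * b) has_vector_derivative 1) (at x within {min (- real j) (real j)..max (- real j) (real j)})"
          unfolding has_vector_derivative_def by (auto intro!: derivative_eq_intros simp: scaleR_conv_of_real)
        from field_vector_diff_chain_within[OF this has_field_derivative_at_within[OF G]]
        show "((\<lambda>w. G (complex_of_real w - \<i> * complex_of_real b)) has_vector_derivative
              k (complex_of_real x - \<i> * complex_of_real b)) (at x within {min (- real j) (real j)..max (- real j) (real j)})"
          by (simp add: o_def)
      qed
      then show ?thesis
        by (simp add: interval_integral_Icc set_lebesgue_integral_def)
    qed
    moreover have "(\<lambda>j. \<integral>w. indicator {- real j..real j} w *\<^sub>R k (complex_of_real w - \<i> * b) \<partial>lborel)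
       \<longlonglongrightarrow> (\<integral>w. k (complex_of_real w - \<i> * b) \<partial>lborel)"
    proof (rule integral_dominated_convergence[where w = "\<lambda>w. norm (k (complex_of_real w - \<i> * b))"])
      show "integrable lborel (\<lambda>w. norm (k (complex_of_real w - \<i> * b)))" using int[OF b] by auto
      show "AE x in lborel. (\<lambda>j. indicator {- real j..real j} x *\<^sub>R k (complex_of_real x - \<i> * b)) \<longlonglongrightarrow> k (complex_of_real x - \<i> * b)"
      proof (intro AE_I2 tendsto_eventually)
        fix x :: real
        obtain N :: nat where "\<bar>x\<bar> \<le> real N" using real_arch_simple by blast
        then show "\<forall>\<^sub>F j in sequentially. indicator {- real j..real j} x *\<^sub>R k (complex_of_real x - \<i> * b) = k (complex_of_real x - \<i> * b)"
          by (intro eventually_sequentiallyI[of N]) (auto simp: indicator_def)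
      qed
    qed (auto simp: indicator_def)
    ultimately show ?thesis by simp
  qed
  \<comment> \<open>\<open>c\<close> is 1 for the right side of the rectangle and -1 for the left; a
    derivative bound along the side, of length \<open>a\<close>, controls the increment of the
    primitive.\<close>
  have vert: "(\<lambda>j::nat. G (complex_of_real (c * real j)) - G (complex_of_real (c * real j) - \<i> * a)) \<longlonglongrightarrow> 0"
    if c: "\<bar>c\<bar> = 1" for c :: real
  proof (rule Lim_null_comparison)
    show "\<forall>\<^sub>F j in sequentially. norm (G (complex_of_real (c * real j)) - G (complex_of_real (c * real j) - \<i> * a))
            \<le> exp (a\<^sup>2 / 2) * B * exp (- (real j)\<^sup>2 / 2) * a"
    proof (intro always_eventually allI)
      fix j :: nat
      let ?w = "c * real j"
      have c2: "?w\<^sup>2 = (real j)\<^sup>2" using c by (auto simp: power_mult_distrib abs_square_eq_1[symmetric] power2_eq_1_iff abs_if split: if_splits)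
      have "norm (G (complex_of_real ?w) - G (complex_of_real ?w - \<i> * a))
          \<le> exp (a\<^sup>2 / 2) * B * exp (- (real j)\<^sup>2 / 2) * norm (complex_of_real ?w - (complex_of_real ?w - \<i> * a))"
      proof (rule field_differentiable_bound[where f' = k and S = "closed_segment (complex_of_real ?w) (complex_of_real ?w - \<i> * a)"])
        fix z assume "z \<in> closed_segment (complex_of_real ?w) (complex_of_real ?w - \<i> * a)"
        then obtain u where u: "0 \<le> u" "u \<le> 1" "z = complex_of_real ?w - \<i> * (u * a)"
          by (auto simp: closed_segment_def algebra_simps scaleR_conv_of_real)
        have "norm (k (complex_of_real ?w - \<i> * complex_of_real (u * a))) \<le> exp (a\<^sup>2 / 2) * B * exp (- ?w\<^sup>2 / 2)"
          using u(1,2) a by (intro nk) (auto intro: mult_left_le_one_le)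
        then show "norm (k z) \<le> exp (a\<^sup>2 / 2) * B * exp (- (real j)\<^sup>2 / 2)"
          using u(3) c2 by simp
      qed (auto intro: DERIV_subset G)
      then show "norm (G (complex_of_real ?w) - G (complex_of_real ?w - \<i> * a)) \<le> exp (a\<^sup>2 / 2) * B * exp (- (real j)\<^sup>2 / 2) * a"
        using a by (simp add: norm_mult)
    qed
    have "(\<lambda>j. exp (- (real j)\<^sup>2 / 2)) \<longlonglongrightarrow> 0"
      by real_asymp
    then show "(\<lambda>j. exp (a\<^sup>2 / 2) * B * exp (- (real j)\<^sup>2 / 2) * a) \<longlonglongrightarrow> 0"
      by (intro tendsto_mult_left_zero tendsto_mult_right_zero)
  qed
  have "(\<lambda>j::nat. (G (complex_of_real (real j) - \<i> * 0) - G (complex_of_real (- real j) - \<i> * 0))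
        - (G (complex_of_real (real j) - \<i> * a) - G (complex_of_real (- real j) - \<i> * a)))
       \<longlonglongrightarrow> (\<integral>w. k (complex_of_real w - \<i> * of_real 0) \<partial>lborel) - (\<integral>w. k (complex_of_real w - \<i> * a) \<partial>lborel)"
    using lim[of 0] lim[of a] a by (intro tendsto_diff) auto
  moreover have "(\<lambda>j::nat. (G (complex_of_real (real j) - \<i> * 0) - G (complex_of_real (- real j) - \<i> * 0))
        - (G (complex_of_real (real j) - \<i> * a) - G (complex_of_real (- real j) - \<i> * a))) \<longlonglongrightarrow> 0 - 0"
    using tendsto_diff[OF vert[of 1] vert[of "-1"]] by (simp add: algebra_simps)
  ultimately have "(\<integral>w. k (complex_of_real w - \<i> * of_real 0) \<partial>lborel) = (\<integral>w. k (complex_of_real w - \<i> * a) \<partial>lborel)"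
    using LIMSEQ_unique by fastforce
  then show "(\<integral>q. exp (- (complex_of_real q + \<i> * a)\<^sup>2 / 2) * H q \<partial>lborel)
       = (\<integral>w. exp (- (complex_of_real w)\<^sup>2 / 2) * H (complex_of_real w - \<i> * a) \<partial>lborel)"
    by (simp add: k_def)
  show "integrable lborel (\<lambda>q. exp (- (complex_of_real q + \<i> * a)\<^sup>2 / 2) * H q)"
    using int[of 0] a by (simp add: k_def)
  show "integrable lborel (\<lambda>w. exp (- (complex_of_real w)\<^sup>2 / 2) * H (complex_of_real w - \<i> * a))"
    using int[of a] a by (simp add: k_def)
qed

lemma exp_taylor1:
  fixes z :: "'a::{banach,real_normed_field}"
  shows "norm (exp z - 1) \<le> exp (norm z) * norm z"
    and "norm (exp z - 1 - z) \<le> exp (norm z) * (norm z)\<^sup>2"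
  using Taylor_exp_field[of z 0] Taylor_exp_field[of z 1]
  by (simp_all add: numeral_2_eq_2 algebra_simps)

text \<open>A majorant, up to a constant, of \<open>phi_integrand q\<close> for all q in a bounded
  part of the strip of depth \<open>b\<close>: quadratic near 0, where the measure may have infinite
  mass, and growing like exp (b u) to the right.\<close>

definition levy_bound :: "real \<Rightarrow> real \<Rightarrow> real" where
  "levy_bound b u = (if \<bar>u\<bar> \<le> 1 then u\<^sup>2 else 1 + exp (b * u))"

lemma levy_bound_nonneg: "levy_bound b u \<ge> 0"
  by (simp add: levy_bound_def add_nonneg_nonneg)

text \<open>Covers two regimes: near 0 the Taylor remainders cost r^2 exp r + 3 r, with 3 a bound
  for exp 1, and away from 0 the triangle inequality costs 3 r + 2.\<close>

definition levy_const :: "real \<Rightarrow> real" where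
  "levy_const r = r\<^sup>2 * exp r + 3 * r + 2"

text \<open>The linear parts i q u of the exponential and of the compensator cancel, so near 0 only
  quadratic remainders are left. Away from 0 the modulus of exp (i q u) is exp (- Im q u), which at
  depth between 0 and \<open>b\<close> is at most 1 + exp (b u) on either half-line;
  \<open>b \<ge> 1\<close> gives the same bound for exp u.\<close>

lemma norm_phi_integrand_le:
  assumes "b \<ge> 1" "- b \<le> Im q" "Im q \<le> 0" "norm q \<le> r"
  shows "norm (phi_integrand q u) \<le> levy_const r * levy_bound b u"
proof (cases "\<bar>u\<bar> \<le> 1")
  case True
  let ?z = "\<i> * q * complex_of_real u"
  have r: "r \<ge> 0" using assms(4) norm_ge_zero order_trans by blast
  have nz: "norm ?z \<le> r * \<bar>u\<bar>" using assms(4) by (simp add: norm_mult mult_right_mono)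
  have nz1: "norm ?z \<le> r" using order_trans[OF nz mult_left_mono[OF True r]] by simp
  have eq: "phi_integrand q u = (exp ?z - 1 - ?z) - \<i> * q * (exp (complex_of_real u) - 1 - complex_of_real u)"
    by (simp add: phi_integrand_def algebra_simps)
  have "norm (exp ?z - 1 - ?z) \<le> exp (norm ?z) * (norm ?z)\<^sup>2" by (rule exp_taylor1)
  also have "\<dots> \<le> exp r * (r * \<bar>u\<bar>)\<^sup>2"
    using nz nz1 by (intro mult_mono power_mono) auto
  finally have A: "norm (exp ?z - 1 - ?z) \<le> exp r * r\<^sup>2 * u\<^sup>2" by (simp add: power_mult_distrib)
  have "norm (exp (complex_of_real u) - 1 - complex_of_real u) \<le> exp \<bar>u\<bar> * u\<^sup>2"
    using exp_taylor1(2)[of "complex_of_real u"] by simp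
  also have "\<dots> \<le> 3 * u\<^sup>2"
    using exp_le True order_trans[of "exp \<bar>u\<bar>" "exp 1" 3] by (intro mult_right_mono) auto
  finally have "norm (\<i> * q * (exp (complex_of_real u) - 1 - complex_of_real u)) \<le> r * (3 * u\<^sup>2)"
    unfolding norm_mult using assms(4) r by (intro mult_mono) auto
  with A have "norm (phi_integrand q u) \<le> exp r * r\<^sup>2 * u\<^sup>2 + r * (3 * u\<^sup>2)"
    unfolding eq using norm_triangle_ineq4 add_mono order_trans by blast
  also have "\<dots> \<le> levy_const r * levy_bound b u"
    using True by (simp add: levy_const_def levy_bound_def algebra_simps)
  finally show ?thesis .
next
  case False
  have r: "r \<ge> 0" using assms(4) norm_ge_zero order_trans by blast
  have b: "b \<ge> 0" using assms by linarith
  have e1: "exp (- (Im q * u)) \<le> 1 + exp (b * u)"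
  proof (cases "u \<ge> 0")
    case True
    then have "- Im q * u \<le> b * u" using assms(2) by (intro mult_right_mono) auto
    then show ?thesis by (simp add: add_increasing)
  next
    case F: False
    then have "- (Im q * u) \<le> 0" using assms(3) by (simp add: mult_nonpos_nonpos)
    then show ?thesis by (smt (verit) exp_le_one_iff exp_gt_zero)
  qed
  have e2: "norm (exp (complex_of_real u) - 1) \<le> 2 + exp u"
    by (rule order_trans[OF norm_triangle_ineq4]) simp
  have e3: "exp u \<le> 1 + exp (b * u)"
  proof (cases "u \<ge> 0")
    case True
    then have "1 * u \<le> b * u" using assms(1) by (intro mult_right_mono) auto
    then show ?thesis by (simp add: add_increasing)
  next
    case F: False
    then have "exp u \<le> 1" by simp
    then show ?thesis by (smt (verit) exp_gt_zero)
  qed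
  have "norm (phi_integrand q u) \<le> norm (exp (\<i> * q * complex_of_real u) - 1) + norm (\<i> * q * (exp (complex_of_real u) - 1))"
    unfolding phi_integrand_def by (rule norm_triangle_ineq4)
  also have "\<dots> \<le> (exp (- (Im q * u)) + 1) + r * (2 + exp u)"
    using assms(4) r e2 norm_triangle_ineq4[of "exp (\<i> * q * complex_of_real u)" 1]
    by (intro add_mono) (auto simp: norm_mult intro!: mult_mono)
  also have "\<dots> \<le> (1 + exp (b * u)) + (1 + exp (b * u)) + r * (2 * (1 + exp (b * u)) + (1 + exp (b * u)))"
    using e1 e3 r by (intro add_mono mult_left_mono) auto
  also have "\<dots> = (2 + 3 * r) * (1 + exp (b * u))" by (simp add: algebra_simps)
  also have "\<dots> \<le> levy_const r * levy_bound b u"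
    unfolding levy_bound_def using False by (auto simp: levy_const_def intro!: mult_right_mono)
  finally show ?thesis .
qed

lemma phi_integrand_imag:
  "phi_integrand (- \<i> * of_nat m) u = complex_of_real (exp (real m * u) - 1 - real m * (exp u - 1))"
  by (simp add: phi_integrand_def flip: exp_of_real)

text \<open>Differentiation under the integral with an explicit error: on [-k, k] the difference
  quotient deviates from the derivative by at most |h| times a multiple of u^2, and u^2 is
  integrable even when the measure has infinite mass near 0.\<close>

lemma holomorphic_phi_truncated:
  assumes [measurable_cong]: "sets nu = sets borel"
    and int: "integrable nu (\<lambda>u. indicator {-k..k} u * u\<^sup>2)"
    and int2: "\<And>q. integrable nu (\<lambda>u. indicator {-k..k} u *\<^sub>R phi_integrand q u)"
    and k: "k \<ge> 0"
  shows "(\<lambda>q. \<integral>u. indicator {-k..k} u *\<^sub>R phi_integrand q u \<partial>nu) holomorphic_on UNIV"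
proof (rule holomorphic_onI)
  fix q :: complex
  define F where "F q = (\<integral>u. indicator {-k..k} u *\<^sub>R phi_integrand q u \<partial>nu)" for q
  \<comment> \<open>The derivative of \<open>phi_integrand\<close> in q. Its two summands are each
    of order u at 0, which need not be integrable; their linear parts cancel and leave order
    u^2.\<close>
  define g where "g u = \<i> * complex_of_real u * exp (\<i> * q * complex_of_real u) - \<i> * (exp (complex_of_real u) - 1)" for u
  have g: "integrable nu (\<lambda>u. indicator {-k..k} u *\<^sub>R g u)"
  proof (rule Bochner_Integration.integrable_bound[OF integrable_mult_right[OF int, where c = "norm q * exp (norm q * k) + exp k"]])
    show "(\<lambda>u. indicator {-k..k} u *\<^sub>R g u) \<in> borel_measurable nu" unfolding g_def by measurable
    show "AE u in nu. norm (indicator {-k..k} u *\<^sub>R g u) \<le> norm ((norm q * exp (norm q * k) + exp k) * (indicator {-k..k} u * u\<^sup>2))"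
    proof (intro AE_I2)
      fix u :: real
      show "norm (indicator {-k..k} u *\<^sub>R g u) \<le> norm ((norm q * exp (norm q * k) + exp k) * (indicator {-k..k} u * u\<^sup>2))"
      proof (cases "u \<in> {-k..k}")
        case True
        then have u: "\<bar>u\<bar> \<le> k" by auto
        let ?z = "\<i> * q * complex_of_real u"
        have eq: "g u = \<i> * complex_of_real u * (exp ?z - 1) - \<i> * (exp (complex_of_real u) - 1 - complex_of_real u)"
          by (simp add: g_def algebra_simps)
        have "norm (exp ?z - 1) \<le> exp (norm ?z) * norm ?z" by (rule exp_taylor1)
        also have "\<dots> \<le> exp (norm q * k) * (norm q * \<bar>u\<bar>)"
          using u by (intro mult_mono) (auto simp: norm_mult mult_left_mono)
        finally have "norm (\<i> * complex_of_real u * (exp ?z - 1)) \<le> \<bar>u\<bar> * (exp (norm q * k) * (norm q * \<bar>u\<bar>))"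
          by (simp add: norm_mult mult_left_mono)
        also have "\<dots> = norm q * exp (norm q * k) * u\<^sup>2" by (simp add: power2_eq_square abs_mult_self_eq mult_ac)
        finally have A: "norm (\<i> * complex_of_real u * (exp ?z - 1)) \<le> norm q * exp (norm q * k) * u\<^sup>2" .
        have "norm (exp (complex_of_real u) - 1 - complex_of_real u) \<le> exp \<bar>u\<bar> * u\<^sup>2"
          using exp_taylor1(2)[of "complex_of_real u"] by simp
        also have "\<dots> \<le> exp k * u\<^sup>2" using u by (intro mult_right_mono) auto
        finally have "norm (\<i> * (exp (complex_of_real u) - 1 - complex_of_real u)) \<le> exp k * u\<^sup>2"
          by (simp add: norm_mult)
        with A have "norm (g u) \<le> norm q * exp (norm q * k) * u\<^sup>2 + exp k * u\<^sup>2"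
          unfolding eq using norm_triangle_ineq4 add_mono order_trans by blast
        then show ?thesis using True by (simp add: algebra_simps abs_of_nonneg add_nonneg_nonneg)
      qed auto
    qed
  qed
  define C where "C = exp (norm q * k) * exp k * (\<integral>u. indicator {-k..k} u * u\<^sup>2 \<partial>nu)"
  have bound: "norm ((F (q + h) - F q) / h - (\<integral>u. indicator {-k..k} u *\<^sub>R g u \<partial>nu)) \<le> C * norm h"
    if h: "h \<noteq> 0" "norm h \<le> 1" for h
  proof -
    have diff_eq: "(F (q + h) - F q) / h - (\<integral>u. indicator {-k..k} u *\<^sub>R g u \<partial>nu)
       = (\<integral>u. (indicator {-k..k} u *\<^sub>R phi_integrand (q + h) u - indicator {-k..k} u *\<^sub>R phi_integrand q u) / h - indicator {-k..k} u *\<^sub>R g u \<partial>nu)"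
      unfolding F_def using int2 g h
      by (subst Bochner_Integration.integral_diff) (auto intro!: integrable_divide Bochner_Integration.integrable_diff)
    have "norm (\<integral>u. (indicator {-k..k} u *\<^sub>R phi_integrand (q + h) u - indicator {-k..k} u *\<^sub>R phi_integrand q u) / h - indicator {-k..k} u *\<^sub>R g u \<partial>nu) \<le> (\<integral>u. exp (norm q * k) * exp k * norm h * (indicator {-k..k} u * u\<^sup>2) \<partial>nu)"
    proof (rule Bochner_Integration.integral_norm_bound_integral)
      show "integrable nu (\<lambda>u. (indicator {-k..k} u *\<^sub>R phi_integrand (q + h) u - indicator {-k..k} u *\<^sub>R phi_integrand q u) / h - indicator {-k..k} u *\<^sub>R g u)"
        using int2 g h by (auto intro!: integrable_divide Bochner_Integration.integrable_diff)
      show "integrable nu (\<lambda>u. exp (norm q * k) * exp k * norm h * (indicator {-k..k} u * u\<^sup>2))"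
        using int by (intro integrable_mult_right) auto
      fix u
      show "norm ((indicator {-k..k} u *\<^sub>R phi_integrand (q + h) u - indicator {-k..k} u *\<^sub>R phi_integrand q u) / h - indicator {-k..k} u *\<^sub>R g u)
          \<le> exp (norm q * k) * exp k * norm h * (indicator {-k..k} u * u\<^sup>2)"
      proof (cases "u \<in> {-k..k}")
        case True
        then have u: "\<bar>u\<bar> \<le> k" by auto
        let ?z = "\<i> * q * complex_of_real u" and ?y = "\<i> * h * complex_of_real u"
        \<comment> \<open>The compensator is linear in q and drops out, so what remains is the
          quadratic Taylor remainder of the exponential in h.\<close>
        have eq: "(phi_integrand (q + h) u - phi_integrand q u) / h - g u = exp ?z * (exp ?y - 1 - ?y) / h"
          using h by (simp add: phi_integrand_def g_def field_simps exp_add)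
        have "norm ?z \<le> norm q * k" "norm ?y \<le> k"
          using u h mult_mono[of "norm h" 1 "\<bar>u\<bar>" k] by (auto simp: norm_mult mult_left_mono)
        then have "exp (norm ?z) \<le> exp (norm q * k)" "exp (norm ?y) * (norm ?y)\<^sup>2 \<le> exp k * (norm ?y)\<^sup>2"
          by (simp_all only: exp_le_cancel_iff mult_right_mono zero_le_power2)
        then have "norm (exp ?z) \<le> exp (norm q * k)" "norm (exp ?y - 1 - ?y) \<le> exp k * (norm ?y)\<^sup>2"
          using norm_exp[of ?z] exp_taylor1(2)[of ?y] by linarith+
        then have "norm (exp ?z * (exp ?y - 1 - ?y)) \<le> exp (norm q * k) * (exp k * (norm ?y)\<^sup>2)"
          by (subst norm_mult) (intro mult_mono, auto)
        also have "\<dots> = exp (norm q * k) * exp k * (norm h)\<^sup>2 * u\<^sup>2"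
          by (simp add: norm_mult power_mult_distrib)
        finally have "norm (exp ?z * (exp ?y - 1 - ?y) / h) \<le> exp (norm q * k) * exp k * (norm h)\<^sup>2 * u\<^sup>2 / norm h"
          by (simp add: norm_divide divide_right_mono)
        also have "\<dots> = exp (norm q * k) * exp k * norm h * u\<^sup>2"
          using h by (simp add: power2_eq_square)
        finally show ?thesis using True eq by simp
      qed auto
    qed
    also have "\<dots> = exp (norm q * k) * exp k * norm h * (\<integral>u. indicator {-k..k} u * u\<^sup>2 \<partial>nu)"
      by (rule integral_mult_right_zero)
    also have "\<dots> = C * norm h" unfolding C_def by (simp only: mult_ac)
    finally show ?thesis unfolding diff_eq .
  qed
  have "((\<lambda>h. (F (q + h) - F q) / h - (\<integral>u. indicator {-k..k} u *\<^sub>R g u \<partial>nu)) \<longlongrightarrow> 0) (at 0)"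
  proof (rule Lim_null_comparison)
    show "\<forall>\<^sub>F h in at 0. norm ((F (q + h) - F q) / h - (\<integral>u. indicator {-k..k} u *\<^sub>R g u \<partial>nu)) \<le> C * norm h"
      unfolding eventually_at by (intro exI[of _ 1]) (auto intro!: bound)
    show "((\<lambda>h. C * norm h) \<longlongrightarrow> 0) (at (0::complex))"
      by (intro tendsto_mult_right_zero tendsto_norm_zero tendsto_ident_at)
  qed
  then have "(F has_field_derivative (\<integral>u. indicator {-k..k} u *\<^sub>R g u \<partial>nu)) (at q)"
    unfolding DERIV_def by (simp add: LIM_zero_iff)
  then show "(\<lambda>q. \<integral>u. indicator {-k..k} u *\<^sub>R phi_integrand q u \<partial>nu) field_differentiable at q within UNIV"
    unfolding F_def field_differentiable_def by auto
qed

section \<open>Integrability and bounds for the cumulant function in the strip\<close>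

locale spectral =
  fixes s2 :: real and M :: "real \<Rightarrow> real" and nu :: "real measure" and n :: nat
  assumes s2: "s2 \<ge> 0" and spec: "spectral_function M nu"
    and spec_int: "spectral_integrable nu n" and n2: "n \<ge> 2"
begin

lemma sets_nu[measurable_cong]: "sets nu = sets borel"
  using spec by (simp add: spectral_function_def)

text \<open>Monotonicity and the limits 0 at both ends make \<open>M\<close> nonpositive on the
  right half-line and nonnegative on the left. Each bounded piece of a tail then has mass at most -
  M 1, respectively M (-1), and the tail is an increasing union of such pieces.\<close>

lemma emeasure_tails: "emeasure nu {1<..} < \<infinity>" "emeasure nu {..-1} < \<infinity>"
proof -
  have M: "mono_on {..<0} M" "mono_on {0<..} M" "(M \<longlongrightarrow> 0) at_top" "(M \<longlongrightarrow> 0) at_bot"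
    "\<And>a b. a \<le> b \<Longrightarrow> b < 0 \<Longrightarrow> emeasure nu {a<..b} = ennreal (M b - M a)"
    "\<And>a b. 0 < a \<Longrightarrow> a \<le> b \<Longrightarrow> emeasure nu {a<..b} = ennreal (M b - M a)"
    using spec by (auto simp: spectral_function_def)
  have neg: "M x \<le> 0" if "x > 0" for x
  proof (rule tendsto_lowerbound[OF M(3)])
    show "\<forall>\<^sub>F i in at_top. M x \<le> M i"
      using eventually_ge_at_top[of x] by eventually_elim (use that in \<open>auto intro: mono_onD[OF M(2)]\<close>)
  qed simp
  have pos: "M x \<ge> 0" if "x < 0" for x
  proof (rule tendsto_upperbound[OF M(4)])
    show "\<forall>\<^sub>F i in at_bot. M i \<le> M x"
      using eventually_le_at_bot[of x] by eventually_elim (use that in \<open>auto intro: mono_onD[OF M(1)]\<close>)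
  qed simp
  have "emeasure nu {1<..} = (SUP j. emeasure nu {1<..1 + real j})"
  proof -
    have "{1<..} = (\<Union>j. {1<..1 + real j})"
    proof (auto)
      fix x :: real obtain j :: nat where "x \<le> real j" using real_arch_simple by blast
      then show "\<exists>j. x \<le> 1 + real j" by (intro exI[of _ j]) auto
    qed
    then show ?thesis by (subst SUP_emeasure_incseq) (auto simp: incseq_def sets_nu)
  qed
  also have "\<dots> \<le> ennreal (- M 1)"
    by (rule SUP_least) (auto simp: M(6) intro!: ennreal_leI neg)
  finally show "emeasure nu {1<..} < \<infinity>" by (rule order.strict_trans1) simp
  have "emeasure nu {..-1} = (SUP j. emeasure nu {-1 - real j<..-1})"
  proof -
    have "{..-1} = (\<Union>j. {-1 - real j<..-1})"
    proof (auto)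
      fix x :: real obtain j :: nat where "- x \<le> real j" using real_arch_simple by blast
      then show "\<exists>j. -1 - real j < x" by (intro exI[of _ j]) auto
    qed
    then show ?thesis by (subst SUP_emeasure_incseq) (auto simp: incseq_def sets_nu)
  qed
  also have "\<dots> \<le> ennreal (M (-1))"
    by (rule SUP_least) (auto simp: M(5) intro!: ennreal_leI pos)
  finally show "emeasure nu {..-1} < \<infinity>" by (rule order.strict_trans1) simp
qed

text \<open>The compensator cannot cancel exp (n u) on the right tail. With x = exp u the claim
  follows from 8 n x \<le> 7 x^n, and x \<ge> 5 / 2 suffices for this from exponent 2 onward (16
  \<le> 17.5 starts the induction).\<close>

lemma exp_dominated_phi_integrand:
  assumes "u > 1"
  shows "exp (real n * u) \<le> 8 * Re (phi_integrand (- \<i> * of_nat n) u)"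
proof -
  define x where "x = exp u"
  have "5 / 2 \<le> exp (1::real)" using exp_lower_Taylor_quadratic[of 1] by simp
  also have "\<dots> \<le> x" using assms by (simp add: x_def)
  finally have x: "x \<ge> 5 / 2" .
  have "8 * real k \<le> 7 * x ^ (k - 1)" if "k \<ge> 2" for k
    using that
  proof (induction k rule: dec_induct)
    case base then show ?case using x by simp
  next
    case (step k)
    have "real k \<ge> 2" using step by simp
    then have "8 * real (Suc k) \<le> 5 / 2 * (8 * real k)" by simp
    also have "\<dots> \<le> x * (7 * x ^ (k - 1))" using x by (intro mult_mono[OF x step(3)]) auto
    also have "\<dots> = 7 * x ^ (Suc k - 1)" using step by (simp flip: power_Suc)
    finally show ?case .
  qed
  from mult_right_mono[OF this[OF n2], of x] x have "8 * real n * x \<le> 7 * (x ^ (n - 1) * x)" by simp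
  also have "x ^ (n - 1) * x = x ^ n" using n2 by (intro power_minus_mult) simp
  finally have "x ^ n \<le> 8 * (x ^ n - 1 - real n * (x - 1))"
    using n2 by (simp add: algebra_simps)
  moreover have "exp (real n * u) = x ^ n" by (simp add: x_def exp_of_nat_mult)
  ultimately show ?thesis unfolding phi_integrand_imag x_def by simp
qed

text \<open>This one majorant makes all integrals over the strip converge. The square near 0 is
  integrable for a spectral function, the tails have finite mass, and exp (n u) on the right is
  dominated by the integrand at - i n. The left tail gets weight 2 because 1 + exp (n u) is at most
  2 there.\<close>

lemma integrable_levy_bound: "integrable nu (levy_bound n)"
proof -
  have i1: "integrable nu (\<lambda>u. indicator {-1..1} u * u\<^sup>2)"
  proof (rule integrableI_nonneg)
    show "(\<integral>\<^sup>+ u. ennreal (indicator {-1..1} u * u\<^sup>2) \<partial>nu) < \<infinity>"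
      using spec by (simp add: spectral_function_def ennreal_mult' ennreal_indicator)
  qed auto
  have i2: "integrable nu (\<lambda>u. indicator {1<..} u :: real)" "integrable nu (\<lambda>u. indicator {..-1} u :: real)"
    using emeasure_tails by (auto simp: integrable_indicator_iff sets_nu)
  have i3: "integrable nu (phi_integrand (- \<i> * of_nat n))"
    using spec_int by (simp add: spectral_integrable_def)
  have "integrable nu (\<lambda>u. indicator {-1..1} u * u\<^sup>2 + indicator {1<..} u + 2 * indicator {..-1} u + 8 * norm (phi_integrand (- \<i> * of_nat n) u))"
    using i1 i2 i3 by auto
  then show ?thesis
  proof (rule Bochner_Integration.integrable_bound)
    show "levy_bound n \<in> borel_measurable nu" unfolding levy_bound_def[abs_def] by measurable
    show "AE u in nu. norm (levy_bound n u) \<le> norm (indicator {-1..1} u * u\<^sup>2 + indicator {1<..} u + 2 * indicator {..-1} u + 8 * norm (phi_integrand (- \<i> * of_nat n) u))"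
    proof (intro AE_I2)
      fix u
      have "exp (real n * u) \<le> 8 * norm (phi_integrand (- \<i> * of_nat n) u)" if "u > 1"
        using exp_dominated_phi_integrand[OF that] complex_Re_le_cmod[of "phi_integrand (- \<i> * of_nat n) u"] by linarith
      moreover have "levy_bound n u \<le> 2" if "u < -1"
        using that by (simp add: levy_bound_def mult_nonneg_nonpos)
      ultimately have "levy_bound n u \<le> indicator {-1..1} u * u\<^sup>2 + indicator {1<..} u + 2 * indicator {..-1} u + 8 * norm (phi_integrand (- \<i> * of_nat n) u)"
        using norm_ge_zero[of "phi_integrand (- \<i> * of_nat n) u"] not_less[of u "-1"]
        by (cases "u < -1") (auto simp: levy_bound_def indicator_def abs_le_iff not_le mult_nonneg_nonpos simp del: norm_ge_zero intro: order_trans[of _ 1])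
      then show "norm (levy_bound n u) \<le> norm (indicator {-1..1} u * u\<^sup>2 + indicator {1<..} u + 2 * indicator {..-1} u + 8 * norm (phi_integrand (- \<i> * of_nat n) u))"
        using levy_bound_nonneg[of n u] by simp
    qed
  qed
qed

lemma n1: "real n \<ge> 1"
  using n2 by simp

text \<open>A block of \<open>N\<close> consecutive indices has \<open>N - m\<close> pairs at
  distance \<open>m\<close>. Taking the pair sum as the definition makes monotonicity and
  nonnegativity available for every \<open>N\<close>; the equality with \<phi>(- i N) is established
  for \<open>N \<le> n\<close>.\<close>

definition \<Phi> :: "nat \<Rightarrow> real" where
  "\<Phi> N = (\<Sum>m\<in>{1..<N}. real (N - m) * dfun s2 nu m)"

lemma phi_integrand_measurable[measurable]: "phi_integrand q \<in> borel_measurable borel"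
  unfolding phi_integrand_def[abs_def] by measurable

lemma integrable_phi_integrand:
  assumes "- real n \<le> Im q" "Im q \<le> 0"
  shows "integrable nu (phi_integrand q)"
proof (rule Bochner_Integration.integrable_bound[OF integrable_mult_right[OF integrable_levy_bound, of "levy_const (norm q)"]])
  show "AE u in nu. norm (phi_integrand q u) \<le> norm (levy_const (norm q) * levy_bound n u)"
    by (intro AE_I2 order_trans[OF norm_phi_integrand_le[OF n1 assms order_refl]]) simp
qed measurable

text \<open>The integral over \<open>[- k, k]\<close> is entire in \<open>q\<close>, so contours can be shifted before \<open>k \<rightarrow> \<infinity>\<close>, and the limit is needed
  only on the two boundary lines of the strip, where \<open>\<phi>\<close> itself is just continuous.\<close>

definition phi_trunc :: "nat \<Rightarrow> complex \<Rightarrow> complex" where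
  "phi_trunc k q = - \<i> * q * of_real s2 / 2 - q^2 * of_real s2 / 2
     + (\<integral>u. indicator {-real k..real k} u *\<^sub>R phi_integrand q u \<partial>nu)"

lemma integrable_truncated_square: "integrable nu (\<lambda>u. indicator {-real k..real k} u * u\<^sup>2)"
proof (rule Bochner_Integration.integrable_bound[OF integrable_mult_right[OF integrable_levy_bound, of "1 + (real k)\<^sup>2"]])
  show "AE u in nu. norm (indicator {-real k..real k} u * u\<^sup>2) \<le> norm ((1 + (real k)\<^sup>2) * levy_bound n u)"
  proof (intro AE_I2)
    fix u :: real
    have "u\<^sup>2 \<le> (1 + (real k)\<^sup>2) * levy_bound n u" if "\<bar>u\<bar> \<le> real k"
    proof (cases "\<bar>u\<bar> \<le> 1")
      case True then show ?thesis by (simp add: levy_bound_def algebra_simps)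
    next
      case False
      have "u\<^sup>2 \<le> (real k)\<^sup>2" using that by (simp add: abs_le_square_iff[symmetric])
      also have "\<dots> \<le> (1 + (real k)\<^sup>2) * 1" by simp
      also have "\<dots> \<le> (1 + (real k)\<^sup>2) * levy_bound n u"
        using False by (intro mult_left_mono) (auto simp: levy_bound_def)
      finally show ?thesis .
    qed
    then show "norm (indicator {-real k..real k} u * u\<^sup>2) \<le> norm ((1 + (real k)\<^sup>2) * levy_bound n u)"
      using levy_bound_nonneg[of n u] by (auto simp: indicator_def abs_mult)
  qed
qed measurable

lemma integrable_truncated:
  "integrable nu (\<lambda>u. indicator {-real k..real k} u *\<^sub>R phi_integrand q u)"
proof (rule Bochner_Integration.integrable_bound[OF integrable_mult_right[OF integrable_truncated_square,
        of "exp (norm q * k) * (norm q)\<^sup>2 + norm q * exp k"]])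
  show "AE u in nu. norm (indicator {- real k..real k} u *\<^sub>R phi_integrand q u)
      \<le> norm ((exp (norm q * k) * (norm q)\<^sup>2 + norm q * exp k) * (indicator {- real k..real k} u * u\<^sup>2))"
  proof (intro AE_I2)
    fix u :: real
    let ?z = "\<i> * q * complex_of_real u"
    show "norm (indicator {- real k..real k} u *\<^sub>R phi_integrand q u)
      \<le> norm ((exp (norm q * k) * (norm q)\<^sup>2 + norm q * exp k) * (indicator {- real k..real k} u * u\<^sup>2))"
    proof (cases "\<bar>u\<bar> \<le> real k")
      case True
      have eq: "phi_integrand q u = (exp ?z - 1 - ?z) - \<i> * q * (exp (complex_of_real u) - 1 - complex_of_real u)"
        by (simp add: phi_integrand_def algebra_simps)
      have "norm (exp ?z - 1 - ?z) \<le> exp (norm ?z) * (norm ?z)\<^sup>2" by (rule exp_taylor1)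
      also have "\<dots> \<le> exp (norm q * k) * (norm q)\<^sup>2 * u\<^sup>2"
        unfolding mult.assoc using True by (intro mult_mono) (auto simp: norm_mult power_mult_distrib mult_left_mono)
      finally have A: "norm (exp ?z - 1 - ?z) \<le> exp (norm q * k) * (norm q)\<^sup>2 * u\<^sup>2" .
      have "norm (exp (complex_of_real u) - 1 - complex_of_real u) \<le> exp \<bar>u\<bar> * u\<^sup>2"
        using exp_taylor1(2)[of "complex_of_real u"] by simp
      also have "\<dots> \<le> exp k * u\<^sup>2" using True by (intro mult_right_mono) auto
      finally have "norm (\<i> * q * (exp (complex_of_real u) - 1 - complex_of_real u)) \<le> norm q * (exp k * u\<^sup>2)"
        by (simp add: norm_mult mult_left_mono)
      with A have "norm (phi_integrand q u) \<le> exp (norm q * k) * (norm q)\<^sup>2 * u\<^sup>2 + norm q * (exp k * u\<^sup>2)"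
        unfolding eq using norm_triangle_ineq4 add_mono order_trans by blast
      also have "\<dots> = (exp (norm q * k) * (norm q)\<^sup>2 + norm q * exp k) * u\<^sup>2"
        by (simp add: algebra_simps)
      finally show ?thesis using True by (simp add: indicator_def abs_le_iff)
    qed (auto simp: indicator_def)
  qed
qed measurable

lemma holomorphic_phi_trunc: "phi_trunc k holomorphic_on UNIV"
  using holomorphic_phi_truncated[OF sets_nu integrable_truncated_square integrable_truncated]
  unfolding phi_trunc_def[abs_def] by (intro holomorphic_intros) auto

text \<open>Bounds real parts, uniformly over the strip and over all truncations. The modulus of
  \<phi> may grow with Re q, but exp (c \<phi>) with c \<ge> 0 is controlled by the real part
  alone.\<close>

definition phi_bound :: real where
  "phi_bound = (real n)\<^sup>2 * s2 + levy_const (real n) * (\<integral>u. levy_bound n u \<partial>nu)"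

text \<open>A cosine is at most 1 and the real part of the compensator depends on Im q only, so q
  may be moved to the imaginary axis. There its modulus is at most \<open>n\<close>, which removes
  the dependence on Re q.\<close>

lemma Re_phi_integrand_le:
  assumes "- real n \<le> Im q" "Im q \<le> 0"
  shows "Re (phi_integrand q u) \<le> levy_const n * levy_bound n u"
proof -
  have "Re (phi_integrand q u) \<le> Re (phi_integrand (\<i> * Im q) u)"
    by (simp add: phi_integrand_def Re_exp exp_of_real flip: of_real_mult)
  also have "\<dots> \<le> norm (phi_integrand (\<i> * Im q) u)" by (rule complex_Re_le_cmod)
  also have "\<dots> \<le> levy_const n * levy_bound n u"
    using assms by (intro norm_phi_integrand_le n1) (auto simp: norm_mult)
  finally show ?thesis .
qed

lemma Re_gauss_le:
  assumes "- real n \<le> Im q" "Im q \<le> 0"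
  shows "Re (- \<i> * q * of_real s2 / 2 - q^2 * of_real s2 / 2) \<le> (real n)\<^sup>2 * s2"
proof -
  have "(Im q)\<^sup>2 \<le> (real n)\<^sup>2" using assms abs_le_square_iff[of "Im q" "real n"] by simp
  then have "Im q / 2 - (Re q)\<^sup>2 / 2 + (Im q)\<^sup>2 / 2 \<le> (real n)\<^sup>2"
    using assms zero_le_power2[of "Re q"] zero_le_power2[of "Im q"] by linarith
  from mult_right_mono[OF this s2] have "(Im q / 2 - (Re q)\<^sup>2 / 2 + (Im q)\<^sup>2 / 2) * s2 \<le> (real n)\<^sup>2 * s2" .
  moreover have "Re (- \<i> * q * of_real s2 / 2 - q^2 * of_real s2 / 2) = (Im q / 2 - (Re q)\<^sup>2 / 2 + (Im q)\<^sup>2 / 2) * s2"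
    by (simp add: power2_eq_square field_simps)
  ultimately show ?thesis by simp
qed

lemma Re_phi_le:
  assumes "- real n \<le> Im q" "Im q \<le> 0"
  shows "Re (phi s2 nu q) \<le> phi_bound" "Re (phi_trunc k q) \<le> phi_bound"
proof -
  have "Re (integral\<^sup>L nu (phi_integrand q)) = (\<integral>u. Re (phi_integrand q u) \<partial>nu)"
    by (simp add: integrable_phi_integrand assms)
  also have "\<dots> \<le> (\<integral>u. levy_const n * levy_bound n u \<partial>nu)"
    using integrable_levy_bound Re_phi_integrand_le[OF assms]
    by (intro integral_mono) (auto simp: integrable_phi_integrand assms)
  finally show "Re (phi s2 nu q) \<le> phi_bound"
    unfolding phi_def phi_bound_def using Re_gauss_le[OF assms] by simp
  have "Re (\<integral>u. indicator {-real k..real k} u *\<^sub>R phi_integrand q u \<partial>nu) = (\<integral>u. Re (indicator {-real k..real k} u *\<^sub>R phi_integrand q u) \<partial>nu)"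
    by (simp only: integral_Re integrable_truncated)
  also have "\<dots> \<le> (\<integral>u. levy_const n * levy_bound n u \<partial>nu)"
  proof (intro integral_mono)
    show "integrable nu (\<lambda>u. Re (indicator {-real k..real k} u *\<^sub>R phi_integrand q u))"
      by (intro integrable_Re integrable_truncated)
    fix u
    have "levy_const n \<ge> 0" by (simp add: levy_const_def)
    then show "Re (indicator {-real k..real k} u *\<^sub>R phi_integrand q u) \<le> levy_const n * levy_bound n u"
      using Re_phi_integrand_le[OF assms, of u] levy_bound_nonneg[of n u] by (auto simp: indicator_def)
  qed (use integrable_levy_bound in auto)
  finally show "Re (phi_trunc k q) \<le> phi_bound"
    unfolding phi_trunc_def phi_bound_def using Re_gauss_le[OF assms] by simp
qed

lemma phi_trunc_tendsto:
  assumes "- real n \<le> Im q" "Im q \<le> 0"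
  shows "(\<lambda>k. phi_trunc k q) \<longlonglongrightarrow> phi s2 nu q"
  unfolding phi_def phi_trunc_def
proof (intro tendsto_intros integral_dominated_convergence[where w = "\<lambda>u. norm (phi_integrand q u)"])
  show "AE u in nu. (\<lambda>k. indicator {- real k..real k} u *\<^sub>R phi_integrand q u) \<longlonglongrightarrow> phi_integrand q u"
  proof (intro AE_I2 tendsto_eventually)
    fix u :: real
    obtain N :: nat where "\<bar>u\<bar> \<le> real N" using real_arch_simple by blast
    then show "\<forall>\<^sub>F j in sequentially. indicator {- real j..real j} u *\<^sub>R phi_integrand q u = phi_integrand q u"
      by (intro eventually_sequentiallyI[of N]) (auto simp: indicator_def)
  qed
qed (use integrable_phi_integrand[OF assms] in \<open>auto simp: indicator_def\<close>)

text \<open>For use when the Gaussian regularisation is removed. The line at depth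
  \<open>m = n\<close> is the boundary of the strip, so continuity is obtained by dominated
  convergence instead of holomorphy.\<close>

lemma phi_continuous_line:
  assumes "s \<longlonglongrightarrow> (0::real)" "m \<le> n"
  shows "(\<lambda>j. phi s2 nu (complex_of_real (s j) - \<i> * of_nat m)) \<longlonglongrightarrow> phi s2 nu (- \<i> * of_nat m)"
proof -
  have lim: "(\<lambda>j. complex_of_real (s j) - \<i> * of_nat m) \<longlonglongrightarrow> - \<i> * of_nat m"
    using tendsto_diff[OF tendsto_of_real[OF assms(1)] tendsto_const[of "\<i> * of_nat m"]] by simp
  from assms(1) have "Bseq s" by (rule convergentI[THEN convergent_imp_Bseq])
  then obtain K where K: "\<And>j. \<bar>s j\<bar> \<le> K" by (auto simp: Bseq_def)
  have "(\<lambda>j. integral\<^sup>L nu (phi_integrand (complex_of_real (s j) - \<i> * of_nat m))) \<longlonglongrightarrow> integral\<^sup>L nu (phi_integrand (- \<i> * of_nat m))"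
  proof (rule integral_dominated_convergence[where w = "\<lambda>u. levy_const (K + real m) * levy_bound n u"])
    show "integrable nu (\<lambda>u. levy_const (K + real m) * levy_bound n u)" using integrable_levy_bound by auto
    show "AE u in nu. (\<lambda>j. phi_integrand (complex_of_real (s j) - \<i> * of_nat m) u) \<longlonglongrightarrow> phi_integrand (- \<i> * of_nat m) u"
      unfolding phi_integrand_def by (intro AE_I2 tendsto_intros lim)
    fix j
    have "norm (complex_of_real (s j) - \<i> * of_nat m) \<le> K + real m"
      using norm_triangle_ineq4[of "complex_of_real (s j)" "\<i> * of_nat m"] K[of j] by (simp add: norm_mult)
    then show "AE u in nu. norm (phi_integrand (complex_of_real (s j) - \<i> * of_nat m) u) \<le> levy_const (K + real m) * levy_bound n u"
      using assms(2) by (intro AE_I2 norm_phi_integrand_le n1) auto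
  qed measurable
  then show ?thesis
    unfolding phi_def by (intro tendsto_intros lim) auto
qed

lemma d_nonneg: "dfun s2 nu m \<ge> 0"
  unfolding dfun_def using s2 by (intro add_nonneg_nonneg integral_nonneg) auto

lemma \<Phi>_Suc: "\<Phi> (Suc N) = \<Phi> N + (\<Sum>m\<in>{1..N}. dfun s2 nu m)"
proof -
  have "\<Phi> (Suc N) = (\<Sum>m\<in>{1..N}. real (N - m) * dfun s2 nu m + dfun s2 nu m)"
    unfolding \<Phi>_def by (rule sum.cong) (auto simp: Suc_diff_le algebra_simps)
  also have "\<dots> = (\<Sum>m\<in>{1..N}. real (N - m) * dfun s2 nu m) + (\<Sum>m\<in>{1..N}. dfun s2 nu m)"
    by (rule sum.distrib)
  also have "(\<Sum>m\<in>{1..N}. real (N - m) * dfun s2 nu m) = \<Phi> N"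
    unfolding \<Phi>_def by (rule sum.mono_neutral_right) auto
  finally show ?thesis .
qed

lemma \<Phi>_0[simp]: "\<Phi> 0 = 0" and \<Phi>_1[simp]: "\<Phi> (Suc 0) = 0"
  by (simp_all add: \<Phi>_def)

lemma \<Phi>_mono: "N \<le> N' \<Longrightarrow> \<Phi> N \<le> \<Phi> N'"
proof (induction rule: dec_induct)
  case (step k)
  then show ?case using sum_nonneg[of "{1..k}" "dfun s2 nu"] by (simp add: \<Phi>_Suc d_nonneg)
qed simp

lemma \<Phi>_nonneg: "\<Phi> N \<ge> 0"
  using \<Phi>_mono[of 0 N] by simp

text \<open>\<open>d\<close> is the second difference of \<open>m \<mapsto> \<phi>(- i m)\<close>, which vanishes at \<open>0\<close> and \<open>1\<close>.\<close>

lemma second_difference: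
  fixes x :: real
  shows "x ^ N - 1 - real N * (x - 1) = (\<Sum>m\<in>{1..<N}. real (N - m) * (x ^ (m - 1) * (x - 1)\<^sup>2))"
proof (induction N)
  case (Suc N)
  have "(\<Sum>m\<in>{1..<Suc N}. real (Suc N - m) * (x ^ (m - 1) * (x - 1)\<^sup>2))
      = (\<Sum>m\<in>{1..N}. real (N - m) * (x ^ (m - 1) * (x - 1)\<^sup>2) + x ^ (m - 1) * (x - 1)\<^sup>2)"
    by (rule sum.cong) (auto simp: Suc_diff_le algebra_simps)
  also have "\<dots> = (\<Sum>m\<in>{1..N}. real (N - m) * (x ^ (m - 1) * (x - 1)\<^sup>2)) + (\<Sum>m\<in>{1..N}. x ^ (m - 1)) * (x - 1)\<^sup>2"
    by (simp add: sum.distrib sum_distrib_right)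
  also have "(\<Sum>m\<in>{1..N}. real (N - m) * (x ^ (m - 1) * (x - 1)\<^sup>2)) = (\<Sum>m\<in>{1..<N}. real (N - m) * (x ^ (m - 1) * (x - 1)\<^sup>2))"
    by (rule sum.mono_neutral_right) auto
  also have "(\<Sum>m\<in>{1..N}. x ^ (m - 1)) = (\<Sum>m<N. x ^ m)"
    by (rule sum.reindex_bij_witness[of _ Suc "\<lambda>m. m - 1"]) auto
  also have "(\<Sum>m<N. x ^ m) * (x - 1)\<^sup>2 = (x ^ N - 1) * (x - 1)"
    using power_diff_1_eq[of x N] by (simp add: power2_eq_square mult_ac)
  finally show ?case unfolding Suc.IH[symmetric] by (simp add: algebra_simps)
qed simp

text \<open>The jump part is \<open>second_difference\<close> at x = exp u, integrated term by term;
  in the Gaussian part, (m^2 - m) / 2 is the number of pairs in a block of \<open>m\<close>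
  indices.\<close>

lemma phi_eq_\<Phi>:
  assumes "m \<le> n"
  shows "phi s2 nu (- \<i> * of_nat m) = complex_of_real (\<Phi> m)"
proof -
  have "(\<integral>u. exp (real m * u) - 1 - real m * (exp u - 1) \<partial>nu)
     = (\<integral>u. (\<Sum>k\<in>{1..<m}. real (m - k) * (exp ((real k - 1) * u) * (exp u - 1)\<^sup>2)) \<partial>nu)"
  proof (intro Bochner_Integration.integral_cong refl)
    fix u
    show "exp (real m * u) - 1 - real m * (exp u - 1) = (\<Sum>k\<in>{1..<m}. real (m - k) * (exp ((real k - 1) * u) * (exp u - 1)\<^sup>2))"
      unfolding exp_of_nat_mult second_difference
      by (rule sum.cong) (auto simp: of_nat_diff simp flip: exp_of_nat_mult)
  qed
  also have "\<dots> = (\<Sum>k\<in>{1..<m}. real (m - k) * (\<integral>u. exp ((real k - 1) * u) * (exp u - 1)\<^sup>2 \<partial>nu))"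
    using spec_int assms by (subst Bochner_Integration.integral_sum) (auto simp: spectral_integrable_def)
  finally have I: "(\<integral>u. exp (real m * u) - 1 - real m * (exp u - 1) \<partial>nu) = (\<Sum>k\<in>{1..<m}. real (m - k) * (\<integral>u. exp ((real k - 1) * u) * (exp u - 1)\<^sup>2 \<partial>nu))" .
  have G: "(real m ^ 2 - real m) / 2 = (\<Sum>k\<in>{1..<m}. real (m - k))" for m
  proof (induction m)
    case (Suc m)
    have "(\<Sum>k\<in>{1..<Suc m}. real (Suc m - k)) = (\<Sum>k\<in>{1..m}. real (m - k) + 1)"
      by (rule sum.cong) (auto simp: Suc_diff_le)
    also have "\<dots> = (\<Sum>k\<in>{1..m}. real (m - k)) + real m" by (simp add: sum.distrib)
    also have "(\<Sum>k\<in>{1..m}. real (m - k)) = (\<Sum>k\<in>{1..<m}. real (m - k))"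
      by (rule sum.mono_neutral_right) auto
    finally show ?case unfolding Suc.IH[symmetric] by (simp add: field_simps power2_eq_square)
  qed simp
  have "phi s2 nu (- \<i> * of_nat m) = complex_of_real ((real m ^ 2 - real m) / 2 * s2 + (\<integral>u. exp (real m * u) - 1 - real m * (exp u - 1) \<partial>nu))"
    unfolding phi_def phi_integrand_imag[abs_def] integral_complex_of_real
    by (simp add: power2_eq_square field_simps)
  also have "(real m ^ 2 - real m) / 2 * s2 + (\<integral>u. exp (real m * u) - 1 - real m * (exp u - 1) \<partial>nu) = \<Phi> m"
    unfolding I G \<Phi>_def dfun_def by (simp add: sum_distrib_right distrib_left sum.distrib)
  finally show ?thesis .
qed

end

section \<open>Exponential moments from the characteristic function\<close>

lemma gauss_char_integral:
  "(\<integral>w. exp (- (complex_of_real w)\<^sup>2 / 2) * exp (\<i> * complex_of_real (t * w)) \<partial>lborel)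
     = complex_of_real (sqrt (2 * pi) * exp (- t\<^sup>2 / 2))"
proof -
  have "complex_of_real (exp (- (t^2) / 2)) = char std_normal_distribution t"
    by (simp add: char_std_normal_distribution)
  also have "\<dots> = (\<integral>w. std_normal_density w *\<^sub>R exp (\<i> * complex_of_real (t * w)) \<partial>lborel)"
    unfolding char_def by (subst integral_density) auto
  also have "\<dots> = (\<integral>w. complex_of_real (1 / sqrt (2 * pi)) * (exp (- (complex_of_real w)\<^sup>2 / 2) * exp (\<i> * complex_of_real (t * w))) \<partial>lborel)"
    by (intro Bochner_Integration.integral_cong refl)
       (simp add: std_normal_density_def scaleR_conv_of_real flip: exp_of_real)
  also have "\<dots> = complex_of_real (1 / sqrt (2 * pi)) * (\<integral>w. exp (- (complex_of_real w)\<^sup>2 / 2) * exp (\<i> * complex_of_real (t * w)) \<partial>lborel)"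
    by (rule integral_mult_right_zero)
  finally show ?thesis by (simp add: field_simps)
qed

context spectral
begin

lemma phi_line_measurable[measurable]:
  assumes "m \<le> n"
  shows "(\<lambda>w. phi s2 nu (complex_of_real (s * w) - \<i> * of_nat m)) \<in> borel_measurable borel"
proof (rule borel_measurable_LIMSEQ_metric)
  show "(\<lambda>w. phi_trunc k (complex_of_real (s * w) - \<i> * of_nat m)) \<in> borel_measurable borel" for k
  proof (rule borel_measurable_continuous_onI)
    show "continuous_on UNIV (\<lambda>w. phi_trunc k (complex_of_real (s * w) - \<i> * of_nat m))"
      by (rule continuous_on_compose2[OF holomorphic_on_imp_continuous_on[OF holomorphic_phi_trunc]])
         (auto intro!: continuous_intros)
  qed
  show "(\<lambda>k. phi_trunc k (complex_of_real (s * w) - \<i> * of_nat m)) \<longlonglongrightarrow> phi s2 nu (complex_of_real (s * w) - \<i> * of_nat m)" for w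
    using assms by (intro phi_trunc_tendsto) auto
qed

text \<open>Scaling q by \<open>s\<close> turns a shift by a = m / s into the depth \<open>m\<close>
  of the strip. All truncations obey the same bound exp (c phi_bound) there, which serves as the
  dominating factor when the truncation is removed on the two lines.\<close>

lemma shift_phi:
  fixes s a c :: real
  assumes s: "s > 0" and m: "m \<le> n" and c: "c \<ge> 0" and a: "a = real m / s"
  shows "(\<integral>q. exp (- (complex_of_real q + \<i> * a)\<^sup>2 / 2) * exp (c * phi s2 nu (complex_of_real (s * q))) \<partial>lborel)
       = (\<integral>w. exp (- (complex_of_real w)\<^sup>2 / 2) * exp (c * phi s2 nu (complex_of_real (s * w) - \<i> * of_nat m)) \<partial>lborel)"
proof -
  have a0: "a \<ge> 0" using s a by simp
  have sa: "s * a = real m" using s a by simp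
  have strip: "- real n \<le> Im (complex_of_real s * z) \<and> Im (complex_of_real s * z) \<le> 0" if "- a \<le> Im z" "Im z \<le> 0" for z
  proof -
    have "s * (- a) \<le> s * Im z" using that s by (intro mult_left_mono) auto
    then show ?thesis using that s m sa by (simp add: mult_nonneg_nonpos)
  qed
  have bd: "norm (exp (complex_of_real c * w)) \<le> exp (c * phi_bound)" if "Re w \<le> phi_bound" for w
    using that c by (simp add: mult_left_mono)
  let ?H = "\<lambda>k z. exp (complex_of_real c * phi_trunc k (complex_of_real s * z))"
  have hol: "?H k holomorphic_on UNIV" for k
  proof -
    have "(phi_trunc k \<circ> (\<lambda>z. complex_of_real s * z)) holomorphic_on UNIV"
      by (rule holomorphic_on_compose_gen[OF _ holomorphic_phi_trunc]) (auto intro!: holomorphic_intros)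
    then show ?thesis by (intro holomorphic_intros) (simp add: o_def)
  qed
  have bound: "norm (?H k z) \<le> exp (c * phi_bound)" if "- a \<le> Im z" "Im z \<le> 0" for k z
    using Re_phi_le(2)[of "complex_of_real s * z" k] strip[OF that] by (intro bd) auto
  note shift = exp_gauss_shift[OF hol a0 bound]
  have one: "(\<lambda>z. 1 :: complex) holomorphic_on UNIV" by auto
  have g1: "integrable lborel (\<lambda>q. exp (- (complex_of_real q + \<i> * a)\<^sup>2 / 2))"
    and g2: "integrable lborel (\<lambda>q. exp (- (complex_of_real q)\<^sup>2 / 2))"
    using exp_gauss_shift(2,3)[OF one a0, of 1] by auto
  have eq: "complex_of_real s * (complex_of_real w - \<i> * a) = complex_of_real (s * w) - \<i> * of_nat m" for w
    using sa by (simp add: algebra_simps flip: of_real_mult)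
  have pt1: "(\<lambda>k. ?H k (complex_of_real q)) \<longlonglongrightarrow> exp (c * phi s2 nu (complex_of_real (s * q)))" for q
    using phi_trunc_tendsto[of "complex_of_real s * complex_of_real q"] by (auto intro!: tendsto_intros)
  have pt2: "(\<lambda>k. ?H k (complex_of_real q - \<i> * a)) \<longlonglongrightarrow> exp (c * phi s2 nu (complex_of_real (s * q) - \<i> * of_nat m))" for q
    using phi_trunc_tendsto[of "complex_of_real s * (complex_of_real q - \<i> * a)"] strip[of "complex_of_real q - \<i> * a"] a0
    unfolding eq by (auto intro!: tendsto_intros)
  have mcexp: "(\<lambda>q. exp (c * phi s2 nu (complex_of_real (s * q)))) \<in> borel_measurable lborel"
  proof -
    have [measurable]: "(\<lambda>q. phi s2 nu (complex_of_real (s * q))) \<in> borel_measurable borel"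
      using phi_line_measurable[of 0 s] by simp
    show ?thesis by measurable
  qed
  have "(\<lambda>k. \<integral>q. exp (- (complex_of_real q + \<i> * a)\<^sup>2 / 2) * ?H k (complex_of_real q) \<partial>lborel)
     \<longlonglongrightarrow> (\<integral>q. exp (- (complex_of_real q + \<i> * a)\<^sup>2 / 2) * exp (c * phi s2 nu (complex_of_real (s * q))) \<partial>lborel)"
  proof (rule integral_dominated_convergence[where w = "\<lambda>q. norm (exp (- (complex_of_real q + \<i> * a)\<^sup>2 / 2)) * exp (c * phi_bound)"])
    show "(\<lambda>q. exp (- (complex_of_real q + \<i> * a)\<^sup>2 / 2) * ?H k (complex_of_real q)) \<in> borel_measurable lborel" for k
      using shift(2) by (rule borel_measurable_integrable)
    show "AE q in lborel. (\<lambda>k. exp (- (complex_of_real q + \<i> * a)\<^sup>2 / 2) * ?H k (complex_of_real q)) \<longlonglongrightarrow>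
       exp (- (complex_of_real q + \<i> * a)\<^sup>2 / 2) * exp (c * phi s2 nu (complex_of_real (s * q)))"
      by (intro AE_I2 tendsto_mult tendsto_const pt1)
    show "(\<lambda>q. exp (- (complex_of_real q + \<i> * a)\<^sup>2 / 2) * exp (c * phi s2 nu (complex_of_real (s * q)))) \<in> borel_measurable lborel"
      by (intro borel_measurable_times mcexp) measurable
    show "integrable lborel (\<lambda>q. norm (exp (- (complex_of_real q + \<i> * a)\<^sup>2 / 2)) * exp (c * phi_bound))"
      using g1 by (intro integrable_mult_left integrable_norm)
    show "AE q in lborel. norm (exp (- (complex_of_real q + \<i> * a)\<^sup>2 / 2) * ?H k (complex_of_real q)) \<le> norm (exp (- (complex_of_real q + \<i> * a)\<^sup>2 / 2)) * exp (c * phi_bound)" for k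
      unfolding norm_mult using a0 by (intro AE_I2 mult_left_mono bound) auto
  qed
  moreover have "(\<lambda>k. \<integral>q. exp (- (complex_of_real q)\<^sup>2 / 2) * ?H k (complex_of_real q - \<i> * a) \<partial>lborel)
     \<longlonglongrightarrow> (\<integral>q. exp (- (complex_of_real q)\<^sup>2 / 2) * exp (c * phi s2 nu (complex_of_real (s * q) - \<i> * of_nat m)) \<partial>lborel)"
  proof (rule integral_dominated_convergence[where w = "\<lambda>q. norm (exp (- (complex_of_real q)\<^sup>2 / 2)) * exp (c * phi_bound)"])
    show "(\<lambda>q. exp (- (complex_of_real q)\<^sup>2 / 2) * ?H k (complex_of_real q - \<i> * a)) \<in> borel_measurable lborel" for k
      using shift(3) by (rule borel_measurable_integrable)
    show "AE q in lborel. (\<lambda>k. exp (- (complex_of_real q)\<^sup>2 / 2) * ?H k (complex_of_real q - \<i> * a)) \<longlonglongrightarrow>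
       exp (- (complex_of_real q)\<^sup>2 / 2) * exp (c * phi s2 nu (complex_of_real (s * q) - \<i> * of_nat m))"
      by (intro AE_I2 tendsto_mult tendsto_const pt2)
    show "(\<lambda>q. exp (- (complex_of_real q)\<^sup>2 / 2) * exp (c * phi s2 nu (complex_of_real (s * q) - \<i> * of_nat m))) \<in> borel_measurable lborel"
      using m by measurable
    show "integrable lborel (\<lambda>q. norm (exp (- (complex_of_real q)\<^sup>2 / 2)) * exp (c * phi_bound))"
      using g2 by (intro integrable_mult_left integrable_norm)
    show "AE q in lborel. norm (exp (- (complex_of_real q)\<^sup>2 / 2) * ?H k (complex_of_real q - \<i> * a)) \<le> norm (exp (- (complex_of_real q)\<^sup>2 / 2)) * exp (c * phi_bound)" for k
      unfolding norm_mult using a0 by (intro AE_I2 mult_left_mono bound) auto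
  qed
  moreover have "(\<integral>q. exp (- (complex_of_real q + \<i> * a)\<^sup>2 / 2) * ?H k (complex_of_real q) \<partial>lborel)
      = (\<integral>q. exp (- (complex_of_real q)\<^sup>2 / 2) * ?H k (complex_of_real q - \<i> * a) \<partial>lborel)" for k
    by (rule shift(1))
  ultimately show ?thesis by (simp only: LIMSEQ_unique)
qed

text \<open>Completing the square shows that exp (m x - s^2 x^2 / 2) is bounded in x, and it is, up
  to the factor sqrt (2 pi), the integral of exp (i s q x) against a Gaussian in q displaced by i m
  / s. Fubini turns its expectation into a Gaussian integral of the characteristic function, the
  contour shift moves the displacement into the argument of \<phi>, and then s tends to 0.\<close>

lemma exp_moment:
  fixes c :: real
  assumes N: "real_distribution N" and c: "c \<ge> 0" and m: "m \<le> n"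
    and char: "\<And>q. char N q = exp (complex_of_real c * phi s2 nu (complex_of_real q))"
  shows "(\<integral>\<^sup>+x. ennreal (exp (real m * x)) \<partial>N) = ennreal (exp (c * \<Phi> m))"
proof -
  interpret N: real_distribution N by fact
  let ?K = "complex_of_real (1 / sqrt (2 * pi))"
  have bounded: "real m * x - s\<^sup>2 * x\<^sup>2 / 2 \<le> (real m)\<^sup>2 / (2 * s\<^sup>2)" if s: "s > 0" for s x :: real
  proof -
    have "0 \<le> (real m / s - s * x)\<^sup>2 / 2" by simp
    also have "\<dots> = (real m)\<^sup>2 / (2 * s\<^sup>2) - (real m * x - s\<^sup>2 * x\<^sup>2 / 2)"
      using s by (simp add: power2_eq_square field_simps)
    finally show ?thesis by simp
  qed
  have int: "integrable N (\<lambda>x. exp (real m * x - s\<^sup>2 * x\<^sup>2 / 2))" if "s > 0" for s :: real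
    by (rule N.integrable_const_bound[where B = "exp ((real m)\<^sup>2 / (2 * s\<^sup>2))"]) (use bounded[OF that] in auto)
  have key: "complex_of_real (\<integral>x. exp (real m * x - s\<^sup>2 * x\<^sup>2 / 2) \<partial>N)
      = ?K * (\<integral>w. exp (- (complex_of_real w)\<^sup>2 / 2) * exp (c * phi s2 nu (complex_of_real (s * w) - \<i> * of_nat m)) \<partial>lborel)"
    if s: "s > 0" for s :: real
  proof -
    define a where "a = real m / s"
    have a0: "a \<ge> 0" and sa: "s * a = real m" using s by (auto simp: a_def)
    let ?g = "\<lambda>q. exp (- (complex_of_real q + \<i> * a)\<^sup>2 / 2)"
    have one: "(\<lambda>z. 1 :: complex) holomorphic_on UNIV" by auto
    have g1: "integrable lborel ?g"
      using exp_gauss_shift(2)[OF one a0, of 1] by auto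
    have inner: "(\<integral>q. ?g q * exp (\<i> * complex_of_real (s * q * x)) \<partial>lborel)
        = complex_of_real (sqrt (2 * pi) * exp (real m * x - s\<^sup>2 * x\<^sup>2 / 2))" for x
    proof -
      let ?H = "\<lambda>z. exp (\<i> * complex_of_real (s * x) * z)"
      have "norm (?H z) \<le> exp (\<bar>s * x\<bar> * a)" if "- a \<le> Im z" "Im z \<le> 0" for z
      proof -
        have "- (s * x * Im z) \<le> \<bar>s * x\<bar> * \<bar>Im z\<bar>" by (metis abs_ge_minus_self abs_mult)
        also have "\<dots> \<le> \<bar>s * x\<bar> * a" using that by (intro mult_left_mono) auto
        finally show ?thesis by simp
      qed
      moreover have "?H holomorphic_on UNIV" by (intro holomorphic_intros)
      ultimately have "(\<integral>q. ?g q * ?H (complex_of_real q) \<partial>lborel)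
        = (\<integral>w. exp (- (complex_of_real w)\<^sup>2 / 2) * ?H (complex_of_real w - \<i> * a) \<partial>lborel)"
        by (intro exp_gauss_shift(1)[OF _ a0])
      also have "\<dots> = (\<integral>w. complex_of_real (exp (real m * x)) * (exp (- (complex_of_real w)\<^sup>2 / 2) * exp (\<i> * complex_of_real (s * x * w))) \<partial>lborel)"
      proof (intro Bochner_Integration.integral_cong refl)
        fix w
        have "\<i> * complex_of_real (s * x) * (complex_of_real w - \<i> * a) = complex_of_real (s * a * x) + \<i> * complex_of_real (s * x * w)"
          by (simp add: algebra_simps)
        then have "?H (complex_of_real w - \<i> * a) = complex_of_real (exp (real m * x)) * exp (\<i> * complex_of_real (s * x * w))"
          unfolding sa by (simp only: exp_add exp_of_real)
        then show "exp (- (complex_of_real w)\<^sup>2 / 2) * ?H (complex_of_real w - \<i> * a)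
          = complex_of_real (exp (real m * x)) * (exp (- (complex_of_real w)\<^sup>2 / 2) * exp (\<i> * complex_of_real (s * x * w)))"
          by simp
      qed
      also have "\<dots> = complex_of_real (exp (real m * x)) * complex_of_real (sqrt (2 * pi) * exp (- (s * x)\<^sup>2 / 2))"
        unfolding gauss_char_integral[symmetric] by (rule integral_mult_right_zero)
      also have "\<dots> = complex_of_real (sqrt (2 * pi) * exp (real m * x - s\<^sup>2 * x\<^sup>2 / 2))"
        unfolding diff_conv_add_uminus exp_add by (simp add: power_mult_distrib mult_ac)
      finally show ?thesis by (simp add: mult_ac)
    qed
    interpret P: pair_sigma_finite lborel N ..
    have "(\<integral>q. ?g q * exp (c * phi s2 nu (complex_of_real (s * q))) \<partial>lborel)
       = (\<integral>q. (\<integral>x. ?g q * exp (\<i> * complex_of_real (s * q * x)) \<partial>N) \<partial>lborel)"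
      unfolding char[symmetric] char_def by simp
    also have "\<dots> = (\<integral>x. (\<integral>q. ?g q * exp (\<i> * complex_of_real (s * q * x)) \<partial>lborel) \<partial>N)"
    proof (rule P.Fubini_integral[symmetric])
      show "integrable (lborel \<Otimes>\<^sub>M N) (\<lambda>(q, x). ?g q * exp (\<i> * complex_of_real (s * q * x)))"
      proof (rule P.Fubini_integrable)
        have nrm: "norm (?g q * exp (\<i> * complex_of_real (s * q * x))) = norm (?g q)" for q x
          by (simp only: norm_mult norm_exp_i_times mult_1_right)
        show "integrable lborel (\<lambda>q. \<integral>x. norm (case (q, x) of (q, x) \<Rightarrow> ?g q * exp (\<i> * complex_of_real (s * q * x))) \<partial>N)"
          unfolding prod.case nrm using integrable_norm[OF g1] by (simp add: N.prob_space)
        show "AE q in lborel. integrable N (\<lambda>x. case (q, x) of (q, x) \<Rightarrow> ?g q * exp (\<i> * complex_of_real (s * q * x)))"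
          by (intro AE_I2 N.integrable_const_bound) (auto simp only: prod.case nrm, auto)
      qed measurable
    qed
    also have "\<dots> = complex_of_real (sqrt (2 * pi)) * complex_of_real (\<integral>x. exp (real m * x - s\<^sup>2 * x\<^sup>2 / 2) \<partial>N)"
      unfolding inner by simp
    finally have "?K * (\<integral>q. ?g q * exp (c * phi s2 nu (complex_of_real (s * q))) \<partial>lborel) = complex_of_real (\<integral>x. exp (real m * x - s\<^sup>2 * x\<^sup>2 / 2) \<partial>N)"
      by simp
    then show ?thesis unfolding shift_phi[OF s m c a_def] by simp
  qed
  define s where "s j = 1 / real (Suc j)" for j
  have s0: "s j > 0" "s j \<le> 1" for j by (auto simp: s_def)
  have slim: "s \<longlonglongrightarrow> 0" unfolding s_def[abs_def] by (rule lim_1_over_n[THEN LIMSEQ_Suc])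
  have "(\<lambda>j. \<integral>w. exp (- (complex_of_real w)\<^sup>2 / 2) * exp (c * phi s2 nu (complex_of_real (s j * w) - \<i> * of_nat m)) \<partial>lborel)
     \<longlonglongrightarrow> (\<integral>w. exp (- (complex_of_real w)\<^sup>2 / 2) * exp (c * phi s2 nu (- \<i> * of_nat m)) \<partial>lborel)"
  proof (rule integral_dominated_convergence[where w = "\<lambda>w. norm (exp (- (complex_of_real w)\<^sup>2 / 2)) * exp (c * phi_bound)"])
    have one: "(\<lambda>z. 1 :: complex) holomorphic_on UNIV" by auto
    show "integrable lborel (\<lambda>q. norm (exp (- (complex_of_real q)\<^sup>2 / 2)) * exp (c * phi_bound))"
      using exp_gauss_shift(3)[OF one, of 0 1] by (intro integrable_mult_left integrable_norm) auto
    show "AE w in lborel. (\<lambda>j. exp (- (complex_of_real w)\<^sup>2 / 2) * exp (c * phi s2 nu (complex_of_real (s j * w) - \<i> * of_nat m)))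
       \<longlonglongrightarrow> exp (- (complex_of_real w)\<^sup>2 / 2) * exp (c * phi s2 nu (- \<i> * of_nat m))"
      by (intro AE_I2 tendsto_intros phi_continuous_line m tendsto_mult_left_zero slim)
    show "AE w in lborel. norm (exp (- (complex_of_real w)\<^sup>2 / 2) * exp (c * phi s2 nu (complex_of_real (s j * w) - \<i> * of_nat m)))
        \<le> norm (exp (- (complex_of_real w)\<^sup>2 / 2)) * exp (c * phi_bound)" for j
      unfolding norm_mult
      using m c by (intro AE_I2 mult_left_mono) (auto intro!: mult_left_mono Re_phi_le)
  qed (use m in measurable)
  also have "(\<integral>w. exp (- (complex_of_real w)\<^sup>2 / 2) * exp (c * phi s2 nu (- \<i> * of_nat m)) \<partial>lborel)
     = complex_of_real (sqrt (2 * pi)) * complex_of_real (exp (c * \<Phi> m))"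
    using gauss_char_integral[of 0] unfolding phi_eq_\<Phi>[OF m] by (simp flip: exp_of_real)
  finally have "(\<lambda>j. complex_of_real (\<integral>x. exp (real m * x - (s j)\<^sup>2 * x\<^sup>2 / 2) \<partial>N)) \<longlonglongrightarrow> ?K * (complex_of_real (sqrt (2 * pi)) * complex_of_real (exp (c * \<Phi> m)))"
    unfolding key[OF s0(1)] by (intro tendsto_mult tendsto_const)
  also have "?K * (complex_of_real (sqrt (2 * pi)) * complex_of_real (exp (c * \<Phi> m))) = complex_of_real (exp (c * \<Phi> m))"
    by simp
  finally have "(\<lambda>j. \<integral>x. exp (real m * x - (s j)\<^sup>2 * x\<^sup>2 / 2) \<partial>N) \<longlonglongrightarrow> exp (c * \<Phi> m)"
    unfolding tendsto_of_real_iff .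
  then have A: "(\<lambda>j. \<integral>\<^sup>+x. ennreal (exp (real m * x - (s j)\<^sup>2 * x\<^sup>2 / 2)) \<partial>N) \<longlonglongrightarrow> ennreal (exp (c * \<Phi> m))"
    by (subst nn_integral_eq_integral[OF int[OF s0(1)]]) auto
  \<comment> \<open>On the side of the law the integrands increase as \<open>s j\<close> decreases,
    so monotone convergence applies; finiteness of the exponential moment is a result of the
    comparison with the other side.\<close>
  have B: "(\<lambda>j. \<integral>\<^sup>+x. ennreal (exp (real m * x - (s j)\<^sup>2 * x\<^sup>2 / 2)) \<partial>N) \<longlonglongrightarrow> (\<integral>\<^sup>+x. ennreal (exp (real m * x)) \<partial>N)"
  proof (rule nn_integral_LIMSEQ)
    show "incseq (\<lambda>j x. ennreal (exp (real m * x - (s j)\<^sup>2 * x\<^sup>2 / 2)))"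
    proof (intro incseq_SucI le_funI ennreal_leI)
      fix j x
      have "(s (Suc j))\<^sup>2 \<le> (s j)\<^sup>2" by (intro power_mono) (auto simp: s_def frac_le)
      from mult_right_mono[OF this, of "x\<^sup>2"] show "exp (real m * x - (s j)\<^sup>2 * x\<^sup>2 / 2) \<le> exp (real m * x - (s (Suc j))\<^sup>2 * x\<^sup>2 / 2)"
        by simp
    qed
    fix x :: real
    have "(\<lambda>j. exp (real m * x - (s j)\<^sup>2 * x\<^sup>2 / 2)) \<longlonglongrightarrow> exp (real m * x - 0\<^sup>2 * x\<^sup>2 / 2)"
      by (intro tendsto_intros slim) auto
    then show "(\<lambda>j. ennreal (exp (real m * x - (s j)\<^sup>2 * x\<^sup>2 / 2))) \<longlonglongrightarrow> ennreal (exp (real m * x))"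
      by simp
  qed auto
  show ?thesis using LIMSEQ_unique[OF B A] .
qed

end

section \<open>Joint exponential moments of the random measure\<close>

definition admissible :: "(real \<times> real) set \<Rightarrow> bool" where
  "admissible A \<longleftrightarrow> A \<in> sets borel \<and> A \<subseteq> Hplus \<and> emeasure rho A < \<infinity>"

lemma sets_rho[measurable_cong]: "sets rho = sets borel"
  by (simp add: rho_def)

lemma admissible_subset:
  assumes "admissible A" "B \<subseteq> A" "B \<in> sets borel"
  shows "admissible B"
proof -
  have "emeasure rho B \<le> emeasure rho A"
    using assms by (intro emeasure_mono) (auto simp: admissible_def sets_rho)
  then show ?thesis using assms by (auto simp: admissible_def)
qed

lemma admissible_Un:
  assumes "admissible A" "admissible B"
  shows "admissible (A \<union> B)"
proof -
  have "emeasure rho (A \<union> B) \<le> emeasure rho A + emeasure rho B"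
    using assms by (intro emeasure_subadditive) (auto simp: admissible_def sets_rho)
  also have "\<dots> < \<infinity>" using assms by (simp add: admissible_def)
  finally show ?thesis using assms by (auto simp: admissible_def intro!: sets.Un)
qed

lemma admissible_UN: "finite T \<Longrightarrow> (\<And>S. S \<in> T \<Longrightarrow> admissible (F S)) \<Longrightarrow> admissible (\<Union>S\<in>T. F S)"
proof (induction T rule: finite_induct)
  case empty then show ?case by (simp add: admissible_def)
next
  case (insert x T) then show ?case by (simp add: admissible_Un)
qed

locale log_id = spectral +
  fixes \<mu> :: real and Pr :: "'w measure" and P :: "(real \<times> real) set \<Rightarrow> 'w \<Rightarrow> real"
  assumes \<mu>: "\<mu> > 0" and prob: "prob_space Pr" and ID: "ID_scattered Pr \<mu> s2 nu P"
begin

sublocale prob_space Pr by (rule prob)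

lemma P_measurable[measurable]: "admissible A \<Longrightarrow> P A \<in> borel_measurable Pr"
  and P_char: "admissible A \<Longrightarrow> char (distr Pr borel (P A)) q = exp (of_real \<mu> * phi s2 nu (of_real q) * of_real (measure rho A))"
  and P_Un: "admissible A \<Longrightarrow> admissible B \<Longrightarrow> A \<inter> B = {} \<Longrightarrow> AE \<omega> in Pr. P (A \<union> B) \<omega> = P A \<omega> + P B \<omega>"
  and P_indep: "finite I \<Longrightarrow> (\<And>i. i \<in> I \<Longrightarrow> admissible (F i)) \<Longrightarrow> disjoint_family_on F I \<Longrightarrow>
    indep_vars (\<lambda>_. borel) (\<lambda>i. P (F i)) (I :: nat set)"
proof -
  have "{A. A \<in> sets borel \<and> A \<subseteq> Hplus \<and> emeasure rho A < \<infinity>} = Collect admissible"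
    by (auto simp: admissible_def)
  note * = ID[unfolded ID_scattered_def Let_def this Ball_def mem_Collect_eq]
  show "admissible A \<Longrightarrow> P A \<in> borel_measurable Pr"
    "admissible A \<Longrightarrow> char (distr Pr borel (P A)) q = exp (of_real \<mu> * phi s2 nu (of_real q) * of_real (measure rho A))"
    "admissible A \<Longrightarrow> admissible B \<Longrightarrow> A \<inter> B = {} \<Longrightarrow> AE \<omega> in Pr. P (A \<union> B) \<omega> = P A \<omega> + P B \<omega>"
    "finite I \<Longrightarrow> (\<And>i. i \<in> I \<Longrightarrow> admissible (F i)) \<Longrightarrow> disjoint_family_on F I \<Longrightarrow>
      indep_vars (\<lambda>_. borel) (\<lambda>i. P (F i)) I"
    using * by blast+
qed

lemma P_UN:
  assumes "finite T" "\<And>S. S \<in> T \<Longrightarrow> admissible (F S)" "disjoint_family_on F T"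
  shows "AE \<omega> in Pr. P (\<Union>S\<in>T. F S) \<omega> = (\<Sum>S\<in>T. P (F S) \<omega>)"
  using assms
proof (induction T rule: finite_induct)
  case empty
  have "admissible {}" by (simp add: admissible_def)
  \<comment> \<open>The empty set is disjoint from itself, so additivity gives P {} = P {} + P {},
    hence 0 almost surely.\<close>
  from P_Un[OF this this] show ?case by simp
next
  case (insert x T)
  have disj: "F x \<inter> (\<Union>S\<in>T. F S) = {}" "disjoint_family_on F T"
    using insert.prems(2) insert.hyps(2) by (simp_all add: disjoint_family_on_insert)
  from P_Un[OF _ _ disj(1)] have "AE \<omega> in Pr. P (F x \<union> (\<Union>S\<in>T. F S)) \<omega> = P (F x) \<omega> + P (\<Union>S\<in>T. F S) \<omega>"
    using insert by (simp add: admissible_UN)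
  moreover have "AE \<omega> in Pr. P (\<Union>S\<in>T. F S) \<omega> = (\<Sum>S\<in>T. P (F S) \<omega>)"
    using insert.prems disj(2) by (intro insert.IH) auto
  ultimately show ?case
    by eventually_elim (use insert.hyps in simp)
qed

lemma P_moment:
  assumes "admissible A" "m \<le> n"
  shows "(\<integral>\<^sup>+\<omega>. ennreal (exp (real m * P A \<omega>)) \<partial>Pr) = ennreal (exp (\<mu> * measure rho A * \<Phi> m))"
proof -
  note [measurable] = P_measurable[OF assms(1)]
  have "real_distribution (distr Pr borel (P A))"
    by (rule real_distribution_distr) measurable
  from exp_moment[OF this _ assms(2), of "\<mu> * measure rho A"] \<mu>
  have "(\<integral>\<^sup>+x. ennreal (exp (real m * x)) \<partial>distr Pr borel (P A)) = ennreal (exp (\<mu> * measure rho A * \<Phi> m))"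
    by (simp add: P_char[OF assms(1)] mult_ac)
  then show ?thesis by (simp add: nn_integral_distr)
qed

text \<open>The sets \<open>C i\<close> are cut into the disjoint atoms on which exactly the indices in \<open>S\<close> are active.\<close>

lemma P_joint_moment:
  fixes C :: "nat \<Rightarrow> (real \<times> real) set"
  assumes I: "finite I" "card I \<le> n" and C: "\<And>i. i \<in> I \<Longrightarrow> admissible (C i)"
  shows "(\<integral>\<^sup>+\<omega>. (\<Prod>i\<in>I. ennreal (exp (P (C i) \<omega>))) \<partial>Pr)
    = ennreal (exp (\<mu> * enn2real (\<integral>\<^sup>+x. ennreal (\<Phi> (card {i\<in>I. x \<in> C i})) \<partial>rho)))"
proof -
  \<comment> \<open>The atom with no active index has infinite mass, so it is left out; it would
    enter with the factor \<open>\<Phi> 0 = 0\<close>.\<close>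
  define T where "T = Pow I - {{}}"
  define B where "B S = {x\<in>Hplus. {i\<in>I. x \<in> C i} = S}" for S
  have finT: "finite T" using I by (simp add: T_def)
  have finS: "finite S" "S \<subseteq> I" if "S \<in> T" for S using that I by (auto simp: T_def intro: finite_subset)
  have Csets: "C i \<in> sets borel" "C i \<subseteq> Hplus" if "i \<in> I" for i using C[OF that] by (auto simp: admissible_def)
  have Beq: "B S = (\<Inter>i\<in>S. C i) - (\<Union>i\<in>I - S. C i)" if S: "S \<in> T" for S
    using S Csets(2) unfolding B_def T_def by fastforce
  have adm: "admissible (B S)" if S: "S \<in> T" for S
  proof -
    obtain i where i: "i \<in> S" using S by (auto simp: T_def)
    have "B S \<in> sets borel"
      unfolding Beq[OF S] using S finS[OF S] I Csets by (intro sets.Diff sets.finite_INT sets.finite_UN) (auto simp: T_def)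
    moreover have "B S \<subseteq> C i" using i unfolding Beq[OF S] by auto
    ultimately show ?thesis using C[of i] i finS[OF S] admissible_subset by blast
  qed
  have disj: "disjoint_family_on B T'" for T' by (auto simp: disjoint_family_on_def B_def)
  have Ceq: "C i = (\<Union>S\<in>{S\<in>T. i \<in> S}. B S)" if "i \<in> I" for i
    using Csets(2)[OF that] that by (auto simp: B_def T_def)
  have "AE \<omega> in Pr. P (C i) \<omega> = (\<Sum>S\<in>{S\<in>T. i \<in> S}. P (B S) \<omega>)" if "i \<in> I" for i
    unfolding Ceq[OF that] using finT adm by (intro P_UN disj) auto
  then have "AE \<omega> in Pr. \<forall>i\<in>I. P (C i) \<omega> = (\<Sum>S\<in>{S\<in>T. i \<in> S}. P (B S) \<omega>)"
    using I by (intro AE_finite_allI) auto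
  then have AE: "AE \<omega> in Pr. (\<Prod>i\<in>I. ennreal (exp (P (C i) \<omega>))) = (\<Prod>S\<in>T. ennreal (exp (real (card S) * P (B S) \<omega>)))"
  proof eventually_elim
    case (elim \<omega>)
    have "(\<Sum>i\<in>I. P (C i) \<omega>) = (\<Sum>i\<in>I. \<Sum>S\<in>{S\<in>T. i \<in> S}. P (B S) \<omega>)"
      using elim by (intro sum.cong) auto
    also have "\<dots> = (\<Sum>S\<in>T. \<Sum>i\<in>{i\<in>I. i \<in> S}. P (B S) \<omega>)"
      by (rule sum.swap_restrict) (use I finT in auto)
    also have "\<dots> = (\<Sum>S\<in>T. real (card S) * P (B S) \<omega>)"
    proof (rule sum.cong[OF refl])
      fix S assume "S \<in> T"
      then have "{i\<in>I. i \<in> S} = S" using finS by auto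
      then show "(\<Sum>i\<in>{i\<in>I. i \<in> S}. P (B S) \<omega>) = real (card S) * P (B S) \<omega>" by simp
    qed
    finally show ?case by (simp add: prod_ennreal flip: exp_sum[OF I(1)] exp_sum[OF finT])
  qed
  \<comment> \<open>Independence is stated for families indexed by natural numbers, so the finite
    index sets naming the atoms are coded as numbers.\<close>
  define F where "F k = B (set_decode k)" for k
  have inj: "inj_on set_encode T"
    using finS by (intro inj_on_subset[OF inj_on_set_encode]) auto
  have dec: "set_decode (set_encode S) = S" if "S \<in> T" for S using finS[OF that] by simp
  have "indep_vars (\<lambda>_. borel) (\<lambda>k. P (F k)) (set_encode ` T)"
  proof (rule P_indep)
    show "disjoint_family_on F (set_encode ` T)"
      unfolding disjoint_family_on_def F_def B_def by (auto simp: dec)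
  qed (use finT adm in \<open>auto simp: F_def dec\<close>)
  from indep_vars_compose2[OF this, of "\<lambda>k x. ennreal (exp (real (card (set_decode k)) * x))" "\<lambda>_. borel"]
  have ind: "indep_vars (\<lambda>_. borel) (\<lambda>k \<omega>. ennreal (exp (real (card (set_decode k)) * P (F k) \<omega>))) (set_encode ` T)"
    by measurable
  have "(\<integral>\<^sup>+\<omega>. (\<Prod>i\<in>I. ennreal (exp (P (C i) \<omega>))) \<partial>Pr) = (\<integral>\<^sup>+\<omega>. (\<Prod>S\<in>T. ennreal (exp (real (card S) * P (B S) \<omega>))) \<partial>Pr)"
    by (rule nn_integral_cong_AE[OF AE])
  also have "\<dots> = (\<integral>\<^sup>+\<omega>. (\<Prod>k\<in>set_encode ` T. ennreal (exp (real (card (set_decode k)) * P (F k) \<omega>))) \<partial>Pr)"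
    by (simp add: prod.reindex[OF inj] dec F_def cong: prod.cong)
  also have "\<dots> = (\<Prod>k\<in>set_encode ` T. \<integral>\<^sup>+\<omega>. ennreal (exp (real (card (set_decode k)) * P (F k) \<omega>)) \<partial>Pr)"
    by (rule indep_vars_nn_integral[OF _ ind]) (use finT in auto)
  also have "\<dots> = (\<Prod>S\<in>T. \<integral>\<^sup>+\<omega>. ennreal (exp (real (card S) * P (B S) \<omega>)) \<partial>Pr)"
    by (simp add: prod.reindex[OF inj] dec F_def cong: prod.cong)
  also have "\<dots> = (\<Prod>S\<in>T. ennreal (exp (\<mu> * measure rho (B S) * \<Phi> (card S))))"
  proof (intro prod.cong refl P_moment adm)
    fix S assume "S \<in> T"
    then show "card S \<le> n" using finS[of S] card_mono[of I S] I by auto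
  qed
  also have "\<dots> = ennreal (exp (\<mu> * (\<Sum>S\<in>T. \<Phi> (card S) * measure rho (B S))))"
    by (simp add: prod_ennreal sum_distrib_left mult_ac flip: exp_sum[OF finT])
  also have "(\<Sum>S\<in>T. \<Phi> (card S) * measure rho (B S)) = enn2real (\<integral>\<^sup>+x. ennreal (\<Phi> (card {i\<in>I. x \<in> C i})) \<partial>rho)"
  proof -
    have "(\<integral>\<^sup>+x. ennreal (\<Phi> (card {i\<in>I. x \<in> C i})) \<partial>rho) = (\<integral>\<^sup>+x. (\<Sum>S\<in>T. ennreal (\<Phi> (card S)) * indicator (B S) x) \<partial>rho)"
    proof (intro nn_integral_cong)
      fix x
      show "ennreal (\<Phi> (card {i\<in>I. x \<in> C i})) = (\<Sum>S\<in>T. ennreal (\<Phi> (card S)) * indicator (B S) x)"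
      proof (cases "{i\<in>I. x \<in> C i} = {}")
        case True
        then have "(\<Sum>S\<in>T. ennreal (\<Phi> (card S)) * indicator (B S) x) = 0"
          by (intro sum.neutral) (auto simp: B_def T_def indicator_def)
        then show ?thesis unfolding True by simp
      next
        case False
        let ?S = "{i\<in>I. x \<in> C i}"
        have xH: "x \<in> Hplus" using False Csets by auto
        have "(\<Sum>S\<in>T. ennreal (\<Phi> (card S)) * indicator (B S) x) = (\<Sum>S\<in>{?S}. ennreal (\<Phi> (card S)) * indicator (B S) x)"
          by (rule sum.mono_neutral_right) (use finT False in \<open>auto simp: T_def B_def indicator_def\<close>)
        then show ?thesis using xH by (simp add: B_def)
      qed
    qed
    also have "\<dots> = (\<Sum>S\<in>T. ennreal (\<Phi> (card S)) * emeasure rho (B S))"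
    proof -
      have [measurable]: "B S \<in> sets rho" if "S \<in> T" for S using adm[OF that] by (simp add: admissible_def sets_rho)
      show ?thesis by (subst nn_integral_sum) (auto simp: nn_integral_cmult_indicator)
    qed
    also have "\<dots> = (\<Sum>S\<in>T. ennreal (\<Phi> (card S) * measure rho (B S)))"
      using adm by (intro sum.cong refl) (auto simp: admissible_def emeasure_eq_ennreal_measure ennreal_mult \<Phi>_nonneg less_top)
    also have "\<dots> = ennreal (\<Sum>S\<in>T. \<Phi> (card S) * measure rho (B S))"
      by (rule sum_ennreal) (simp add: \<Phi>_nonneg)
    finally show ?thesis by (simp add: sum_nonneg \<Phi>_nonneg)
  qed
  finally show ?thesis .
qed

end

section \<open>Geometry of the truncated cones\<close>

lemma measurable_snd_real[measurable]: "snd \<in> borel_measurable (borel :: (real \<times> real) measure)"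
  by (intro borel_measurable_continuous_onI continuous_intros)

lemma Hplus_sets[measurable]: "Hplus \<in> sets borel"
  unfolding Hplus_def by (intro borel_open open_Collect_less continuous_intros)

lemma nn_integral_rho:
  assumes [measurable]: "f \<in> borel_measurable borel"
  shows "(\<integral>\<^sup>+x. f x \<partial>rho) = (\<integral>\<^sup>+l. indicator {0<..} l * ennreal (1 / l\<^sup>2) * (\<integral>\<^sup>+t. f (t, l) \<partial>lborel) \<partial>lborel)"
proof -
  have "(\<integral>\<^sup>+x. f x \<partial>rho) = (\<integral>\<^sup>+x. indicator Hplus x * ennreal (1 / (snd x)\<^sup>2) * f x \<partial>lborel)"
    unfolding rho_def by (subst nn_integral_density) auto
  also have "\<dots> = (\<integral>\<^sup>+x. indicator Hplus x * ennreal (1 / (snd x)\<^sup>2) * f x \<partial>(lborel \<Otimes>\<^sub>M lborel))"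
    by (simp add: lborel_prod)
  also have "\<dots> = (\<integral>\<^sup>+l. (\<integral>\<^sup>+t. indicator Hplus (t, l) * ennreal (1 / (snd (t, l))\<^sup>2) * f (t, l) \<partial>lborel) \<partial>lborel)"
  proof -
    have "(\<lambda>x. indicator Hplus x * ennreal (1 / (snd x)\<^sup>2) * f x) \<in> borel_measurable (borel :: (real \<times> real) measure)"
      by measurable
    then have "(\<lambda>x. indicator Hplus x * ennreal (1 / (snd x)\<^sup>2) * f x) \<in> borel_measurable (lborel \<Otimes>\<^sub>M lborel)"
      by (simp add: lborel_prod)
    from lborel_pair.nn_integral_snd[OF this] show ?thesis by (rule sym)
  qed
  also have "\<dots> = (\<integral>\<^sup>+l. indicator {0<..} l * ennreal (1 / l\<^sup>2) * (\<integral>\<^sup>+t. f (t, l) \<partial>lborel) \<partial>lborel)"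
    by (intro nn_integral_cong, subst nn_integral_cmult[symmetric]) (auto simp: Hplus_def indicator_def)
  finally show ?thesis .
qed

lemma AE_rho: "AE x in rho. snd x > 0"
  unfolding rho_def by (subst AE_density) (auto simp: Hplus_def split: split_indicator intro!: AE_I2)

lemma cone_set_sets[measurable]: "cone_set \<epsilon> u \<in> sets borel"
proof -
  have "cone_set \<epsilon> u = {x. \<epsilon> \<le> snd x \<and> snd x \<le> 1 \<and> \<bar>fst x - u\<bar> \<le> snd x / 2} \<union> {x. 1 \<le> snd x \<and> \<bar>fst x - u\<bar> \<le> 1 / 2}"
    by (auto simp: cone_set_def)
  also have "\<dots> \<in> sets borel"
    by (intro sets.Un borel_closed closed_Collect_conj closed_Collect_le continuous_intros) auto
  finally show ?thesis .
qed

lemma cone_set_alt: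
  assumes "\<epsilon> \<le> 1"
  shows "(t, l) \<in> cone_set \<epsilon> u \<longleftrightarrow> \<epsilon> \<le> l \<and> \<bar>t - u\<bar> \<le> min l 1 / 2"
  using assms by (auto simp: cone_set_def min_def)

text \<open>Horizontal slices have length at most 1, so the mass is at most the integral of 1 / l^2
  from \<epsilon> on, which is 1 / \<epsilon>.\<close>

lemma admissible_cone_set:
  assumes "0 < \<epsilon>" "\<epsilon> \<le> 1"
  shows "admissible (cone_set \<epsilon> u)"
proof -
  have "emeasure rho (cone_set \<epsilon> u) = (\<integral>\<^sup>+l. indicator {0<..} l * ennreal (1 / l\<^sup>2) * (\<integral>\<^sup>+t. indicator (cone_set \<epsilon> u) (t, l) \<partial>lborel) \<partial>lborel)"
    by (subst nn_integral_rho[symmetric]) (auto simp: sets_rho)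
  also have "\<dots> \<le> (\<integral>\<^sup>+l. ennreal (1 / l\<^sup>2) * indicator {\<epsilon>..} l \<partial>lborel)"
  proof (intro nn_integral_mono)
    fix l
    show "indicator {0<..} l * ennreal (1 / l\<^sup>2) * (\<integral>\<^sup>+t. indicator (cone_set \<epsilon> u) (t, l) \<partial>lborel) \<le> ennreal (1 / l\<^sup>2) * indicator {\<epsilon>..} l"
    proof (cases "\<epsilon> \<le> l")
      case True
      have "(\<integral>\<^sup>+t. indicator (cone_set \<epsilon> u) (t, l) \<partial>lborel) \<le> (\<integral>\<^sup>+t. indicator {u - 1/2..u + 1/2} t \<partial>lborel)"
      proof (intro nn_integral_mono)
        fix x
        have "\<bar>x - u\<bar> \<le> min l 1 / 2 \<Longrightarrow> u - 1/2 \<le> x \<and> x \<le> u + 1/2" by linarith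
        then show "indicator (cone_set \<epsilon> u) (x, l) \<le> (indicator {u - 1/2..u + 1/2} x :: ennreal)"
          unfolding indicator_def cone_set_alt[OF assms(2)] by auto
      qed
      also have "\<dots> = 1" by simp
      finally show ?thesis using True assms by (auto simp: indicator_def intro!: mult_left_le)
    next
      case False
      then have "(\<integral>\<^sup>+t. indicator (cone_set \<epsilon> u) (t, l) \<partial>lborel) = 0"
        by (subst nn_integral_0_iff_AE) (auto simp: indicator_def cone_set_alt[OF assms(2)])
      then show ?thesis by simp
    qed
  qed
  also have "\<dots> = ennreal (0 - (- 1 / \<epsilon>))"
  proof (rule nn_integral_FTC_atLeast)
    fix x assume "\<epsilon> \<le> x"
    then show "((\<lambda>x. - 1 / x) has_real_derivative 1 / x\<^sup>2) (at x)"
      using assms by (auto intro!: derivative_eq_intros simp: power2_eq_square)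
  next
    show "((\<lambda>x::real. - 1 / x) \<longlongrightarrow> 0) at_top" by real_asymp
  qed auto
  also have "\<dots> < \<infinity>" by simp
  finally have "emeasure rho (cone_set \<epsilon> u) < \<infinity>" .
  moreover have "cone_set \<epsilon> u \<subseteq> Hplus"
    using assms by (force simp: Hplus_def cone_set_def)
  ultimately show ?thesis by (simp add: admissible_def)
qed

text \<open>With r = t - s the slices at height l overlap in length min l 1 - r if this is positive,
  and not at all below height r. The range [r, 1] contributes - ln r - 1 + r and the range above 1
  contributes 1 - r. The flat top of the cones is what makes the sum a pure logarithm.\<close>

lemma emeasure_cone_Int:
  assumes "0 < t - s" "t - s < 1"
  shows "emeasure rho (cone_set 0 s \<inter> cone_set 0 t) = ennreal (- ln (t - s))"
proof -
  define r where "r = t - s"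
  have r: "0 < r" "r < 1" using assms by (auto simp: r_def)
  have "emeasure rho (cone_set 0 s \<inter> cone_set 0 t)
     = (\<integral>\<^sup>+l. indicator {0<..} l * ennreal (1 / l\<^sup>2) * (\<integral>\<^sup>+x. indicator (cone_set 0 s \<inter> cone_set 0 t) (x, l) \<partial>lborel) \<partial>lborel)"
    by (subst nn_integral_rho[symmetric]) (auto simp: sets_rho)
  also have "\<dots> = (\<integral>\<^sup>+l. ennreal ((l - r) / l\<^sup>2) * indicator {r..1} l + ennreal ((1 - r) / l\<^sup>2) * indicator {1..} l \<partial>lborel)"
  proof (intro nn_integral_cong_AE)
    \<comment> \<open>Both indicators on the right contain the height 1, where the slice would be
      counted twice.\<close>
    have "AE l in lborel. l \<noteq> (1::real)" by (rule AE_lborel_singleton)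
    then show "AE l in lborel. indicator {0<..} l * ennreal (1 / l\<^sup>2) * (\<integral>\<^sup>+x. indicator (cone_set 0 s \<inter> cone_set 0 t) (x, l) \<partial>lborel)
       = ennreal ((l - r) / l\<^sup>2) * indicator {r..1} l + ennreal ((1 - r) / l\<^sup>2) * indicator {1..} l"
    proof eventually_elim
      case (elim l)
      show ?case
      proof (cases "l > 0")
        case True
        have "(\<integral>\<^sup>+x. indicator (cone_set 0 s \<inter> cone_set 0 t) (x, l) \<partial>lborel) = (\<integral>\<^sup>+x. indicator {t - min l 1 / 2..s + min l 1 / 2} x \<partial>lborel)"
        proof (intro nn_integral_cong)
          fix x
          have "\<bar>x - s\<bar> \<le> min l 1 / 2 \<and> \<bar>x - t\<bar> \<le> min l 1 / 2 \<longleftrightarrow> t - min l 1 / 2 \<le> x \<and> x \<le> s + min l 1 / 2"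
            using assms by linarith
          then show "indicator (cone_set 0 s \<inter> cone_set 0 t) (x, l) = (indicator {t - min l 1 / 2..s + min l 1 / 2} x :: ennreal)"
            using True by (simp add: indicator_def cone_set_alt del: min_less_iff_conj min_le_iff_disj)
        qed
        also have "\<dots> = ennreal (min l 1 - r)"
          by (cases "r \<le> min l 1") (auto simp: r_def ennreal_neg)
        finally have I: "(\<integral>\<^sup>+x. indicator (cone_set 0 s \<inter> cone_set 0 t) (x, l) \<partial>lborel) = ennreal (min l 1 - r)" .
        show ?thesis unfolding I using True r elim
          by (auto simp: indicator_def min_def ennreal_neg simp flip: ennreal_mult)
      qed (use r in \<open>auto simp: indicator_def\<close>)
    qed
  qed
  also have "\<dots> = (\<integral>\<^sup>+l. ennreal ((l - r) / l\<^sup>2) * indicator {r..1} l \<partial>lborel) + (\<integral>\<^sup>+l. ennreal ((1 - r) / l\<^sup>2) * indicator {1..} l \<partial>lborel)"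
    by (rule nn_integral_add) auto
  also have "(\<integral>\<^sup>+l. ennreal ((l - r) / l\<^sup>2) * indicator {r..1} l \<partial>lborel) = ennreal ((ln 1 + r / 1) - (ln r + r / r))"
  proof (rule nn_integral_FTC_Icc)
    fix x assume "x \<in> {r..1}"
    then have x: "r \<le> x" "x \<le> 1" by auto
    have "((\<lambda>x. ln x + r / x) has_real_derivative (x - r) / x\<^sup>2) (at x)"
      using x r by (auto intro!: derivative_eq_intros simp: power2_eq_square field_simps)
    then show "((\<lambda>x. ln x + r / x) has_real_derivative (x - r) / x\<^sup>2) (at x)" .
  qed (use r in auto)
  also have "(\<integral>\<^sup>+l. ennreal ((1 - r) / l\<^sup>2) * indicator {1..} l \<partial>lborel) = ennreal (0 - (- (1 - r) / 1))"
  proof (rule nn_integral_FTC_atLeast[where F = "\<lambda>x. - (1 - r) / x"])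
    fix x :: real assume "1 \<le> x"
    then show "((\<lambda>x. - (1 - r) / x) has_real_derivative (1 - r) / x\<^sup>2) (at x)"
      by (auto intro!: derivative_eq_intros simp: power2_eq_square)
  next
    show "((\<lambda>x::real. - (1 - r) / x) \<longlongrightarrow> 0) at_top" by real_asymp
  qed (use r in auto)
  also have "ennreal ((ln 1 + r / 1) - (ln r + r / r)) + ennreal (0 - (- (1 - r) / 1)) = ennreal (- ln r)"
    using r ln_le_minus_one[of r] by (subst ennreal_plus[symmetric]) auto
  finally show ?thesis by (simp add: r_def)
qed

lemma ennreal_double_sum:
  assumes "\<And>p k. p \<in> A \<Longrightarrow> k \<in> B p \<Longrightarrow> 0 \<le> f p k"
  shows "ennreal (\<Sum>p\<in>A. \<Sum>k\<in>B p. f p k) = (\<Sum>p\<in>A. \<Sum>k\<in>B p. ennreal (f p k))"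
proof -
  have "(\<Sum>p\<in>A. \<Sum>k\<in>B p. ennreal (f p k)) = (\<Sum>p\<in>A. ennreal (\<Sum>k\<in>B p. f p k))"
    using assms by (intro sum.cong refl sum_ennreal) auto
  also have "\<dots> = ennreal (\<Sum>p\<in>A. \<Sum>k\<in>B p. f p k)"
    using assms by (intro sum_ennreal sum_nonneg) auto
  finally show ?thesis by simp
qed

context spectral
begin

lemma \<Phi>_interval:
  "(\<Sum>p\<in>{a..<a + N}. \<Sum>k\<in>{a..<p}. dfun s2 nu (p - k)) = \<Phi> N"
proof (induction N)
  case (Suc N)
  have "(\<Sum>k\<in>{a..<a + N}. dfun s2 nu (a + N - k)) = (\<Sum>m\<in>{1..N}. dfun s2 nu m)"
    by (rule sum.reindex_bij_witness[of _ "\<lambda>m. a + N - m" "\<lambda>k. a + N - k"]) auto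
  then show ?case using Suc by (simp add: \<Phi>_Suc)
qed simp

text \<open>A set of indices closed under betweenness is a block, so the pairs inside it are counted
  by \<open>\<Phi>\<close>. This replaces a function of the number of active cones by a sum over
  pairs of active cones, which can be integrated pair by pair.\<close>

lemma \<Phi>_card_convex:
  assumes S: "S \<subseteq> {1..N}" and conv: "\<And>i j k. i \<in> S \<Longrightarrow> k \<in> S \<Longrightarrow> i < j \<Longrightarrow> j < k \<Longrightarrow> j \<in> S"
  shows "\<Phi> (card S) = (\<Sum>p\<in>{1..N}. \<Sum>k\<in>{1..<p}. if k \<in> S \<and> p \<in> S then dfun s2 nu (p - k) else 0)"
proof (cases "S = {}")
  case False
  have fin: "finite S" using S finite_subset by blast
  define a where "a = Min S"
  define b where "b = Max S"
  have ab: "a \<in> S" "b \<in> S" "a \<le> b" using fin False by (auto simp: a_def b_def)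
  have eq: "S = {a..b}"
  proof
    show "S \<subseteq> {a..b}" using fin by (auto simp: a_def b_def)
    show "{a..b} \<subseteq> S"
    proof
      fix j assume "j \<in> {a..b}"
      then show "j \<in> S" using conv[OF ab(1,2), of j] ab by (cases "j = a \<or> j = b") auto
    qed
  qed
  have eq2: "S = {a..<a + card S}" using ab(3) by (auto simp: eq)
  have "(\<Sum>p\<in>{1..N}. \<Sum>k\<in>{1..<p}. if k \<in> S \<and> p \<in> S then dfun s2 nu (p - k) else 0)
     = (\<Sum>p\<in>{1..N}. if p \<in> S then \<Sum>k\<in>{1..<p}. if k \<in> S then dfun s2 nu (p - k) else 0 else 0)"
    by (intro sum.cong) auto
  also have "\<dots> = (\<Sum>p\<in>S. \<Sum>k\<in>{1..<p}. if k \<in> S then dfun s2 nu (p - k) else 0)"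
    using S by (intro sum.mono_neutral_cong_right) auto
  also have "\<dots> = (\<Sum>p\<in>S. \<Sum>k\<in>{a..<p}. dfun s2 nu (p - k))"
    using S ab(1) by (intro sum.cong refl sum.mono_neutral_cong_right) (auto simp: eq)
  also have "\<dots> = (\<Sum>p\<in>{a..<a + card S}. \<Sum>k\<in>{a..<p}. dfun s2 nu (p - k))"
    using eq2 by simp
  finally show ?thesis by (simp add: \<Phi>_interval)
qed simp

text \<open>The exponent of the joint moment before the factor \<mu>. Uncut cones have infinite
  mass, but regions covered at most once cost nothing since \<open>\<Phi>\<close> vanishes at 0 and
  1. Coinciding points may still give the value infinity, hence the type.\<close>

definition energy :: "(nat \<Rightarrow> real) \<Rightarrow> (nat \<Rightarrow> real) \<Rightarrow> ennreal" where
  "energy \<epsilon> t = (\<integral>\<^sup>+x. ennreal (\<Phi> (card {i\<in>{1..n}. x \<in> cone_set (\<epsilon> i) (t i)})) \<partial>rho)"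

lemma energy_le:
  assumes "\<And>i. i \<in> {1..n} \<Longrightarrow> \<epsilon> i \<ge> 0"
  shows "energy \<epsilon> t \<le> energy (\<lambda>_. 0) t"
  unfolding energy_def
proof (intro nn_integral_mono ennreal_leI \<Phi>_mono card_mono)
  fix x
  have "cone_set e u \<subseteq> cone_set 0 u" if "e \<ge> 0" for e u
    using that by (auto simp: cone_set_def)
  then show "{i \<in> {1..n}. x \<in> cone_set (\<epsilon> i) (t i)} \<subseteq> {i \<in> {1..n}. x \<in> cone_set 0 (t i)}"
    using assms by blast
qed auto

text \<open>Below the scale of the smallest gap the cones are disjoint, and \<open>\<Phi>\<close> vanishes at \<open>0\<close> and \<open>1\<close>.\<close>

lemma energy_eq:
  assumes \<epsilon>: "\<And>i. i \<in> {1..n} \<Longrightarrow> 0 \<le> \<epsilon> i \<and> \<epsilon> i \<le> \<eta>" and \<eta>: "\<eta> \<le> 1"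
    and gap: "\<And>i j. i \<in> {1..n} \<Longrightarrow> j \<in> {1..n} \<Longrightarrow> i \<noteq> j \<Longrightarrow> \<bar>t i - t j\<bar> \<ge> \<eta>"
  shows "energy \<epsilon> t = energy (\<lambda>_. 0) t"
  unfolding energy_def
proof (rule nn_integral_cong_AE)
  show "AE x in rho. ennreal (\<Phi> (card {i \<in> {1..n}. x \<in> cone_set (\<epsilon> i) (t i)})) = ennreal (\<Phi> (card {i \<in> {1..n}. x \<in> cone_set 0 (t i)}))"
    using AE_rho
  proof eventually_elim
    case (elim x)
    obtain s l where x: "x = (s, l)" by (cases x)
    have l: "l > 0" using elim x by simp
    let ?A = "{i \<in> {1..n}. x \<in> cone_set (\<epsilon> i) (t i)}" and ?B = "{i \<in> {1..n}. x \<in> cone_set 0 (t i)}"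
    show ?case
    proof (cases "l < \<eta>")
      case False
      have "?A = ?B" using \<epsilon> \<eta> False l by (force simp: x cone_set_alt)
      then show ?thesis by simp
    next
      case True
      have sub: "?A \<subseteq> ?B" using \<epsilon> \<eta> l by (force simp: x cone_set_alt)
      have "i = j" if "i \<in> ?B" "j \<in> ?B" for i j
      proof (rule ccontr)
        assume "i \<noteq> j"
        then have "\<bar>t i - t j\<bar> \<ge> \<eta>" using gap that by auto
        moreover have "\<bar>s - t i\<bar> \<le> min l 1 / 2" "\<bar>s - t j\<bar> \<le> min l 1 / 2" using that by (auto simp: x cone_set_alt)
        ultimately show False using True by linarith
      qed
      moreover have "finite ?B" by auto
      ultimately have B: "card ?B \<le> 1" using card_le_Suc0_iff_eq[of ?B] by simp
      have "card ?A \<le> card ?B" by (intro card_mono sub) auto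
      then have "\<Phi> (card ?A) = 0" "\<Phi> (card ?B) = 0"
        using B \<Phi>_mono[of "card ?A" 1] \<Phi>_mono[of "card ?B" 1] \<Phi>_nonneg[of "card ?A"] \<Phi>_nonneg[of "card ?B"] by auto
      then show ?thesis by simp
    qed
  qed
qed

text \<open>A point of abscissa s and height l activates the indices with t i within min l 1 / 2 of
  s. For ordered points these are consecutive, so the count splits into pairs and each pair
  contributes the mass of one intersection of cones.\<close>

lemma energy_sorted:
  assumes t: "\<And>i j. i \<in> {1..n} \<Longrightarrow> j \<in> {1..n} \<Longrightarrow> i < j \<Longrightarrow> t i < t j"
    and t01: "\<And>i. i \<in> {1..n} \<Longrightarrow> 0 < t i \<and> t i < 1"
  shows "energy (\<lambda>_. 0) t = ennreal (\<Sum>p\<in>{1..n}. \<Sum>k\<in>{1..<p}. dfun s2 nu (p - k) * - ln (t p - t k))"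
proof -
  let ?C = "\<lambda>i. cone_set 0 (t i)"
  have "energy (\<lambda>_. 0) t = (\<integral>\<^sup>+x. (\<Sum>p\<in>{1..n}. \<Sum>k\<in>{1..<p}. ennreal (dfun s2 nu (p - k)) * indicator (?C k \<inter> ?C p) x) \<partial>rho)"
    unfolding energy_def
  proof (intro nn_integral_cong)
    fix x :: "real \<times> real"
    obtain s l where x: "x = (s, l)" by (cases x)
    let ?S = "{i\<in>{1..n}. x \<in> ?C i}"
    have card_eq: "\<Phi> (card ?S) = (\<Sum>p\<in>{1..n}. \<Sum>k\<in>{1..<p}. if k \<in> ?S \<and> p \<in> ?S then dfun s2 nu (p - k) else 0)"
    proof (rule \<Phi>_card_convex)
      fix i j k assume *: "i \<in> ?S" "k \<in> ?S" "i < j" "j < k"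
      have "t i < t j" "t j < t k" using * by (auto intro!: t)
      moreover have "\<bar>s - t i\<bar> \<le> min l 1 / 2" "\<bar>s - t k\<bar> \<le> min l 1 / 2" "0 \<le> l" using * by (auto simp: x cone_set_alt)
      ultimately have "\<bar>s - t j\<bar> \<le> min l 1 / 2" by linarith
      then show "j \<in> ?S" using * by (auto simp: x cone_set_alt)
    qed auto
    have "ennreal (\<Phi> (card ?S)) = (\<Sum>p\<in>{1..n}. \<Sum>k\<in>{1..<p}. ennreal (if k \<in> ?S \<and> p \<in> ?S then dfun s2 nu (p - k) else 0))"
      unfolding card_eq by (rule ennreal_double_sum) (simp add: d_nonneg)
    also have "\<dots> = (\<Sum>p\<in>{1..n}. \<Sum>k\<in>{1..<p}. ennreal (dfun s2 nu (p - k)) * indicator (?C k \<inter> ?C p) x)"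
    proof (intro sum.cong refl)
      fix p k assume "p \<in> {1..n}" "k \<in> {1..<p}"
      then have "k \<in> {1..n}" "p \<in> {1..n}" by auto
      then show "ennreal (if k \<in> ?S \<and> p \<in> ?S then dfun s2 nu (p - k) else 0) = ennreal (dfun s2 nu (p - k)) * indicator (?C k \<inter> ?C p) x"
        by (cases "x \<in> ?C k"; cases "x \<in> ?C p") simp_all
    qed
    finally show "ennreal (\<Phi> (card ?S)) = (\<Sum>p\<in>{1..n}. \<Sum>k\<in>{1..<p}. ennreal (dfun s2 nu (p - k)) * indicator (?C k \<inter> ?C p) x)" .
  qed
  also have "\<dots> = (\<Sum>p\<in>{1..n}. \<Sum>k\<in>{1..<p}. ennreal (dfun s2 nu (p - k)) * emeasure rho (?C k \<inter> ?C p))"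
  proof -
    have [measurable]: "?C k \<inter> ?C p \<in> sets rho" for k p by (auto simp: sets_rho)
    show ?thesis by (subst nn_integral_sum, measurable, subst nn_integral_sum, measurable) (auto simp: nn_integral_cmult_indicator)
  qed
  also have "\<dots> = (\<Sum>p\<in>{1..n}. \<Sum>k\<in>{1..<p}. ennreal (dfun s2 nu (p - k) * - ln (t p - t k)))"
  proof (intro sum.cong refl)
    fix p k assume "p \<in> {1..n}" "k \<in> {1..<p}"
    then have "t k < t p" "0 < t k" "t p < 1" using t[of k p] t01[of k] t01[of p] by auto
    then have "emeasure rho (?C k \<inter> ?C p) = ennreal (- ln (t p - t k))" "0 \<le> - ln (t p - t k)"
      by (auto intro!: emeasure_cone_Int)
    then show "ennreal (dfun s2 nu (p - k)) * emeasure rho (?C k \<inter> ?C p) = ennreal (dfun s2 nu (p - k) * - ln (t p - t k))"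
      by (simp only: ennreal_mult d_nonneg)
  qed
  also have "\<dots> = ennreal (\<Sum>p\<in>{1..n}. \<Sum>k\<in>{1..<p}. dfun s2 nu (p - k) * - ln (t p - t k))"
  proof -
    have nn: "0 \<le> dfun s2 nu (p - k) * - ln (t p - t k)" if "p \<in> {1..n}" "k \<in> {1..<p}" for p k
    proof -
      have "t k < t p" "0 < t k" "t p < 1" using that t[of k p] t01[of k] t01[of p] by auto
      then show ?thesis by (intro mult_nonneg_nonneg d_nonneg) auto
    qed
    then show ?thesis by (rule ennreal_double_sum[symmetric])
  qed
  finally show ?thesis .
qed

end

section \<open>Integrals over the cube and the ordered simplex\<close>

abbreviation lebn :: "nat \<Rightarrow> (nat \<Rightarrow> real) measure" where
  "lebn n \<equiv> PiM {1..n} (\<lambda>_. lborel)"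

interpretation lebn: product_sigma_finite "\<lambda>_::nat. lborel :: real measure"
  by standard

definition sorted_cube :: "nat \<Rightarrow> (nat \<Rightarrow> real) set" where
  "sorted_cube n = {t. (\<forall>i\<in>{1..n}. 0 < t i \<and> t i < 1) \<and> (\<forall>i\<in>{1..<n}. t i < t (Suc i))}"

definition cube :: "nat \<Rightarrow> (nat \<Rightarrow> real) set" where
  "cube n = {t. \<forall>i\<in>{1..n}. 0 < t i \<and> t i < 1}"

lemma sorted_cube_less:
  assumes "t \<in> sorted_cube n" "i \<in> {1..n}" "j \<in> {1..n}" "i < j"
  shows "t i < t j"
  using assms(4,2,3)
proof (induction rule: strict_inc_induct)
  case (base i) then show ?case using assms(1) by (auto simp: sorted_cube_def)
next
  case (step i)
  then have "t i < t (Suc i)" using assms(1) by (auto simp: sorted_cube_def)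
  also have "\<dots> < t j" using step by auto
  finally show ?case .
qed

lemma measurable_component_lebn: "i \<in> {1..n} \<Longrightarrow> (\<lambda>t. t i) \<in> borel_measurable (lebn n)"
  using measurable_component_singleton[of i "{1..n}" "\<lambda>_. lborel :: real measure"] by simp

lemma indicator_cube_measurable[measurable]:
    "(\<lambda>t. indicator (cube n) t :: ennreal) \<in> borel_measurable (lebn n)"
  and indicator_sorted_cube_measurable[measurable]:
    "(\<lambda>t. indicator (sorted_cube n) t :: ennreal) \<in> borel_measurable (lebn n)"
proof -
  have p1: "Measurable.pred (lebn n) (\<lambda>t. 0 < t i \<and> t i < 1)" if i: "i \<in> {1..n}" for i
    using i by measurable
  have p2: "Measurable.pred (lebn n) (\<lambda>t. t i < t (Suc i))" if "i \<in> {1..<n}" for i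
  proof -
    have "i \<in> {1..n}" "Suc i \<in> {1..n}" using that by auto
    then show ?thesis by measurable
  qed
  have [measurable]: "Measurable.pred (lebn n) (\<lambda>t. \<forall>i\<in>{1..n}. 0 < t i \<and> t i < 1)"
    by (intro pred_intros_finite p1) auto
  have [measurable]: "Measurable.pred (lebn n) (\<lambda>t. \<forall>i\<in>{1..<n}. t i < t (Suc i))"
    by (intro pred_intros_finite p2) auto
  have "(\<lambda>t. if \<forall>i\<in>{1..n}. 0 < t i \<and> t i < 1 then 1 else 0 :: ennreal) \<in> borel_measurable (lebn n)"
    by measurable
  then show "(\<lambda>t. indicator (cube n) t :: ennreal) \<in> borel_measurable (lebn n)"
    by (simp add: indicator_def of_bool_def cube_def)
  have "(\<lambda>t. if (\<forall>i\<in>{1..n}. 0 < t i \<and> t i < 1) \<and> (\<forall>i\<in>{1..<n}. t i < t (Suc i)) then 1 else 0 :: ennreal) \<in> borel_measurable (lebn n)"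
    by measurable
  then show "(\<lambda>t. indicator (sorted_cube n) t :: ennreal) \<in> borel_measurable (lebn n)"
    by (simp add: indicator_def of_bool_def sorted_cube_def)
qed

section \<open>Ties and reorderings of the coordinates\<close>

lemma AE_lebn_inj: "AE t in lebn n. inj_on t {1..n}"
proof -
  have ne: "AE t in lebn n. t i \<noteq> t j" if ij: "i \<in> {1..n}" "j \<in> {1..n}" "i \<noteq> j" for i j
  proof -
    let ?I = "{1..n} - {j}"
    have I: "{1..n} = insert j ?I" using ij by auto
    have "(\<lambda>t. if t i = t j then 1 else 0 :: ennreal) \<in> borel_measurable (lebn n)"
      using ij by measurable
    then have m: "(\<lambda>t. indicator {t. t i = t j} t :: ennreal) \<in> borel_measurable (lebn n)"
      by (simp add: indicator_def of_bool_def)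
    have "(\<integral>\<^sup>+t. indicator {t. t i = t j} t \<partial>lebn n) = (\<integral>\<^sup>+x. (\<integral>\<^sup>+y. indicator {t. t i = t j} (x(j := y)) \<partial>lborel) \<partial>PiM ?I (\<lambda>_. lborel :: real measure))"
      using lebn.product_nn_integral_insert[of ?I j, folded I, OF _ _ m] by auto
    also have "\<dots> = (\<integral>\<^sup>+x. 0 \<partial>PiM ?I (\<lambda>_. lborel :: real measure))"
    proof (rule nn_integral_cong)
      fix x :: "nat \<Rightarrow> real"
      have "(\<integral>\<^sup>+y. indicator {t. t i = t j} (x(j := y)) \<partial>lborel) = (\<integral>\<^sup>+y. indicator {x i} y \<partial>lborel)"
        using ij by (intro nn_integral_cong) (auto simp: indicator_def)
      then show "(\<integral>\<^sup>+y. indicator {t. t i = t j} (x(j := y)) \<partial>lborel) = 0" by simp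
    qed
    finally have "(\<integral>\<^sup>+t. indicator {t. t i = t j} t \<partial>lebn n) = 0" by simp
    then have "AE t in lebn n. (indicator {t. t i = t j} t :: ennreal) = 0"
      using m by (subst (asm) nn_integral_0_iff_AE) auto
    then show ?thesis by eventually_elim (auto simp: indicator_def split: if_splits)
  qed
  then have "AE t in lebn n. \<forall>i\<in>{1..n}. \<forall>j\<in>{1..n}. i \<noteq> j \<longrightarrow> t i \<noteq> t j"
    by (intro AE_finite_allI) (auto intro: AE_mp)
  then show ?thesis by eventually_elim (auto simp: inj_on_def)
qed

text \<open>Restricted to {1..n} so that the result is extensional, as points of the product space
  are.\<close>

definition rearrange :: "nat \<Rightarrow> (nat \<Rightarrow> nat) \<Rightarrow> (nat \<Rightarrow> real) \<Rightarrow> nat \<Rightarrow> real" where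
  "rearrange n \<sigma> t = (\<lambda>i\<in>{1..n}. t (\<sigma> i))"

lemma measurable_rearrange[measurable]:
  assumes "\<sigma> permutes {1..n}"
  shows "rearrange n \<sigma> \<in> measurable (lebn n) (lebn n)"
  unfolding rearrange_def[abs_def]
  by (intro measurable_restrict measurable_component_singleton) (use assms permutes_in_image in fastforce)

text \<open>The product measure is determined by its values on boxes. The preimage of a box is the
  box with permuted sides, of the same measure because all factors are equal.\<close>

lemma distr_rearrange:
  assumes s: "\<sigma> permutes {1..n}"
  shows "distr (lebn n) (lebn n) (rearrange n \<sigma>) = lebn n"
proof (rule lebn.PiM_eqI)
  note [measurable] = measurable_rearrange[OF s]
  fix A :: "nat \<Rightarrow> real set" assume A: "\<And>i. i \<in> {1..n} \<Longrightarrow> A i \<in> sets lborel"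
  have inv: "inv \<sigma> permutes {1..n}" using s by (rule permutes_inv)
  have "rearrange n \<sigma> -` Pi\<^sub>E {1..n} A \<inter> space (lebn n) = Pi\<^sub>E {1..n} (\<lambda>j. A (inv \<sigma> j))"
  proof (intro set_eqI iffI)
    fix t assume t: "t \<in> rearrange n \<sigma> -` Pi\<^sub>E {1..n} A \<inter> space (lebn n)"
    have "t j \<in> A (inv \<sigma> j)" if "j \<in> {1..n}" for j
    proof -
      have "inv \<sigma> j \<in> {1..n}" using permutes_in_image[OF inv] that by blast
      then have "rearrange n \<sigma> t (inv \<sigma> j) \<in> A (inv \<sigma> j)" using t by auto
      then show ?thesis using \<open>inv \<sigma> j \<in> {1..n}\<close> permutes_inverses(1)[OF s] by (simp add: rearrange_def)
    qed
    then show "t \<in> Pi\<^sub>E {1..n} (\<lambda>j. A (inv \<sigma> j))" using t by (auto simp: space_PiM PiE_def)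
  next
    fix t assume t: "t \<in> Pi\<^sub>E {1..n} (\<lambda>j. A (inv \<sigma> j))"
    have "t (\<sigma> i) \<in> A i" if "i \<in> {1..n}" for i
    proof -
      have "\<sigma> i \<in> {1..n}" using permutes_in_image[OF s] that by blast
      then have "t (\<sigma> i) \<in> A (inv \<sigma> (\<sigma> i))" using t by blast
      then show ?thesis using permutes_inverses(2)[OF s] by simp
    qed
    then show "t \<in> rearrange n \<sigma> -` Pi\<^sub>E {1..n} A \<inter> space (lebn n)"
      using t by (auto simp: rearrange_def space_PiM PiE_def)
  qed
  moreover have "emeasure (distr (lebn n) (lebn n) (rearrange n \<sigma>)) (Pi\<^sub>E {1..n} A) = emeasure (lebn n) (rearrange n \<sigma> -` Pi\<^sub>E {1..n} A \<inter> space (lebn n))"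
    using A by (intro emeasure_distr measurable_rearrange[OF s] sets_PiM_I_finite) auto
  moreover have "emeasure (lebn n) (Pi\<^sub>E {1..n} (\<lambda>j. A (inv \<sigma> j))) = (\<Prod>j\<in>{1..n}. emeasure lborel (A (inv \<sigma> j)))"
    using A permutes_in_image[OF inv] by (intro lebn.emeasure_PiM) blast+
  moreover have "(\<Prod>j\<in>{1..n}. emeasure lborel (A (inv \<sigma> j))) = (\<Prod>i\<in>{1..n}. emeasure lborel (A i))"
    using prod.permute[OF inv, of "\<lambda>i. emeasure lborel (A i)"] by (simp add: o_def)
  ultimately show "emeasure (distr (lebn n) (lebn n) (rearrange n \<sigma>)) (Pi\<^sub>E {1..n} A) = (\<Prod>i\<in>{1..n}. emeasure lborel (A i))"
    by simp
qed auto

lemma rearrange_sorted_cube: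
  assumes "t \<in> cube n" "\<sigma> permutes {1..n}"
  shows "rearrange n \<sigma> t \<in> sorted_cube n \<longleftrightarrow> strict_mono_on {1..n} (\<lambda>i. t (\<sigma> i))"
proof
  assume *: "rearrange n \<sigma> t \<in> sorted_cube n"
  show "strict_mono_on {1..n} (\<lambda>i. t (\<sigma> i))"
    by (rule strict_mono_onI) (use sorted_cube_less[OF *] in \<open>auto simp: rearrange_def\<close>)
next
  assume *: "strict_mono_on {1..n} (\<lambda>i. t (\<sigma> i))"
  then have "t (\<sigma> i) < t (\<sigma> (Suc i))" if "i \<in> {1..<n}" for i
    using that by (auto intro: strict_mono_onD)
  moreover have "0 < t (\<sigma> i) \<and> t (\<sigma> i) < 1" if "i \<in> {1..n}" for i
    using assms that permutes_in_image[OF assms(2)] by (auto simp: cube_def)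
  ultimately show "rearrange n \<sigma> t \<in> sorted_cube n"
    by (auto simp: sorted_cube_def rearrange_def)
qed

text \<open>For existence the distinct values are sorted and their indices read off by the inverse
  of \<open>t\<close>. For uniqueness, two sorting permutations list the same set of values in
  increasing order, and such a list is unique.\<close>

lemma unique_sorting_permutation:
  assumes inj: "inj_on (t :: nat \<Rightarrow> real) {1..n}"
  shows "\<exists>!\<sigma>. \<sigma> permutes {1..n} \<and> strict_mono_on {1..n} (\<lambda>i. t (\<sigma> i))"
proof (rule ex_ex1I)
  define xs where "xs = sorted_list_of_set (t ` {1..n})"
  have len: "length xs = n" using inj by (simp add: xs_def card_image)
  have xs: "sorted_wrt (<) xs" "set xs = t ` {1..n}" "distinct xs" by (auto simp: xs_def)
  define g where "g = the_inv_into {1..n} t"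
  \<comment> \<open>\<open>i - 1\<close> passes from indices starting at 1 to list positions
    starting at 0; outside {1..n} a permutation has to be the identity.\<close>
  define \<sigma> where "\<sigma> i = (if i \<in> {1..n} then g (xs ! (i - 1)) else i)" for i
  have "bij_betw (\<lambda>i. i - 1) {1..n} {..<n}"
    by (rule bij_betw_byWitness[of _ Suc]) auto
  moreover have "bij_betw ((!) xs) {..<n} (t ` {1..n})"
    using xs len by (intro bij_betw_nth) auto
  moreover have "bij_betw g (t ` {1..n}) {1..n}"
    unfolding g_def using inj by (intro bij_betw_the_inv_into) (simp add: bij_betw_def)
  ultimately have "bij_betw (g \<circ> ((!) xs \<circ> (\<lambda>i. i - 1))) {1..n} {1..n}"
    by (blast intro: bij_betw_trans)
  then have "bij_betw \<sigma> {1..n} {1..n}"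
    by (rule bij_betw_cong[THEN iffD1, rotated]) (simp add: \<sigma>_def)
  then have perm: "\<sigma> permutes {1..n}"
    by (rule bij_imp_permutes) (auto simp: \<sigma>_def)
  have t\<sigma>: "t (\<sigma> i) = xs ! (i - 1)" if "i \<in> {1..n}" for i
  proof -
    have "xs ! (i - 1) \<in> t ` {1..n}" using that len xs(2) nth_mem[of "i - 1" xs] by auto
    then show ?thesis using that inj by (simp add: \<sigma>_def g_def f_the_inv_into_f)
  qed
  have "strict_mono_on {1..n} (\<lambda>i. t (\<sigma> i))"
  proof (rule strict_mono_onI)
    fix i j :: nat assume "i \<in> {1..n}" "j \<in> {1..n}" "i < j"
    then show "t (\<sigma> i) < t (\<sigma> j)"
      using sorted_wrt_nth_less[OF xs(1), of "i - 1" "j - 1"] by (auto simp: t\<sigma> len)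
  qed
  with perm show "\<exists>\<sigma>. \<sigma> permutes {1..n} \<and> strict_mono_on {1..n} (\<lambda>i. t (\<sigma> i))" by blast
next
  fix \<sigma> \<tau> assume s: "\<sigma> permutes {1..n} \<and> strict_mono_on {1..n} (\<lambda>i. t (\<sigma> i))"
    and r: "\<tau> permutes {1..n} \<and> strict_mono_on {1..n} (\<lambda>i. t (\<tau> i))"
  let ?l = "\<lambda>\<sigma>. map (\<lambda>i. t (\<sigma> i)) [1..<Suc n]"
  have l: "sorted (?l \<sigma>) \<and> distinct (?l \<sigma>) \<and> set (?l \<sigma>) = t ` {1..n}"
    if "\<sigma> permutes {1..n} \<and> strict_mono_on {1..n} (\<lambda>i. t (\<sigma> i))" for \<sigma>
  proof -
    have "sorted_wrt (<) (?l \<sigma>)"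
      unfolding sorted_wrt_iff_nth_less using that by (auto intro!: strict_mono_onD[of "{1..n}" "\<lambda>i. t (\<sigma> i)"] simp del: upt_Suc)
    moreover have "set (?l \<sigma>) = t ` {1..n}"
    proof -
      have "set (?l \<sigma>) = t ` (\<sigma> ` {1..n})" by (auto simp: atLeastLessThanSuc_atLeastAtMost simp del: upt_Suc)
      then show ?thesis using permutes_image that by metis
    qed
    ultimately show ?thesis by (auto simp: strict_sorted_iff simp del: upt_Suc)
  qed
  have "?l \<sigma> = ?l \<tau>" using l[OF s] l[OF r] by (intro sorted_distinct_set_unique) auto
  then have eq: "t (\<sigma> i) = t (\<tau> i)" if "i \<in> {1..n}" for i
    using that by (auto simp del: upt_Suc)
  show "\<sigma> = \<tau>"
  proof
    fix i show "\<sigma> i = \<tau> i"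
    proof (cases "i \<in> {1..n}")
      case True
      have "\<sigma> i \<in> {1..n}" "\<tau> i \<in> {1..n}"
        using permutes_in_image[OF conjunct1[OF s], THEN iffD2, OF True] permutes_in_image[OF conjunct1[OF r], THEN iffD2, OF True] by blast+
      then show ?thesis using inj_onD[OF inj eq[OF True]] by blast
    next
      case False then show ?thesis using s r by (metis permutes_not_in)
    qed
  qed
qed

text \<open>Off the null set of ties, exactly one reordering of a point of the cube lies in the
  simplex. Summing over all n! reorderings therefore reproduces the integrand on the cube, and each
  summand has the same integral because coordinate permutations preserve the measure.\<close>

lemma nn_integral_cube_symmetric:
  assumes H[measurable]: "H \<in> borel_measurable (lebn n)"
    and sym: "\<And>\<sigma> t. \<sigma> permutes {1..n} \<Longrightarrow> H (rearrange n \<sigma> t) = H t"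
  shows "(\<integral>\<^sup>+t. indicator (cube n) t * H t \<partial>lebn n) = ennreal (fact n) * (\<integral>\<^sup>+t. indicator (sorted_cube n) t * H t \<partial>lebn n)"
proof -
  let ?S = "{\<sigma>. \<sigma> permutes {1..n}}"
  have fin: "finite ?S" by (rule finite_permutations) simp
  have "(\<integral>\<^sup>+t. indicator (cube n) t * H t \<partial>lebn n) = (\<integral>\<^sup>+t. (\<Sum>\<sigma>\<in>?S. indicator (sorted_cube n) (rearrange n \<sigma> t) * H (rearrange n \<sigma> t)) \<partial>lebn n)"
  proof (rule nn_integral_cong_AE)
    show "AE t in lebn n. indicator (cube n) t * H t = (\<Sum>\<sigma>\<in>?S. indicator (sorted_cube n) (rearrange n \<sigma> t) * H (rearrange n \<sigma> t))"
      using AE_lebn_inj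
    proof eventually_elim
      case (elim t)
      show ?case
      proof (cases "t \<in> cube n")
        case True
        obtain \<tau> where \<tau>: "\<tau> permutes {1..n}" "strict_mono_on {1..n} (\<lambda>i. t (\<tau> i))"
          and uniq: "\<And>\<sigma>. \<sigma> permutes {1..n} \<Longrightarrow> strict_mono_on {1..n} (\<lambda>i. t (\<sigma> i)) \<Longrightarrow> \<sigma> = \<tau>"
          using unique_sorting_permutation[OF elim] by blast
        have "(\<Sum>\<sigma>\<in>?S. indicator (sorted_cube n) (rearrange n \<sigma> t) * H (rearrange n \<sigma> t)) = (\<Sum>\<sigma>\<in>?S. if \<sigma> = \<tau> then H t else 0)"
        proof (intro sum.cong refl)
          fix \<sigma> assume "\<sigma> \<in> ?S"
          then have s: "\<sigma> permutes {1..n}" by simp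
          show "indicator (sorted_cube n) (rearrange n \<sigma> t) * H (rearrange n \<sigma> t) = (if \<sigma> = \<tau> then H t else 0)"
          proof (cases "\<sigma> = \<tau>")
            case eq: True
            then have "rearrange n \<sigma> t \<in> sorted_cube n" using rearrange_sorted_cube[OF True s] \<tau>(2) by blast
            then show ?thesis using eq sym[OF s] by simp
          next
            case False
            then have "rearrange n \<sigma> t \<notin> sorted_cube n" using rearrange_sorted_cube[OF True s] uniq[OF s] by blast
            then show ?thesis using False by simp
          qed
        qed
        then show ?thesis using True \<tau>(1) fin by simp
      next
        case False
        have "rearrange n \<sigma> t \<notin> sorted_cube n" if s: "\<sigma> permutes {1..n}" for \<sigma>
        proof
          assume *: "rearrange n \<sigma> t \<in> sorted_cube n"
          have "0 < t j \<and> t j < 1" if "j \<in> {1..n}" for j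
          proof -
            have "j \<in> \<sigma> ` {1..n}" using that unfolding permutes_image[OF s] .
            then obtain i where i: "i \<in> {1..n}" "j = \<sigma> i" by (rule imageE)
            have "0 < rearrange n \<sigma> t i \<and> rearrange n \<sigma> t i < 1"
              using * i(1) unfolding sorted_cube_def by blast
            then show ?thesis using i by (simp add: rearrange_def del: One_nat_def)
          qed
          then show False using False unfolding cube_def by blast
        qed
        then show ?thesis using False by simp
      qed
    qed
  qed
  also have "\<dots> = (\<Sum>\<sigma>\<in>?S. \<integral>\<^sup>+t. indicator (sorted_cube n) (rearrange n \<sigma> t) * H (rearrange n \<sigma> t) \<partial>lebn n)"
  proof (rule nn_integral_sum)
    fix \<sigma> assume "\<sigma> \<in> ?S"
    then have [measurable]: "rearrange n \<sigma> \<in> measurable (lebn n) (lebn n)" by (intro measurable_rearrange) simp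
    show "(\<lambda>t. indicator (sorted_cube n) (rearrange n \<sigma> t) * H (rearrange n \<sigma> t)) \<in> borel_measurable (lebn n)"
      by measurable
  qed
  also have "\<dots> = (\<Sum>\<sigma>\<in>?S. \<integral>\<^sup>+t. indicator (sorted_cube n) t * H t \<partial>lebn n)"
  proof (intro sum.cong refl)
    fix \<sigma> assume s: "\<sigma> \<in> ?S"
    then have [measurable]: "rearrange n \<sigma> \<in> measurable (lebn n) (lebn n)" by (intro measurable_rearrange) simp
    have "(\<integral>\<^sup>+t. indicator (sorted_cube n) t * H t \<partial>lebn n) = (\<integral>\<^sup>+t. indicator (sorted_cube n) t * H t \<partial>distr (lebn n) (lebn n) (rearrange n \<sigma>))"
      using s by (simp add: distr_rearrange del: One_nat_def)
    also have "\<dots> = (\<integral>\<^sup>+t. indicator (sorted_cube n) (rearrange n \<sigma> t) * H (rearrange n \<sigma> t) \<partial>lebn n)"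
      by (rule nn_integral_distr) measurable
    finally show "(\<integral>\<^sup>+t. indicator (sorted_cube n) (rearrange n \<sigma> t) * H (rearrange n \<sigma> t) \<partial>lebn n) = (\<integral>\<^sup>+t. indicator (sorted_cube n) t * H t \<partial>lebn n)" by simp
  qed
  also have "\<dots> = ennreal (fact n) * (\<integral>\<^sup>+t. indicator (sorted_cube n) t * H t \<partial>lebn n)"
    by (simp add: card_permutations[OF refl] ennreal_of_nat_eq_real_of_nat)
  finally show ?thesis .
qed

section \<open>Integrability of products of powers of gaps\<close>

lemma nn_integral_powr_gap:
  assumes "a < 1"
  shows "(\<integral>\<^sup>+y. ennreal (indicator {0<..<1} y * y powr (- a)) \<partial>lborel) < \<infinity>"
proof -
  have "(\<integral>\<^sup>+y. ennreal (indicator {0<..<1} y * y powr (- a)) \<partial>lborel) \<le> (\<integral>\<^sup>+y. ennreal (indicator {0..1} y * y powr (- a)) \<partial>lborel)"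
    by (intro nn_integral_mono) (auto simp: indicator_def)
  also have "\<dots> = ennreal (1 powr (- a + 1) / (- a + 1))"
    by (rule nn_integral_has_integral_lebesgue[OF _ has_integral_powr_from_0]) (use assms in auto)
  also have "\<dots> < \<infinity>" by simp
  finally show ?thesis .
qed

text \<open>The last coordinate is integrated first: by translation invariance its gap contributes
  the full integral of \<open>g\<close>, whatever the other coordinates are. The first coordinate,
  confined to the unit interval, contributes 1.\<close>

lemma nn_integral_gaps:
  assumes g[measurable]: "g \<in> borel_measurable borel"
  shows "(\<integral>\<^sup>+t. indicator {0<..<1} (t 1) * (\<Prod>i\<in>{1..<Suc m}. g (t (Suc i) - t i)) \<partial>lebn (Suc m)) = (\<integral>\<^sup>+y. g y \<partial>lborel) ^ m"
proof (induction m)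
  case 0
  have "(\<integral>\<^sup>+t. indicator {0<..<1} (t 1) \<partial>PiM {1::nat} (\<lambda>_. lborel :: real measure)) = (\<integral>\<^sup>+t. indicator {0<..<1::real} t \<partial>lborel)"
    by (rule lebn.product_nn_integral_singleton) auto
  then show ?case by simp
next
  case (Suc m)
  let ?f = "\<lambda>m t. indicator {0<..<1} (t 1) * (\<Prod>i\<in>{1..<Suc m}. g (t (Suc i) - t i)) :: ennreal"
  have m: "?f m \<in> borel_measurable (lebn (Suc m))" for m
    by (intro borel_measurable_times_ennreal borel_measurable_prod_ennreal measurable_compose[OF _ g] borel_measurable_diff
          measurable_component_lebn measurable_compose[OF measurable_component_lebn]) auto
  have I: "{1..Suc (Suc m)} = insert (Suc (Suc m)) {1..Suc m}" by auto
  have "(\<integral>\<^sup>+t. ?f (Suc m) t \<partial>lebn (Suc (Suc m))) = (\<integral>\<^sup>+x. (\<integral>\<^sup>+y. ?f (Suc m) (x(Suc (Suc m) := y)) \<partial>lborel) \<partial>lebn (Suc m))"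
    using m[of "Suc m"] unfolding I by (intro lebn.product_nn_integral_insert) auto
  also have "\<dots> = (\<integral>\<^sup>+x. ?f m x * (\<integral>\<^sup>+y. g y \<partial>lborel) \<partial>lebn (Suc m))"
  proof (rule nn_integral_cong)
    fix x :: "nat \<Rightarrow> real"
    have "(\<Prod>i\<in>{1..<Suc m}. g ((x(Suc (Suc m) := y)) (Suc i) - (x(Suc (Suc m) := y)) i)) = (\<Prod>i\<in>{1..<Suc m}. g (x (Suc i) - x i))" for y
      by (rule prod.cong) auto
    then have "(\<integral>\<^sup>+y. ?f (Suc m) (x(Suc (Suc m) := y)) \<partial>lborel) = (\<integral>\<^sup>+y. ?f m x * g (y - x (Suc m)) \<partial>lborel)"
      by (intro nn_integral_cong) (simp add: mult_ac)
    also have "\<dots> = ?f m x * (\<integral>\<^sup>+y. g (y - x (Suc m)) \<partial>lborel)"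
      by (rule nn_integral_cmult, rule measurable_compose[OF _ g]) simp
    also have "(\<integral>\<^sup>+y. g (y - x (Suc m)) \<partial>lborel) = (\<integral>\<^sup>+y. g y \<partial>lborel)"
      using nn_integral_real_affine[OF g, of 1 "- x (Suc m)"] by (simp add: algebra_simps)
    finally show "(\<integral>\<^sup>+y. ?f (Suc m) (x(Suc (Suc m) := y)) \<partial>lborel) = ?f m x * (\<integral>\<^sup>+y. g y \<partial>lborel)" .
  qed
  also have "\<dots> = (\<integral>\<^sup>+y. g y \<partial>lborel) ^ m * (\<integral>\<^sup>+y. g y \<partial>lborel)"
    by (subst nn_integral_multc[OF m]) (simp only: Suc.IH)
  finally show ?case by (simp only: power_Suc2)
qed

context spectral
begin

text \<open>For each distance m, \<open>sum_ln_blocks_ge\<close> with K = n - 1 - m bounds the pairs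
  at that distance by the fraction (n - m) / (n - 1) of the total logarithm of the gaps. Weighted by
  d(m), these fractions add up to \<open>\<Phi> n / (n - 1)\<close>.\<close>

lemma energy_sum_le:
  assumes t: "t \<in> sorted_cube n"
  shows "(\<Sum>p\<in>{1..n}. \<Sum>k\<in>{1..<p}. dfun s2 nu (p - k) * - ln (t p - t k))
     \<le> (\<Phi> n / real (n - 1)) * (\<Sum>i\<in>{1..<n}. - ln (t (Suc i) - t i))"
proof -
  define x where "x i = t (Suc (Suc i)) - t (Suc i)" for i
  have xpos: "x i > 0" if "i < n - 1" for i
    using t that by (auto simp: x_def sorted_cube_def)
  have tele: "(\<Sum>j<m. x (s + j)) = t (Suc s + m) - t (Suc s)" for s m
    by (induction m) (auto simp: x_def)
  let ?L = "\<Sum>i<n - 1. - ln (x i)"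
  have "(\<Sum>p\<in>{1..n}. \<Sum>k\<in>{1..<p}. dfun s2 nu (p - k) * - ln (t p - t k))
     = (\<Sum>(p, k)\<in>Sigma {1..n} (\<lambda>p. {1..<p}). dfun s2 nu (p - k) * - ln (t p - t k))"
    by (rule sum.Sigma) auto
  \<comment> \<open>Pairs k < p are regrouped by distance m = p - k, and s = k - 1 is the position,
    counted from 0, of the first of the m gaps between them; t p - t k is then a block sum of
    \<open>x\<close>.\<close>
  also have "\<dots> = (\<Sum>(m, s)\<in>Sigma {1..<n} (\<lambda>m. {..n - 1 - m}). dfun s2 nu m * - ln (\<Sum>j<m. x (s + j)))"
    by (rule sum.reindex_bij_witness[of _ "\<lambda>(m, s). (Suc s + m, Suc s)" "\<lambda>(p, k). (p - k, k - 1)"])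
       (auto simp: tele)
  also have "\<dots> = (\<Sum>m\<in>{1..<n}. \<Sum>s\<le>n - 1 - m. dfun s2 nu m * - ln (\<Sum>j<m. x (s + j)))"
    by (rule sum.Sigma[symmetric]) auto
  also have "\<dots> = (\<Sum>m\<in>{1..<n}. dfun s2 nu m * (\<Sum>s\<le>n - 1 - m. - ln (\<Sum>j<m. x (s + j))))"
    by (simp only: sum_distrib_left)
  also have "\<dots> \<le> (\<Sum>m\<in>{1..<n}. dfun s2 nu m * (real (n - m) / real (n - 1) * ?L))"
  proof (intro sum_mono mult_left_mono d_nonneg)
    fix m assume m: "m \<in> {1..<n}"
    have K: "n - 1 - m + m = n - 1" using m by auto
    have "(real (n - 1 - m) + 1) * (\<Sum>i<n - 1 - m + m. ln (x i)) \<le> real (n - 1 - m + m) * (\<Sum>s\<le>n - 1 - m. ln (\<Sum>j<m. x (s + j)))"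
      using m by (intro sum_ln_blocks_ge xpos) auto
    moreover have "real (n - 1 - m) + 1 = real (n - m)" using m by (simp add: of_nat_diff)
    ultimately have "real (n - m) * (\<Sum>i<n - 1. ln (x i)) \<le> real (n - 1) * (\<Sum>s\<le>n - 1 - m. ln (\<Sum>j<m. x (s + j)))"
      unfolding K by simp
    then show "(\<Sum>s\<le>n - 1 - m. - ln (\<Sum>j<m. x (s + j))) \<le> real (n - m) / real (n - 1) * ?L"
      using n2 by (simp add: sum_negf field_simps)
  qed
  also have "\<dots> = (\<Sum>m\<in>{1..<n}. (real (n - m) * dfun s2 nu m) * (?L / real (n - 1)))"
    by (rule sum.cong) auto
  also have "\<dots> = \<Phi> n * (?L / real (n - 1))"
    unfolding \<Phi>_def by (rule sum_distrib_right[symmetric])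
  also have "\<dots> = \<Phi> n / real (n - 1) * ?L" by simp
  also have "?L = (\<Sum>i\<in>{1..<n}. - ln (t (Suc i) - t i))"
    by (rule sum.reindex_bij_witness[of _ "\<lambda>i. i - 1" Suc]) (auto simp: x_def)
  finally show ?thesis .
qed

end

section \<open>Moments of the approximating measures\<close>

lemma measurable_fst_real[measurable]: "fst \<in> borel_measurable (borel :: (real \<times> real) measure)"
  by (intro borel_measurable_continuous_onI continuous_intros)

lemma pred_le_real:
  fixes f g :: "'a \<Rightarrow> real"
  shows "f \<in> borel_measurable M \<Longrightarrow> g \<in> borel_measurable M \<Longrightarrow> Measurable.pred M (\<lambda>x. f x \<le> g x)"
  unfolding pred_def by (rule borel_measurable_le)

context spectral
begin

lemma energy_measurable[measurable]: "energy (\<lambda>_. 0) \<in> borel_measurable (lebn n)"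
proof -
  have Q: "Measurable.pred (lebn n \<Otimes>\<^sub>M (lborel :: (real \<times> real) measure)) (\<lambda>z. snd z \<in> cone_set 0 (fst z i))"
    if i: "i \<in> {1..n}" for i
  proof -
    have [measurable]: "(\<lambda>z. fst z i) \<in> borel_measurable (lebn n \<Otimes>\<^sub>M (lborel :: (real \<times> real) measure))"
      using measurable_compose[OF measurable_fst measurable_component_lebn[OF i]] .
    have [measurable]: "(\<lambda>z. fst (snd z)) \<in> borel_measurable (lebn n \<Otimes>\<^sub>M (lborel :: (real \<times> real) measure))"
      "(\<lambda>z. snd (snd z)) \<in> borel_measurable (lebn n \<Otimes>\<^sub>M (lborel :: (real \<times> real) measure))"
      by (rule measurable_compose[OF measurable_snd], simp add: measurable_fst_real measurable_snd_real)+
    show ?thesis unfolding cone_set_def case_prod_unfold mem_Collect_eq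
      by (intro pred_intros_logic pred_le_real borel_measurable_diff borel_measurable_abs borel_measurable_divide
            borel_measurable_const; fact)
  qed
  \<comment> \<open>Measurability of the number of active cones is read off from a sum of
    indicators; the floor then turns this real sum back into a natural number to which
    \<open>\<Phi>\<close> applies.\<close>
  have "(\<lambda>z. \<Sum>i\<in>{1..n}. if snd z \<in> cone_set 0 (fst z i) then 1 else 0 :: real) \<in> borel_measurable (lebn n \<Otimes>\<^sub>M (lborel :: (real \<times> real) measure))"
    by (intro borel_measurable_sum measurable_If Q[unfolded pred_def] measurable_const) (auto intro: Q[unfolded pred_def])
  from measurable_compose[OF this, of "\<lambda>y. ennreal (\<Phi> (nat \<lfloor>y\<rfloor>))" borel]
  have "(\<lambda>z. ennreal (\<Phi> (nat \<lfloor>\<Sum>i\<in>{1..n}. if snd z \<in> cone_set 0 (fst z i) then 1 else 0 :: real\<rfloor>))) \<in> borel_measurable (lebn n \<Otimes>\<^sub>M (lborel :: (real \<times> real) measure))"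
    by measurable
  also have "(\<lambda>z. ennreal (\<Phi> (nat \<lfloor>\<Sum>i\<in>{1..n}. if snd z \<in> cone_set 0 (fst z i) then 1 else 0 :: real\<rfloor>)))
     = (\<lambda>z. ennreal (\<Phi> (card {i\<in>{1..n}. snd z \<in> cone_set 0 (fst z i)})))"
  proof
    fix z :: "(nat \<Rightarrow> real) \<times> real \<times> real"
    have "(\<Sum>i\<in>{1..n}. if snd z \<in> cone_set 0 (fst z i) then 1 else 0 :: real) = real (card {i\<in>{1..n}. snd z \<in> cone_set 0 (fst z i)})"
      by (subst sum.inter_filter[symmetric]) auto
    then show "ennreal (\<Phi> (nat \<lfloor>\<Sum>i\<in>{1..n}. if snd z \<in> cone_set 0 (fst z i) then 1 else 0 :: real\<rfloor>))
       = ennreal (\<Phi> (card {i\<in>{1..n}. snd z \<in> cone_set 0 (fst z i)}))" by simp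
  qed
  finally have [measurable]: "(\<lambda>z. ennreal (\<Phi> (card {i\<in>{1..n}. snd z \<in> cone_set 0 (fst z i)}))) \<in> borel_measurable (lebn n \<Otimes>\<^sub>M (lborel :: (real \<times> real) measure))" .
  \<comment> \<open>Passing to the density makes \<sigma>-finite Lebesgue measure the integrator, as
    measurability of an integral depending on a parameter requires.\<close>
  define dens where "dens x = indicator Hplus x * ennreal (1 / (snd x)\<^sup>2)" for x :: "real \<times> real"
  have dm: "dens \<in> borel_measurable (lborel :: (real \<times> real) measure)"
    unfolding dens_def[abs_def] by measurable
  have "energy (\<lambda>_. 0) t = (\<integral>\<^sup>+x. dens x * ennreal (\<Phi> (card {i\<in>{1..n}. x \<in> cone_set 0 (t i)})) \<partial>lborel)"
    if "t \<in> space (lebn n)" for t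
  proof -
    have m: "(\<lambda>x. ennreal (\<Phi> (card {i\<in>{1..n}. x \<in> cone_set 0 (t i)}))) \<in> borel_measurable lborel"
      using measurable_compose[OF measurable_Pair1'[OF that] \<open>(\<lambda>z. ennreal (\<Phi> (card {i\<in>{1..n}. snd z \<in> cone_set 0 (fst z i)}))) \<in> _\<close>] by simp
    show ?thesis
      unfolding energy_def rho_def dens_def[symmetric] by (rule nn_integral_density[OF dm m])
  qed
  moreover have "(\<lambda>t. \<integral>\<^sup>+x. dens x * ennreal (\<Phi> (card {i\<in>{1..n}. x \<in> cone_set 0 (t i)})) \<partial>lborel) \<in> borel_measurable (lebn n)"
  proof (rule lborel.borel_measurable_nn_integral)
    have "(\<lambda>z. dens (snd z) * ennreal (\<Phi> (card {i\<in>{1..n}. snd z \<in> cone_set 0 (fst z i)}))) \<in> borel_measurable (lebn n \<Otimes>\<^sub>M (lborel :: (real \<times> real) measure))"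
      by (intro borel_measurable_times_ennreal measurable_compose[OF measurable_snd dm]) measurable
    then show "(\<lambda>(t, x). dens x * ennreal (\<Phi> (card {i\<in>{1..n}. x \<in> cone_set 0 (t i)}))) \<in> borel_measurable (lebn n \<Otimes>\<^sub>M lborel)"
      by (simp add: case_prod_unfold)
  qed
  ultimately show ?thesis by (subst measurable_cong) auto
qed

lemma energy_rearrange:
  assumes s: "\<sigma> permutes {1..n}"
  shows "energy (\<lambda>_. 0) (rearrange n \<sigma> t) = energy (\<lambda>_. 0) t"
proof -
  have "card {i\<in>{1..n}. x \<in> cone_set 0 (rearrange n \<sigma> t i)} = card {i\<in>{1..n}. x \<in> cone_set 0 (t i)}" for x
  proof -
    have "{i\<in>{1..n}. x \<in> cone_set 0 (t i)} = \<sigma> ` {i\<in>{1..n}. x \<in> cone_set 0 (rearrange n \<sigma> t i)}"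
    proof (intro set_eqI iffI)
      fix j assume j: "j \<in> {i\<in>{1..n}. x \<in> cone_set 0 (t i)}"
      then have "j \<in> \<sigma> ` {1..n}" unfolding permutes_image[OF s] by blast
      then obtain i where "i \<in> {1..n}" "j = \<sigma> i" by (rule imageE)
      then show "j \<in> \<sigma> ` {i\<in>{1..n}. x \<in> cone_set 0 (rearrange n \<sigma> t i)}" using j by (auto simp: rearrange_def)
    next
      fix j assume "j \<in> \<sigma> ` {i\<in>{1..n}. x \<in> cone_set 0 (rearrange n \<sigma> t i)}"
      then obtain i where i: "i \<in> {1..n}" "x \<in> cone_set 0 (rearrange n \<sigma> t i)" "j = \<sigma> i" by blast
      have "j \<in> {1..n}" using permutes_in_image[OF s, THEN iffD2, OF i(1)] i(3) by simp
      then show "j \<in> {i\<in>{1..n}. x \<in> cone_set 0 (t i)}" using i by (simp add: rearrange_def del: One_nat_def)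
    qed
    then show ?thesis
      by (simp add: card_image[OF inj_on_subset[OF permutes_inj_on[OF s] subset_UNIV]])
  qed
  then show ?thesis by (simp only: energy_def)
qed

end

locale log_id_moment = log_id s2 M nu n \<mu> Pr P for s2 M nu n \<mu> and Pr :: "'w measure" and P +
  fixes Mmu :: "'w \<Rightarrow> real measure" and f :: "real \<Rightarrow> real"
  assumes lim: "limit_logID_measure Pr P Mmu" and cond: "real n - \<mu> * \<Phi> n > 1"
    and fcont: "continuous_on {0..1} f" and fpos: "\<And>t. t \<in> {0..1} \<Longrightarrow> f t \<ge> 0"
begin

text \<open>Sign and continuity of \<open>f\<close> are known on [0, 1] only. The open interval fits
  the open simplex of the formula; the two endpoints are null for the approximating
  measures.\<close>

definition cut_f :: "real \<Rightarrow> real" where "cut_f t = indicator {0<..<1} t * f t"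

text \<open>The offset 2 keeps every scale strictly between 0 and 1, the range in which the
  truncated field is assumed jointly measurable.\<close>

definition scale :: "nat \<Rightarrow> real" where "scale j = 1 / real (j + 2)"

definition approx :: "nat \<Rightarrow> 'w \<Rightarrow> ennreal" where
  "approx j \<omega> = (\<integral>\<^sup>+u. ennreal (cut_f u) * ennreal (exp (P (cone_set (scale j) u) \<omega>)) \<partial>lborel)"

text \<open>The value \<open>\<top>\<close> on configurations of infinite energy, where \<open>enn2real\<close> would give \<open>0\<close>, makes \<open>weight\<close>
  an upper bound for the truncated weights at every point.\<close>

definition weight :: "(nat \<Rightarrow> real) \<Rightarrow> ennreal" where
  "weight t = (if energy (\<lambda>_. 0) t = \<top> then \<top> else ennreal (exp (\<mu> * enn2real (energy (\<lambda>_. 0) t))))"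

definition density_fun :: "(nat \<Rightarrow> real) \<Rightarrow> ennreal" where
  "density_fun t = (\<Prod>i\<in>{1..n}. ennreal (cut_f (t i))) * weight t"

definition full_moment :: ennreal where "full_moment = (\<integral>\<^sup>+t. density_fun t \<partial>lebn n)"

definition separated :: "real \<Rightarrow> (nat \<Rightarrow> real) set" where
  "separated \<eta> = {t. \<forall>i\<in>{1..n}. \<forall>j\<in>{1..n}. i \<noteq> j \<longrightarrow> \<eta> \<le> \<bar>t i - t j\<bar>}"

lemma scale: "0 < scale j" "scale j < 1" "scale j \<le> 1" by (auto simp: scale_def)

lemma cut_f_nonneg: "cut_f t \<ge> 0" using fpos by (auto simp: cut_f_def indicator_def)

lemma cut_f_measurable[measurable]: "cut_f \<in> borel_measurable borel"
proof -
  have "(\<lambda>t. indicator {0<..<1} t *\<^sub>R f t) \<in> borel_measurable borel"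
    by (intro borel_measurable_continuous_on_indicator continuous_on_subset[OF fcont]) auto
  then show ?thesis by (simp add: cut_f_def[abs_def])
qed

lemma P_cone_measurable[measurable]:
  "(\<lambda>(u, \<omega>). P (cone_set (scale j) u) \<omega>) \<in> borel_measurable (lborel \<Otimes>\<^sub>M Pr)"
  using bspec[OF conjunct1[OF lim[unfolded limit_logID_measure_def]], of "scale j"] scale[of j] by simp

lemma P_cone_measurable_section:
  assumes "\<omega> \<in> space Pr"
  shows "(\<lambda>u. P (cone_set (scale j) u) \<omega>) \<in> borel_measurable lborel"
  using measurable_compose[OF measurable_Pair2'[OF assms] P_cone_measurable[of j]] by simp

lemma approx_measurable[measurable]: "approx j \<in> borel_measurable Pr"
proof -
  have "(\<lambda>(\<omega>, u). ennreal (cut_f u) * ennreal (exp (P (cone_set (scale j) u) \<omega>))) \<in> borel_measurable (Pr \<Otimes>\<^sub>M lborel)"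
    using measurable_compose[OF measurable_pair_swap' P_cone_measurable[of j]] by (simp add: case_prod_unfold)
  from lborel.borel_measurable_nn_integral[OF this] show ?thesis by (simp add: approx_def[abs_def])
qed

text \<open>A product of \<open>n\<close> integrals is one integral over \<open>n\<close>
  coordinates; Tonelli moves the expectation inside, where the points are fixed and the joint moment
  of their cones applies. Each factor has its own scale, as the mixed moments demand.\<close>

lemma approx_product_moment:
  "(\<integral>\<^sup>+\<omega>. (\<Prod>i\<in>{1..n}. approx (j i) \<omega>) \<partial>Pr)
     = (\<integral>\<^sup>+t. (\<Prod>i\<in>{1..n}. ennreal (cut_f (t i))) * ennreal (exp (\<mu> * enn2real (energy (\<lambda>i. scale (j i)) t))) \<partial>lebn n)"
proof -
  interpret L: sigma_finite_measure "lebn n" by (rule lebn.sigma_finite) simp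
  interpret PL: pair_sigma_finite Pr "lebn n" ..
  let ?g = "\<lambda>i u \<omega>. ennreal (cut_f u) * ennreal (exp (P (cone_set (scale (j i)) u) \<omega>))"
  have "(\<integral>\<^sup>+\<omega>. (\<Prod>i\<in>{1..n}. approx (j i) \<omega>) \<partial>Pr) = (\<integral>\<^sup>+\<omega>. (\<integral>\<^sup>+t. (\<Prod>i\<in>{1..n}. ?g i (t i) \<omega>) \<partial>lebn n) \<partial>Pr)"
  proof (rule nn_integral_cong)
    fix \<omega> assume \<omega>: "\<omega> \<in> space Pr"
    note [measurable] = P_cone_measurable_section[OF \<omega>]
    show "(\<Prod>i\<in>{1..n}. approx (j i) \<omega>) = (\<integral>\<^sup>+t. (\<Prod>i\<in>{1..n}. ?g i (t i) \<omega>) \<partial>lebn n)"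
      unfolding approx_def by (rule lebn.product_nn_integral_prod[symmetric]) auto
  qed
  also have "\<dots> = (\<integral>\<^sup>+t. (\<integral>\<^sup>+\<omega>. (\<Prod>i\<in>{1..n}. ?g i (t i) \<omega>) \<partial>Pr) \<partial>lebn n)"
  proof (rule PL.Fubini'[symmetric])
    have "(\<lambda>z. ?g i (snd z i) (fst z)) \<in> borel_measurable (Pr \<Otimes>\<^sub>M lebn n)" if i: "i \<in> {1..n}" for i
    proof -
      have 1: "(\<lambda>z. snd z i) \<in> borel_measurable (Pr \<Otimes>\<^sub>M lebn n)"
        using measurable_compose[OF measurable_snd measurable_component_lebn[OF i]] .
      then have 2: "(\<lambda>z. (snd z i, fst z)) \<in> measurable (Pr \<Otimes>\<^sub>M lebn n) (lborel \<Otimes>\<^sub>M Pr)"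
        by (intro measurable_Pair measurable_fst) simp
      have "(\<lambda>z. P (cone_set (scale (j i)) (snd z i)) (fst z)) \<in> borel_measurable (Pr \<Otimes>\<^sub>M lebn n)"
        using measurable_compose[OF 2 P_cone_measurable] by simp
      then show ?thesis
        using measurable_compose[OF 1 cut_f_measurable] by measurable
    qed
    then have "(\<lambda>z. \<Prod>i\<in>{1..n}. ?g i (snd z i) (fst z)) \<in> borel_measurable (Pr \<Otimes>\<^sub>M lebn n)"
      by (intro borel_measurable_prod_ennreal)
    then show "(\<lambda>(\<omega>, t). \<Prod>i\<in>{1..n}. ?g i (t i) \<omega>) \<in> borel_measurable (Pr \<Otimes>\<^sub>M lebn n)"
      by (simp add: case_prod_unfold)
  qed
  also have "\<dots> = (\<integral>\<^sup>+t. (\<Prod>i\<in>{1..n}. ennreal (cut_f (t i))) * ennreal (exp (\<mu> * enn2real (energy (\<lambda>i. scale (j i)) t))) \<partial>lebn n)"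
  proof (rule nn_integral_cong)
    fix t :: "nat \<Rightarrow> real"
    have adm: "admissible (cone_set (scale (j i)) (t i))" for i by (intro admissible_cone_set scale)
    note [measurable] = P_measurable[OF adm]
    have "(\<integral>\<^sup>+\<omega>. (\<Prod>i\<in>{1..n}. ?g i (t i) \<omega>) \<partial>Pr) = (\<integral>\<^sup>+\<omega>. (\<Prod>i\<in>{1..n}. ennreal (cut_f (t i))) * (\<Prod>i\<in>{1..n}. ennreal (exp (P (cone_set (scale (j i)) (t i)) \<omega>))) \<partial>Pr)"
      by (simp only: prod.distrib)
    also have "\<dots> = (\<Prod>i\<in>{1..n}. ennreal (cut_f (t i))) * (\<integral>\<^sup>+\<omega>. (\<Prod>i\<in>{1..n}. ennreal (exp (P (cone_set (scale (j i)) (t i)) \<omega>))) \<partial>Pr)"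
      by (rule nn_integral_cmult) measurable
    also have "(\<integral>\<^sup>+\<omega>. (\<Prod>i\<in>{1..n}. ennreal (exp (P (cone_set (scale (j i)) (t i)) \<omega>))) \<partial>Pr) = ennreal (exp (\<mu> * enn2real (energy (\<lambda>i. scale (j i)) t)))"
      unfolding energy_def by (rule P_joint_moment) (auto intro: adm)
    finally show "(\<integral>\<^sup>+\<omega>. (\<Prod>i\<in>{1..n}. ?g i (t i) \<omega>) \<partial>Pr) = (\<Prod>i\<in>{1..n}. ennreal (cut_f (t i))) * ennreal (exp (\<mu> * enn2real (energy (\<lambda>i. scale (j i)) t)))" .
  qed
  finally show ?thesis .
qed

lemma approx_product_moment_le: "(\<integral>\<^sup>+\<omega>. (\<Prod>i\<in>{1..n}. approx (j i) \<omega>) \<partial>Pr) \<le> full_moment"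
  unfolding approx_product_moment full_moment_def density_fun_def
proof (intro nn_integral_mono mult_left_mono)
  fix t
  have "energy (\<lambda>i. scale (j i)) t \<le> energy (\<lambda>_. 0) t" by (rule energy_le) (simp add: scale less_imp_le)
  then show "ennreal (exp (\<mu> * enn2real (energy (\<lambda>i. scale (j i)) t))) \<le> weight t"
    using \<mu> by (auto simp: weight_def less_top intro!: ennreal_leI enn2real_mono)
qed auto

lemma density_fun_measurable[measurable]: "density_fun \<in> borel_measurable (lebn n)"
proof -
  have "weight \<in> borel_measurable (lebn n)"
    unfolding weight_def[abs_def] by measurable
  moreover have "(\<lambda>t. \<Prod>i\<in>{1..n}. ennreal (cut_f (t i))) \<in> borel_measurable (lebn n)"
    by (intro borel_measurable_prod_ennreal measurable_compose[OF measurable_component_lebn]) auto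
  ultimately show ?thesis unfolding density_fun_def[abs_def] by measurable
qed

lemma full_moment_eq: "full_moment = ennreal (fact n) * (\<integral>\<^sup>+t. indicator (sorted_cube n) t * density_fun t \<partial>lebn n)"
proof -
  have "full_moment = (\<integral>\<^sup>+t. indicator (cube n) t * density_fun t \<partial>lebn n)"
    unfolding full_moment_def
  proof (rule nn_integral_cong)
    fix t
    have "density_fun t = 0" if "t \<notin> cube n"
    proof -
      have "\<exists>i\<in>{1..n}. \<not> (0 < t i \<and> t i < 1)" using that by (simp add: cube_def)
      then obtain i where i: "i \<in> {1..n}" "\<not> (0 < t i \<and> t i < 1)" by blast
      then have "ennreal (cut_f (t i)) = 0" by (auto simp: cut_f_def)
      then have "(\<Prod>i\<in>{1..n}. ennreal (cut_f (t i))) = 0" using i(1) by (intro prod_zero) auto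
      then show ?thesis by (simp add: density_fun_def)
    qed
    then show "density_fun t = indicator (cube n) t * density_fun t" by (cases "t \<in> cube n") auto
  qed
  also have "\<dots> = ennreal (fact n) * (\<integral>\<^sup>+t. indicator (sorted_cube n) t * density_fun t \<partial>lebn n)"
  proof (rule nn_integral_cube_symmetric[OF density_fun_measurable])
    fix \<sigma> t assume s: "\<sigma> permutes {1..n}"
    have "(\<Prod>i\<in>{1..n}. ennreal (cut_f (rearrange n \<sigma> t i))) = (\<Prod>i\<in>{1..n}. ennreal (cut_f (t (\<sigma> i))))"
      by (rule prod.cong) (auto simp: rearrange_def)
    also have "\<dots> = (\<Prod>i\<in>{1..n}. ennreal (cut_f (t i)))"
      using prod.permute[OF s, of "\<lambda>i. ennreal (cut_f (t i))"] by (simp add: o_def)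
    finally show "density_fun (rearrange n \<sigma> t) = density_fun t" by (simp only: density_fun_def weight_def energy_rearrange[OF s])
  qed
  finally show ?thesis .
qed

lemma density_fun_sorted:
  assumes t: "t \<in> sorted_cube n"
  shows "density_fun t = ennreal ((\<Prod>i\<in>{1..n}. f (t i)) * exp (\<mu> * (\<Sum>p\<in>{1..n}. \<Sum>k\<in>{1..<p}. dfun s2 nu (p - k) * - ln (t p - t k))))"
    (is "_ = ennreal (_ * exp (\<mu> * ?S))")
proof -
  have t01: "0 < t i \<and> t i < 1" if "i \<in> {1..n}" for i using t that by (auto simp: sorted_cube_def)
  have S0: "?S \<ge> 0"
  proof (intro sum_nonneg mult_nonneg_nonneg d_nonneg)
    fix p k assume "p \<in> {1..n}" "k \<in> {1..<p}"
    then have "t k < t p" "0 < t k" "t p < 1" using sorted_cube_less[OF t, of k p] t01[of k] t01[of p] by auto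
    then show "0 \<le> - ln (t p - t k)" by auto
  qed
  have E: "energy (\<lambda>_. 0) t = ennreal ?S"
    by (rule energy_sorted) (use sorted_cube_less[OF t] t01 in auto)
  have "(\<Prod>i\<in>{1..n}. ennreal (cut_f (t i))) = (\<Prod>i\<in>{1..n}. ennreal (f (t i)))"
    using t01 by (intro prod.cong) (auto simp: cut_f_def)
  also have "\<dots> = ennreal (\<Prod>i\<in>{1..n}. f (t i))"
    by (rule prod_ennreal) (use t01 fpos in \<open>auto simp: less_imp_le\<close>)
  finally show ?thesis
    unfolding density_fun_def weight_def E using S0 prod_nonneg[of "{1..n}" "\<lambda>i. f (t i)"] fpos t01
    by (simp add: ennreal_mult less_imp_le del: One_nat_def)
qed

text \<open>The moment condition reads \<mu> \<Phi> n < n - 1, so the even distribution of the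
  energy over the gaps leaves each with a power \<open>- a\<close> for some \<open>a < 1\<close>.
  With \<open>f\<close> bounded, the integral is dominated by a product of one-dimensional
  integrals.\<close>

lemma full_moment_finite: "full_moment < \<infinity>"
proof -
  define a where "a = \<mu> * \<Phi> n / real (n - 1)"
  have n1: "real (n - 1) = real n - 1" "n - 1 > 0" using n2 by (auto simp: of_nat_diff)
  have a: "a < 1" using cond n1 by (simp add: a_def)
  have "bounded (f ` {0..1})" by (intro compact_imp_bounded compact_continuous_image fcont) auto
  then obtain B where B: "\<And>t. t \<in> {0..1} \<Longrightarrow> f t \<le> B" "B \<ge> 0"
    unfolding bounded_pos by (metis abs_le_D1 imageI less_imp_le real_norm_def)
  let ?g = "\<lambda>y::real. ennreal (indicator {0<..<1} y * y powr (- a))"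
  have le: "indicator (sorted_cube n) t * density_fun t \<le> ennreal (B ^ n) * (indicator {0<..<1} (t 1) * (\<Prod>i\<in>{1..<n}. ?g (t (Suc i) - t i)))" for t
  proof (cases "t \<in> sorted_cube n")
    case True
    have t01: "0 < t i \<and> t i < 1" if "i \<in> {1..n}" for i using True that by (auto simp: sorted_cube_def)
    have gap: "0 < t (Suc i) - t i \<and> t (Suc i) - t i < 1" if "i \<in> {1..<n}" for i
    proof -
      have "i \<in> {1..n}" "Suc i \<in> {1..n}" using that by auto
      then show ?thesis using t01[of i] t01[of "Suc i"] sorted_cube_less[OF True, of i "Suc i"] by linarith
    qed
    have "(\<Prod>i\<in>{1..n}. f (t i)) \<le> (\<Prod>i\<in>{1..n}. B)"
      by (rule prod_mono) (use t01 B fpos in \<open>auto simp: less_imp_le\<close>)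
    then have f1: "(\<Prod>i\<in>{1..n}. f (t i)) \<le> B ^ n" by simp
    have "exp (\<mu> * (\<Sum>p\<in>{1..n}. \<Sum>k\<in>{1..<p}. dfun s2 nu (p - k) * - ln (t p - t k)))
       \<le> exp (\<mu> * ((\<Phi> n / real (n - 1)) * (\<Sum>i\<in>{1..<n}. - ln (t (Suc i) - t i))))"
      using mult_left_mono[OF energy_sum_le[OF True] less_imp_le[OF \<mu>]] by (simp only: exp_le_cancel_iff)
    also have "\<mu> * ((\<Phi> n / real (n - 1)) * (\<Sum>i\<in>{1..<n}. - ln (t (Suc i) - t i))) = (\<Sum>i\<in>{1..<n}. - a * ln (t (Suc i) - t i))"
      unfolding a_def by (simp add: sum_distrib_left mult.assoc)
    also have "exp \<dots> = (\<Prod>i\<in>{1..<n}. (t (Suc i) - t i) powr (- a))"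
      unfolding exp_sum[OF finite_atLeastLessThan]
    proof (intro prod.cong refl)
      fix i assume "i \<in> {1..<n}"
      from gap[OF this] show "exp (- a * ln (t (Suc i) - t i)) = (t (Suc i) - t i) powr (- a)"
        by (simp add: powr_def)
    qed
    finally have "density_fun t \<le> ennreal (B ^ n * (\<Prod>i\<in>{1..<n}. (t (Suc i) - t i) powr (- a)))"
      unfolding density_fun_sorted[OF True] using f1 B(2) by (intro ennreal_leI mult_mono) auto
    also have "\<dots> = ennreal (B ^ n) * (\<Prod>i\<in>{1..<n}. ennreal ((t (Suc i) - t i) powr (- a)))"
      using B(2) by (simp add: ennreal_mult prod_nonneg prod_ennreal)
    also have "(\<Prod>i\<in>{1..<n}. ennreal ((t (Suc i) - t i) powr (- a))) = (\<Prod>i\<in>{1..<n}. ?g (t (Suc i) - t i))"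
      by (rule prod.cong) (use gap in auto)
    finally show ?thesis using True t01[of 1] n2 by simp
  qed simp
  obtain m where m: "n = Suc m" using n2 by (cases n) auto
  have "(\<integral>\<^sup>+t. indicator (sorted_cube n) t * density_fun t \<partial>lebn n)
      \<le> (\<integral>\<^sup>+t. ennreal (B ^ n) * (indicator {0<..<1} (t 1) * (\<Prod>i\<in>{1..<n}. ?g (t (Suc i) - t i))) \<partial>lebn n)"
    by (intro nn_integral_mono le)
  also have "\<dots> = ennreal (B ^ n) * (\<integral>\<^sup>+t. (indicator {0<..<1} (t 1) * (\<Prod>i\<in>{1..<n}. ?g (t (Suc i) - t i))) \<partial>lebn n)"
  proof (rule nn_integral_cmult)
    have "(\<lambda>t. ?g (t (Suc i) - t i)) \<in> borel_measurable (lebn n)" if "i \<in> {1..<n}" for i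
    proof -
      have "(\<lambda>t. t (Suc i) - t i) \<in> borel_measurable (lebn n)"
        using that by (intro borel_measurable_diff measurable_component_lebn) auto
      from measurable_compose[OF this, of ?g borel] show ?thesis by measurable
    qed
    moreover have "(\<lambda>t. indicator {0<..<1} (t 1)) \<in> borel_measurable (lebn n)"
      using n2 by (intro measurable_compose[OF measurable_component_lebn]) auto
    ultimately show "(\<lambda>t. indicator {0<..<1} (t 1) * (\<Prod>i\<in>{1..<n}. ?g (t (Suc i) - t i))) \<in> borel_measurable (lebn n)"
      by (intro borel_measurable_times_ennreal borel_measurable_prod_ennreal)
  qed
  also have "(\<integral>\<^sup>+t. (indicator {0<..<1} (t 1) * (\<Prod>i\<in>{1..<n}. ?g (t (Suc i) - t i))) \<partial>lebn n) = (\<integral>\<^sup>+y. ?g y \<partial>lborel) ^ m"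
    unfolding m by (rule nn_integral_gaps) measurable
  also have "ennreal (B ^ n) * (\<integral>\<^sup>+y. ?g y \<partial>lborel) ^ m < \<infinity>"
    using nn_integral_powr_gap[OF a] by (auto simp: ennreal_mult_less_top power_less_top_ennreal)
  finally show ?thesis unfolding full_moment_eq by (auto simp: ennreal_mult_less_top)
qed

text \<open>On configurations with all gaps at least \<eta> the truncation at scales below \<eta>
  leaves the energy unchanged, so the two integrands agree there.\<close>

lemma approx_product_moment_ge:
  assumes "\<And>i. i \<in> {1..n} \<Longrightarrow> scale (j i) \<le> \<eta>" "\<eta> \<le> 1"
  shows "(\<integral>\<^sup>+t. indicator (separated \<eta>) t * density_fun t \<partial>lebn n) \<le> (\<integral>\<^sup>+\<omega>. (\<Prod>i\<in>{1..n}. approx (j i) \<omega>) \<partial>Pr)"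
  unfolding approx_product_moment
proof (rule nn_integral_mono_AE)
  \<comment> \<open>At infinite energy \<open>weight\<close> is infinite, whereas the truncated side
    would read \<open>enn2real\<close> of infinity as 0. Finiteness of the integral forces the
    product of the \<open>cut_f\<close> factors to vanish at almost all such points.\<close>
  have "AE t in lebn n. density_fun t \<noteq> \<infinity>"
    using full_moment_finite unfolding full_moment_def by (intro nn_integral_PInf_AE density_fun_measurable) simp
  then show "AE t in lebn n. indicator (separated \<eta>) t * density_fun t
     \<le> (\<Prod>i\<in>{1..n}. ennreal (cut_f (t i))) * ennreal (exp (\<mu> * enn2real (energy (\<lambda>i. scale (j i)) t)))"
  proof eventually_elim
    case (elim t)
    show ?case
    proof (cases "t \<in> separated \<eta>")
      case True
      have eq: "energy (\<lambda>i. scale (j i)) t = energy (\<lambda>_. 0) t"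
        using True assms by (intro energy_eq[of _ \<eta>]) (auto simp: separated_def scale less_imp_le)
      show ?thesis
      proof (cases "energy (\<lambda>_. 0) t = \<top>")
        case top: True
        then have "(\<Prod>i\<in>{1..n}. ennreal (cut_f (t i))) = 0"
          using elim by (auto simp: density_fun_def weight_def ennreal_mult_top split: if_splits)
        then show ?thesis by (simp only: density_fun_def mult_zero_left mult_zero_right order_refl)
      next
        case False
        then show ?thesis using True by (simp add: density_fun_def weight_def eq)
      qed
    qed simp
  qed
qed

text \<open>Almost every configuration has distinct coordinates and is separated once the scale
  drops below its smallest gap. With \<open>approx_product_moment_le\<close> this pins all mixed
  moments to the same limit.\<close>

lemma separated_tendsto: "(\<lambda>j. \<integral>\<^sup>+t. indicator (separated (scale j)) t * density_fun t \<partial>lebn n) \<longlonglongrightarrow> full_moment"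
  unfolding full_moment_def
proof (rule nn_integral_dominated_convergence[where w = density_fun])
  show "(\<lambda>t. indicator (separated (scale j)) t * density_fun t) \<in> borel_measurable (lebn n)" for j
  proof -
    have "Measurable.pred (lebn n) (\<lambda>t. i \<noteq> k \<longrightarrow> scale j \<le> \<bar>t i - t k\<bar>)" if "i \<in> {1..n}" "k \<in> {1..n}" for i k
      using that by measurable
    then have [measurable]: "Measurable.pred (lebn n) (\<lambda>t. \<forall>i\<in>{1..n}. \<forall>k\<in>{1..n}. i \<noteq> k \<longrightarrow> scale j \<le> \<bar>t i - t k\<bar>)"
      by (intro pred_intros_finite) auto
    have "(\<lambda>t. if \<forall>i\<in>{1..n}. \<forall>k\<in>{1..n}. i \<noteq> k \<longrightarrow> scale j \<le> \<bar>t i - t k\<bar> then 1 else 0 :: ennreal) \<in> borel_measurable (lebn n)"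
      by measurable
    then have "(\<lambda>t. indicator (separated (scale j)) t :: ennreal) \<in> borel_measurable (lebn n)"
      by (simp add: indicator_def of_bool_def separated_def)
    then show ?thesis by measurable
  qed
  show "AE t in lebn n. (\<lambda>j. indicator (separated (scale j)) t * density_fun t) \<longlonglongrightarrow> density_fun t"
    using AE_lebn_inj
  proof eventually_elim
    case (elim t)
    have "scale \<longlonglongrightarrow> 0" unfolding scale_def[abs_def] by real_asymp
    have "\<forall>\<^sub>F j in sequentially. \<forall>i\<in>{1..n}. \<forall>k\<in>{1..n}. i \<noteq> k \<longrightarrow> scale j \<le> \<bar>t i - t k\<bar>"
    proof (intro eventually_ball_finite ballI finite_atLeastAtMost)
      fix i k assume ik: "i \<in> {1..n}" "k \<in> {1..n}"
      show "\<forall>\<^sub>F j in sequentially. i \<noteq> k \<longrightarrow> scale j \<le> \<bar>t i - t k\<bar>"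
      proof (cases "i = k")
        case False
        then have "\<bar>t i - t k\<bar> > 0" using inj_onD[OF elim _ ik] by auto
        from order_tendstoD(2)[OF \<open>scale \<longlonglongrightarrow> 0\<close> this] show ?thesis by eventually_elim simp
      qed simp
    qed
    then have "\<forall>\<^sub>F j in sequentially. indicator (separated (scale j)) t * density_fun t = density_fun t"
      by eventually_elim (simp add: separated_def)
    then show ?case by (rule tendsto_eventually)
  qed
qed (use full_moment_finite density_fun_measurable in \<open>auto simp: full_moment_def indicator_def simp del: One_nat_def\<close>)

end

section \<open>Passage to the limit\<close>

text \<open>Mere existence of coefficients is enough in what follows: their sum is obtained later by
  evaluating the polynomial at x = y = 1.\<close>

lemma homogeneous_mult:
  fixes a b :: real and c :: "nat \<Rightarrow> real"
  shows "\<exists>c'. \<forall>x y :: real. (a * x + b * y) * (\<Sum>k\<le>N. c k * x ^ k * y ^ (N - k)) = (\<Sum>k\<le>Suc N. c' k * x ^ k * y ^ (Suc N - k))"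
proof (intro exI allI)
  fix x y :: real
  let ?c1 = "\<lambda>k. if k = 0 then 0 else a * c (k - 1)" and ?c2 = "\<lambda>k. if k = Suc N then 0 else b * c k"
  have "(\<Sum>k\<le>Suc N. ?c1 k * x ^ k * y ^ (Suc N - k)) = (\<Sum>k\<le>N. a * x * (c k * x ^ k * y ^ (N - k)))"
    unfolding sum.atMost_Suc_shift by (auto intro!: sum.cong)
  moreover have "(\<Sum>k\<le>Suc N. ?c2 k * x ^ k * y ^ (Suc N - k)) = (\<Sum>k\<le>N. b * y * (c k * x ^ k * y ^ (N - k)))"
    by (auto intro!: sum.cong simp: Suc_diff_le)
  ultimately show "(a * x + b * y) * (\<Sum>k\<le>N. c k * x ^ k * y ^ (N - k)) = (\<Sum>k\<le>Suc N. (?c1 k + ?c2 k) * x ^ k * y ^ (Suc N - k))"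
    by (simp only: distrib_right sum.distrib sum_distrib_left)
qed

lemma homogeneous_power_product:
  "\<exists>c. \<forall>x y :: real. (x - y) ^ p * (x + y) ^ q = (\<Sum>k\<le>p + q. c k * x ^ k * y ^ (p + q - k))"
proof (induction p)
  case 0
  show ?case
  proof (induction q)
    case 0
    show ?case by (rule exI[of _ "\<lambda>_. 1"]) simp
  next
    case (Suc q)
    then obtain c where c: "\<And>x y :: real. (x - y) ^ 0 * (x + y) ^ q = (\<Sum>k\<le>0 + q. c k * x ^ k * y ^ (0 + q - k))" by blast
    from homogeneous_mult[of 1 1 c "0 + q"] show ?case unfolding c[symmetric] by (simp add: mult_ac)
  qed
next
  case (Suc p)
  then obtain c where c: "\<And>x y :: real. (x - y) ^ p * (x + y) ^ q = (\<Sum>k\<le>p + q. c k * x ^ k * y ^ (p + q - k))" by blast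
  from homogeneous_mult[of 1 "-1" c "p + q"] show ?case unfolding c[symmetric] by (simp add: mult_ac)
qed

text \<open>For odd \<open>n\<close> the power \<open>\<bar>x - y\<bar> ^ n\<close> is not a polynomial, but it is dominated by one that
  still vanishes on the diagonal.\<close>

lemma abs_diff_power_dominated:
  assumes "n \<ge> 2"
  obtains c :: "nat \<Rightarrow> real" where "(\<Sum>k\<le>n. c k) = 0"
    and "\<And>x y :: real. 0 \<le> x \<Longrightarrow> 0 \<le> y \<Longrightarrow> \<bar>x - y\<bar> ^ n \<le> (\<Sum>k\<le>n. c k * (x ^ k * y ^ (n - k)))"
proof -
  \<comment> \<open>\<open>p\<close> is the largest even number up to \<open>n\<close>, so the power
    \<open>p\<close> of |x - y| is a polynomial, and the leftover exponent \<open>q\<close>, 0 or 1,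
    is absorbed by |x - y| \<le> x + y. From n \<ge> 2 follows p > 0, hence the vanishing on the
    diagonal.\<close>
  define p where "p = 2 * (n div 2)"
  define q where "q = n mod 2"
  have pq: "p + q = n" "p > 0" using assms by (auto simp: p_def q_def)
  obtain c where c: "\<And>x y :: real. (x - y) ^ p * (x + y) ^ q = (\<Sum>k\<le>n. c k * x ^ k * y ^ (n - k))"
    using homogeneous_power_product[of p q] unfolding pq(1) by blast
  show ?thesis
  proof (rule that[of c])
    show "(\<Sum>k\<le>n. c k) = 0" using c[of 1 1] zero_power[OF pq(2), where 'a = real] by simp
    fix x y :: real assume xy: "0 \<le> x" "0 \<le> y"
    have "\<bar>x - y\<bar> ^ n = \<bar>x - y\<bar> ^ p * \<bar>x - y\<bar> ^ q" by (simp add: pq(1) flip: power_add)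
    also have "\<bar>x - y\<bar> ^ p = (x - y) ^ p" by (simp add: p_def power_even_abs)
    also have "(x - y) ^ p * \<bar>x - y\<bar> ^ q \<le> (x - y) ^ p * (x + y) ^ q"
      using xy by (intro mult_left_mono power_mono) (auto simp: p_def)
    finally show "\<bar>x - y\<bar> ^ n \<le> (\<Sum>k\<le>n. c k * (x ^ k * y ^ (n - k)))"
      unfolding c by (simp add: mult.assoc)
  qed
qed

text \<open>A substitute for Minkowski's inequality: either y is at most (1 + \<eta>) x, or |y - x|
  is at least the fraction \<eta> / (1 + \<eta>) of y. The factor at x^n tends to 1 with \<eta>, so
  nothing is lost in the limit.\<close>

lemma power_split_le:
  fixes x y \<eta> :: real
  assumes "x \<ge> 0" "y \<ge> 0" "\<eta> > 0"
  shows "y ^ n \<le> (1 + \<eta>) ^ n * x ^ n + ((1 + \<eta>) / \<eta>) ^ n * \<bar>y - x\<bar> ^ n"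
proof (cases "y \<le> (1 + \<eta>) * x")
  case True
  then have "y ^ n \<le> ((1 + \<eta>) * x) ^ n" using assms by (intro power_mono)
  moreover have "0 \<le> ((1 + \<eta>) / \<eta>) ^ n * \<bar>y - x\<bar> ^ n" using assms by simp
  ultimately show ?thesis by (simp add: power_mult_distrib)
next
  case False
  have "x \<le> (1 + \<eta>) * x" using assms by (simp add: mult_le_cancel_right1)
  then have abs: "\<bar>y - x\<bar> = y - x" using False by simp
  have "\<eta> * y \<le> (1 + \<eta>) * (y - x)" using False by (simp add: algebra_simps)
  then have "y \<le> (1 + \<eta>) / \<eta> * \<bar>y - x\<bar>"
    unfolding abs using assms by (simp add: field_simps)
  then have "y ^ n \<le> ((1 + \<eta>) / \<eta> * \<bar>y - x\<bar>) ^ n" using assms by (intro power_mono)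
  moreover have "0 \<le> (1 + \<eta>) ^ n * x ^ n" using assms by simp
  ultimately show ?thesis unfolding power_mult_distrib by linarith
qed

section \<open>Convergence of the approximating masses in the norm of order n\<close>

context log_id_moment
begin

text \<open>An infinite mass is replaced by 0; \<open>approx_finite\<close> shows that this concerns
  a null event.\<close>

definition approx_real :: "nat \<Rightarrow> 'w \<Rightarrow> real" where "approx_real j \<omega> = enn2real (approx j \<omega>)"

lemma approx_real_measurable[measurable]: "approx_real j \<in> borel_measurable Pr"
  unfolding approx_real_def[abs_def] by measurable

lemma approx_real_nonneg: "approx_real j \<omega> \<ge> 0" by (simp add: approx_real_def)

lemma approx_finite: "AE \<omega> in Pr. approx j \<omega> = ennreal (approx_real j \<omega>)"
proof -
  have "(\<integral>\<^sup>+\<omega>. approx j \<omega> ^ n \<partial>Pr) < \<infinity>"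
    using order.strict_trans1[OF approx_product_moment_le[of "\<lambda>_. j"] full_moment_finite] by simp
  then have "AE \<omega> in Pr. approx j \<omega> ^ n \<noteq> \<infinity>" by (intro nn_integral_PInf_AE) auto
  then show ?thesis
  proof eventually_elim
    case (elim \<omega>)
    then have "approx j \<omega> \<noteq> \<top>" using n2 by (auto simp: power_eq_top_ennreal)
    then show ?case by (simp add: approx_real_def less_top)
  qed
qed

lemma mixed_moment:
  assumes "k \<le> n"
  shows "(\<integral>\<^sup>+\<omega>. ennreal (approx_real i \<omega> ^ k * approx_real j \<omega> ^ (n - k)) \<partial>Pr) = (\<integral>\<^sup>+\<omega>. (\<Prod>l\<in>{1..n}. approx (if l \<le> k then i else j) \<omega>) \<partial>Pr)"
proof (rule nn_integral_cong_AE)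
  show "AE \<omega> in Pr. ennreal (approx_real i \<omega> ^ k * approx_real j \<omega> ^ (n - k)) = (\<Prod>l\<in>{1..n}. approx (if l \<le> k then i else j) \<omega>)"
    using approx_finite[of i] approx_finite[of j]
  proof eventually_elim
    case (elim \<omega>)
    have eq: "{1..n} = {1..k} \<union> {k<..n}" using assms by auto
    have "(\<Prod>l\<in>{1..n}. approx (if l \<le> k then i else j) \<omega>) = (\<Prod>l\<in>{1..k}. approx (if l \<le> k then i else j) \<omega>) * (\<Prod>l\<in>{k<..n}. approx (if l \<le> k then i else j) \<omega>)"
      unfolding eq by (rule prod.union_disjoint) auto
    also have "\<dots> = approx i \<omega> ^ k * approx j \<omega> ^ (n - k)" by simp
    finally show ?case
      using elim by (simp add: ennreal_mult ennreal_power approx_real_nonneg)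
  qed
qed

definition sep_moment :: "nat \<Rightarrow> ennreal" where
  "sep_moment j = (\<integral>\<^sup>+t. indicator (separated (scale j)) t * density_fun t \<partial>lebn n)"

text \<open>For \<open>i \<le> j\<close> the scale of \<open>i\<close> is the coarser one, so
  separation at that scale suffices for all \<open>n\<close> factors, and the lower bound depends on
  \<open>i\<close> alone.\<close>

lemma mixed_moment_bounds:
  assumes "k \<le> n" "i \<le> j"
  shows "sep_moment i \<le> (\<integral>\<^sup>+\<omega>. ennreal (approx_real i \<omega> ^ k * approx_real j \<omega> ^ (n - k)) \<partial>Pr)"
    and "(\<integral>\<^sup>+\<omega>. ennreal (approx_real i \<omega> ^ k * approx_real j \<omega> ^ (n - k)) \<partial>Pr) \<le> full_moment"
proof -
  have "scale j \<le> scale i" using assms(2) by (simp add: scale_def frac_le)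
  then show "sep_moment i \<le> (\<integral>\<^sup>+\<omega>. ennreal (approx_real i \<omega> ^ k * approx_real j \<omega> ^ (n - k)) \<partial>Pr)"
    unfolding mixed_moment[OF assms(1)] sep_moment_def by (intro approx_product_moment_ge) (auto simp: scale)
  show "(\<integral>\<^sup>+\<omega>. ennreal (approx_real i \<omega> ^ k * approx_real j \<omega> ^ (n - k)) \<partial>Pr) \<le> full_moment"
    unfolding mixed_moment[OF assms(1)] by (rule approx_product_moment_le)
qed

lemma mixed_moment_real:
  assumes "k \<le> n" "i \<le> j"
  shows "integrable Pr (\<lambda>\<omega>. approx_real i \<omega> ^ k * approx_real j \<omega> ^ (n - k))"
    and "enn2real (sep_moment i) \<le> expectation (\<lambda>\<omega>. approx_real i \<omega> ^ k * approx_real j \<omega> ^ (n - k))"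
    and "expectation (\<lambda>\<omega>. approx_real i \<omega> ^ k * approx_real j \<omega> ^ (n - k)) \<le> enn2real full_moment"
proof -
  note b = mixed_moment_bounds[OF assms]
  have nn: "0 \<le> approx_real i \<omega> ^ k * approx_real j \<omega> ^ (n - k)" for \<omega> by (simp add: approx_real_nonneg)
  show int: "integrable Pr (\<lambda>\<omega>. approx_real i \<omega> ^ k * approx_real j \<omega> ^ (n - k))"
    using order.strict_trans1[OF b(2) full_moment_finite] nn by (intro integrableI_nonneg) auto
  have eq: "(\<integral>\<^sup>+\<omega>. ennreal (approx_real i \<omega> ^ k * approx_real j \<omega> ^ (n - k)) \<partial>Pr) = ennreal (expectation (\<lambda>\<omega>. approx_real i \<omega> ^ k * approx_real j \<omega> ^ (n - k)))"
    using nn by (intro nn_integral_eq_integral int) auto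
  have nn': "0 \<le> expectation (\<lambda>\<omega>. approx_real i \<omega> ^ k * approx_real j \<omega> ^ (n - k))" by (rule integral_nonneg_AE) (simp add: nn)
  show "enn2real (sep_moment i) \<le> expectation (\<lambda>\<omega>. approx_real i \<omega> ^ k * approx_real j \<omega> ^ (n - k))"
    using enn2real_mono[OF b(1)[unfolded eq]] nn' by simp
  show "expectation (\<lambda>\<omega>. approx_real i \<omega> ^ k * approx_real j \<omega> ^ (n - k)) \<le> enn2real full_moment"
    using enn2real_mono[OF b(2)[unfolded eq]] nn' full_moment_finite by simp
qed

text \<open>The dominating polynomial is a combination of mixed moments with coefficients of sum 0.
  All these moments lie between \<open>sep_moment i\<close> and \<open>full_moment\<close>, so the
  combination is at most the sum of the |c k| times the length of that interval, uniformly in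
  \<open>j\<close>.\<close>

lemma approx_real_Cauchy:
  obtains \<delta> :: "nat \<Rightarrow> real" where "\<delta> \<longlonglongrightarrow> 0"
    and "\<And>i j. i \<le> j \<Longrightarrow> (\<integral>\<^sup>+\<omega>. ennreal (\<bar>approx_real i \<omega> - approx_real j \<omega>\<bar> ^ n) \<partial>Pr) \<le> ennreal (\<delta> i)"
proof -
  obtain c where c0: "(\<Sum>k\<le>n. c k) = (0 :: real)"
    and c: "\<And>x y :: real. 0 \<le> x \<Longrightarrow> 0 \<le> y \<Longrightarrow> \<bar>x - y\<bar> ^ n \<le> (\<Sum>k\<le>n. c k * (x ^ k * y ^ (n - k)))"
    using abs_diff_power_dominated[OF n2] by blast
  define \<delta> where "\<delta> i = (\<Sum>k\<le>n. \<bar>c k\<bar>) * (enn2real full_moment - enn2real (sep_moment i))" for i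
  have R': "ennreal (enn2real full_moment) = full_moment" using full_moment_finite by simp
  have "sep_moment \<longlonglongrightarrow> ennreal (enn2real full_moment)"
    unfolding sep_moment_def[abs_def] R' by (rule separated_tendsto)
  then have "(\<lambda>i. enn2real (sep_moment i)) \<longlonglongrightarrow> enn2real full_moment"
    by (rule tendsto_enn2real) simp
  then have "\<delta> \<longlonglongrightarrow> (\<Sum>k\<le>n. \<bar>c k\<bar>) * (enn2real full_moment - enn2real full_moment)"
    unfolding \<delta>_def[abs_def] by (intro tendsto_mult tendsto_diff tendsto_const)
  then have lim0: "\<delta> \<longlonglongrightarrow> 0" by simp
  have "(\<integral>\<^sup>+\<omega>. ennreal (\<bar>approx_real i \<omega> - approx_real j \<omega>\<bar> ^ n) \<partial>Pr) \<le> ennreal (\<delta> i)" if ij: "i \<le> j" for i j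
  proof -
    let ?m = "\<lambda>k. expectation (\<lambda>\<omega>. approx_real i \<omega> ^ k * approx_real j \<omega> ^ (n - k))"
    have int: "integrable Pr (\<lambda>\<omega>. \<Sum>k\<le>n. c k * (approx_real i \<omega> ^ k * approx_real j \<omega> ^ (n - k)))"
      using ij by (intro Bochner_Integration.integrable_sum integrable_mult_right mixed_moment_real(1)) auto
    have nn: "0 \<le> (\<Sum>k\<le>n. c k * (approx_real i \<omega> ^ k * approx_real j \<omega> ^ (n - k)))" for \<omega>
      by (rule order_trans[OF _ c]) (auto simp: approx_real_nonneg)
    have "(\<integral>\<^sup>+\<omega>. ennreal (\<bar>approx_real i \<omega> - approx_real j \<omega>\<bar> ^ n) \<partial>Pr) \<le> (\<integral>\<^sup>+\<omega>. ennreal (\<Sum>k\<le>n. c k * (approx_real i \<omega> ^ k * approx_real j \<omega> ^ (n - k))) \<partial>Pr)"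
      by (intro nn_integral_mono ennreal_leI c approx_real_nonneg)
    also have "\<dots> = ennreal (expectation (\<lambda>\<omega>. \<Sum>k\<le>n. c k * (approx_real i \<omega> ^ k * approx_real j \<omega> ^ (n - k))))"
      using nn by (intro nn_integral_eq_integral int) auto
    also have "expectation (\<lambda>\<omega>. \<Sum>k\<le>n. c k * (approx_real i \<omega> ^ k * approx_real j \<omega> ^ (n - k))) = (\<Sum>k\<le>n. c k * ?m k)"
      using ij mixed_moment_real(1)[of _ i j] by (subst Bochner_Integration.integral_sum) auto
    \<comment> \<open>Since the coefficients sum to 0, subtracting the common limit from every
      moment changes nothing.\<close>
    also have "\<dots> = (\<Sum>k\<le>n. c k * (?m k - enn2real full_moment))"
      using c0 by (simp add: right_diff_distrib sum_subtractf flip: sum_distrib_right)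
    also have "\<dots> \<le> (\<Sum>k\<le>n. \<bar>c k\<bar> * (enn2real full_moment - enn2real (sep_moment i)))"
    proof (intro sum_mono)
      fix k assume "k \<in> {..n}"
      then have "\<bar>?m k - enn2real full_moment\<bar> \<le> enn2real full_moment - enn2real (sep_moment i)"
        using mixed_moment_real(2,3)[of k i j] ij by simp
      then have "\<bar>c k * (?m k - enn2real full_moment)\<bar> \<le> \<bar>c k\<bar> * (enn2real full_moment - enn2real (sep_moment i))"
        unfolding abs_mult by (intro mult_left_mono) auto
      then show "c k * (?m k - enn2real full_moment) \<le> \<bar>c k\<bar> * (enn2real full_moment - enn2real (sep_moment i))"
        by (rule order_trans[OF abs_ge_self])
    qed
    also have "\<dots> = \<delta> i" by (simp add: \<delta>_def sum_distrib_right)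
    finally show ?thesis by (simp add: ennreal_leI)
  qed
  with lim0 show ?thesis by (rule that)
qed

text \<open>Fatou gives the upper bound directly. Applied to the Cauchy estimate with
  \<open>j\<close> tending to infinity, it also bounds the distance of order n from
  \<open>approx_real i\<close> to \<open>Z\<close>; splitting the powers and letting first
  \<open>i\<close> tend to infinity and then \<eta> to 0 gives the lower bound.\<close>

lemma limit_moment:
  assumes Z[measurable]: "Z \<in> borel_measurable Pr" and lim: "AE \<omega> in Pr. (\<lambda>j. approx_real j \<omega>) \<longlonglongrightarrow> Z \<omega>"
  shows "(\<integral>\<^sup>+\<omega>. ennreal (Z \<omega> ^ n) \<partial>Pr) = full_moment"
proof (rule antisym)
  have Z0: "AE \<omega> in Pr. 0 \<le> Z \<omega>"
    using lim by eventually_elim (rule LIMSEQ_le_const, auto simp: approx_real_nonneg)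
  have upper: "(\<integral>\<^sup>+\<omega>. ennreal (approx_real j \<omega> ^ n) \<partial>Pr) \<le> full_moment" and lower: "sep_moment j \<le> (\<integral>\<^sup>+\<omega>. ennreal (approx_real j \<omega> ^ n) \<partial>Pr)" for j
    using mixed_moment_bounds[of n j j] by auto
  have "(\<integral>\<^sup>+\<omega>. ennreal (Z \<omega> ^ n) \<partial>Pr) = (\<integral>\<^sup>+\<omega>. liminf (\<lambda>j. ennreal (approx_real j \<omega> ^ n)) \<partial>Pr)"
  proof (rule nn_integral_cong_AE)
    show "AE \<omega> in Pr. ennreal (Z \<omega> ^ n) = liminf (\<lambda>j. ennreal (approx_real j \<omega> ^ n))"
      using lim
    proof eventually_elim
      case (elim \<omega>)
      have "(\<lambda>j. ennreal (approx_real j \<omega> ^ n)) \<longlonglongrightarrow> ennreal (Z \<omega> ^ n)"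
        by (intro tendsto_ennrealI tendsto_power elim)
      then show ?case by (intro lim_imp_Liminf[symmetric]) auto
    qed
  qed
  also have "\<dots> \<le> liminf (\<lambda>j. \<integral>\<^sup>+\<omega>. ennreal (approx_real j \<omega> ^ n) \<partial>Pr)"
    by (rule nn_integral_liminf) measurable
  also have "\<dots> \<le> full_moment"
    using upper by (intro order_trans[OF Liminf_mono Liminf_const[THEN eq_refl]]) (auto intro!: always_eventually)
  finally show ZR: "(\<integral>\<^sup>+\<omega>. ennreal (Z \<omega> ^ n) \<partial>Pr) \<le> full_moment" .
  obtain \<delta> where \<delta>: "\<delta> \<longlonglongrightarrow> (0 :: real)"
    and C: "\<And>i j. i \<le> j \<Longrightarrow> (\<integral>\<^sup>+\<omega>. ennreal (\<bar>approx_real i \<omega> - approx_real j \<omega>\<bar> ^ n) \<partial>Pr) \<le> ennreal (\<delta> i)"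
    using approx_real_Cauchy by blast
  have CZ: "(\<integral>\<^sup>+\<omega>. ennreal (\<bar>approx_real i \<omega> - Z \<omega>\<bar> ^ n) \<partial>Pr) \<le> ennreal (\<delta> i)" for i
  proof -
    have "(\<integral>\<^sup>+\<omega>. ennreal (\<bar>approx_real i \<omega> - Z \<omega>\<bar> ^ n) \<partial>Pr) = (\<integral>\<^sup>+\<omega>. liminf (\<lambda>j. ennreal (\<bar>approx_real i \<omega> - approx_real j \<omega>\<bar> ^ n)) \<partial>Pr)"
    proof (rule nn_integral_cong_AE)
      show "AE \<omega> in Pr. ennreal (\<bar>approx_real i \<omega> - Z \<omega>\<bar> ^ n) = liminf (\<lambda>j. ennreal (\<bar>approx_real i \<omega> - approx_real j \<omega>\<bar> ^ n))"
        using lim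
      proof eventually_elim
        case (elim \<omega>)
        have "(\<lambda>j. ennreal (\<bar>approx_real i \<omega> - approx_real j \<omega>\<bar> ^ n)) \<longlonglongrightarrow> ennreal (\<bar>approx_real i \<omega> - Z \<omega>\<bar> ^ n)"
          by (intro tendsto_ennrealI tendsto_power tendsto_rabs tendsto_diff tendsto_const elim)
        then show ?case by (intro lim_imp_Liminf[symmetric]) auto
      qed
    qed
    also have "\<dots> \<le> liminf (\<lambda>j. \<integral>\<^sup>+\<omega>. ennreal (\<bar>approx_real i \<omega> - approx_real j \<omega>\<bar> ^ n) \<partial>Pr)"
      by (rule nn_integral_liminf) measurable
    also have "\<dots> \<le> ennreal (\<delta> i)"
      using C by (intro order_trans[OF Liminf_mono Liminf_const[THEN eq_refl]]) (auto intro!: eventually_sequentiallyI[of i])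
    finally show ?thesis .
  qed
  let ?z = "\<integral>\<^sup>+\<omega>. ennreal (Z \<omega> ^ n) \<partial>Pr"
  have z_fin: "?z < \<infinity>" using order.strict_trans1[OF ZR full_moment_finite] .
  have full_moment_le: "full_moment \<le> ennreal ((1 + \<eta>) ^ n) * ?z" if \<eta>: "\<eta> > 0" for \<eta> :: real
  proof -
    let ?K = "((1 + \<eta>) / \<eta>) ^ n"
    have "sep_moment i \<le> ennreal ((1 + \<eta>) ^ n) * ?z + ennreal (?K * \<delta> i)" for i
    proof -
      have "sep_moment i \<le> (\<integral>\<^sup>+\<omega>. ennreal (approx_real i \<omega> ^ n) \<partial>Pr)" by (rule lower)
      also have "\<dots> \<le> (\<integral>\<^sup>+\<omega>. ennreal ((1 + \<eta>) ^ n) * ennreal (Z \<omega> ^ n) + ennreal ?K * ennreal (\<bar>approx_real i \<omega> - Z \<omega>\<bar> ^ n) \<partial>Pr)"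
      proof (rule nn_integral_mono_AE)
        show "AE \<omega> in Pr. ennreal (approx_real i \<omega> ^ n) \<le> ennreal ((1 + \<eta>) ^ n) * ennreal (Z \<omega> ^ n) + ennreal ?K * ennreal (\<bar>approx_real i \<omega> - Z \<omega>\<bar> ^ n)"
          using Z0
        proof eventually_elim
          case (elim \<omega>)
          have "ennreal (approx_real i \<omega> ^ n) \<le> ennreal ((1 + \<eta>) ^ n * Z \<omega> ^ n + ?K * \<bar>approx_real i \<omega> - Z \<omega>\<bar> ^ n)"
            by (intro ennreal_leI power_split_le elim approx_real_nonneg \<eta>)
          then show ?case using \<eta> elim by (simp add: ennreal_mult ennreal_plus)
        qed
      qed
      also have "\<dots> = ennreal ((1 + \<eta>) ^ n) * ?z + ennreal ?K * (\<integral>\<^sup>+\<omega>. ennreal (\<bar>approx_real i \<omega> - Z \<omega>\<bar> ^ n) \<partial>Pr)"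
        by (subst nn_integral_add) (auto simp: nn_integral_cmult)
      also have "\<dots> \<le> ennreal ((1 + \<eta>) ^ n) * ?z + ennreal ?K * ennreal (\<delta> i)"
        by (intro add_left_mono mult_left_mono CZ) auto
      also have "ennreal ?K * ennreal (\<delta> i) = ennreal (?K * \<delta> i)"
        using \<eta> by (simp add: ennreal_mult')
      finally show ?thesis .
    qed
    moreover have "sep_moment \<longlonglongrightarrow> full_moment" using separated_tendsto by (simp add: sep_moment_def[abs_def])
    moreover have "(\<lambda>i. ennreal ((1 + \<eta>) ^ n) * ?z + ennreal (?K * \<delta> i)) \<longlonglongrightarrow> ennreal ((1 + \<eta>) ^ n) * ?z + ennreal (?K * 0)"
      by (intro tendsto_add tendsto_const tendsto_ennrealI tendsto_mult \<delta>)
    ultimately show ?thesis by (intro LIMSEQ_le[of sep_moment full_moment]) auto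
  qed
  show "full_moment \<le> ?z"
  proof -
    obtain zr where zr: "?z = ennreal zr" "zr \<ge> 0" using z_fin by (cases ?z) auto
    have "full_moment \<le> ennreal ((1 + 1 / real (Suc k)) ^ n * zr)" for k
      using full_moment_le[of "1 / real (Suc k)"] zr(2) unfolding zr(1) by (simp add: ennreal_mult)
    moreover have "(\<lambda>k. ennreal ((1 + 1 / real (Suc k)) ^ n * zr)) \<longlonglongrightarrow> ennreal ((1 + 0) ^ n * zr)"
      by (intro tendsto_ennrealI tendsto_mult tendsto_power tendsto_add tendsto_const lim_1_over_n[THEN LIMSEQ_Suc])
    ultimately show ?thesis unfolding zr(1) by (intro LIMSEQ_le_const[of _ "ennreal zr" full_moment]) auto
  qed
qed

section \<open>Identification with the limit measure\<close>

lemma approx_real_eq_integral: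
  assumes "\<omega> \<in> space Pr"
  shows "(LBINT u:{0..1}. f u * exp (P (cone_set (scale j) u) \<omega>)) = approx_real j \<omega>"
proof -
  note [measurable] = P_cone_measurable_section[OF assms]
  have "(LBINT u:{0..1}. f u * exp (P (cone_set (scale j) u) \<omega>)) = (\<integral>u. cut_f u * exp (P (cone_set (scale j) u) \<omega>) \<partial>lborel)"
    unfolding set_lebesgue_integral_def
  proof (rule integral_cong_AE)
    have "(\<lambda>u. indicator {0..1} u *\<^sub>R f u) \<in> borel_measurable lborel"
      using borel_measurable_continuous_on_indicator[OF _ fcont] by simp
    then have "(\<lambda>u. (indicator {0..1} u *\<^sub>R f u) * exp (P (cone_set (scale j) u) \<omega>)) \<in> borel_measurable lborel"
      by measurable
    then show "(\<lambda>u. indicator {0..1} u *\<^sub>R (f u * exp (P (cone_set (scale j) u) \<omega>))) \<in> borel_measurable lborel"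
      by (simp add: mult.assoc)
    have "AE u in lborel. u \<noteq> (0 :: real)" "AE u in lborel. u \<noteq> (1 :: real)" by (rule AE_lborel_singleton)+
    then show "AE u in lborel. indicator {0..1} u *\<^sub>R (f u * exp (P (cone_set (scale j) u) \<omega>)) = cut_f u * exp (P (cone_set (scale j) u) \<omega>)"
      by eventually_elim (auto simp: cut_f_def indicator_def)
  qed measurable
  also have "\<dots> = enn2real (\<integral>\<^sup>+u. ennreal (cut_f u * exp (P (cone_set (scale j) u) \<omega>)) \<partial>lborel)"
    by (rule integral_eq_nn_integral) (auto simp: cut_f_nonneg)
  also have "\<dots> = approx_real j \<omega>"
    by (simp add: approx_real_def approx_def ennreal_mult cut_f_nonneg)
  finally show ?thesis .
qed

text \<open>The limit measure is finite and carries no mass off [0, 1], where \<open>f\<close> is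
  continuous, hence bounded. The extended integral of the claim therefore agrees with the Bochner
  integral in the definition of convergence.\<close>

lemma nn_integral_Mmu:
  assumes "\<omega> \<in> space Pr"
  shows "(\<integral>\<^sup>+t. ennreal (f t) \<partial>Mmu \<omega>) = ennreal (LINT u:{0..1}|Mmu \<omega>. f u)"
    and "0 \<le> (LINT u:{0..1}|Mmu \<omega>. f u)"
proof -
  have M: "sets (Mmu \<omega>) = sets borel" "finite_measure (Mmu \<omega>)" "emeasure (Mmu \<omega>) (- {0..1}) = 0"
    using lim assms by (auto simp: limit_logID_measure_def)
  interpret finite_measure "Mmu \<omega>" by fact
  have nn: "0 \<le> indicator {0..1} u *\<^sub>R f u" for u using fpos by (auto simp: indicator_def)
  show "0 \<le> (LINT u:{0..1}|Mmu \<omega>. f u)"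
    unfolding set_lebesgue_integral_def by (rule integral_nonneg_AE) (use nn in auto)
  have "bounded (f ` {0..1})" by (intro compact_imp_bounded compact_continuous_image fcont) auto
  then obtain B where B: "\<And>t. t \<in> {0..1} \<Longrightarrow> f t \<le> B" "B \<ge> 0"
    unfolding bounded_pos by (metis abs_le_D1 imageI less_imp_le real_norm_def)
  have m: "(\<lambda>u. indicator {0..1} u *\<^sub>R f u) \<in> borel_measurable (Mmu \<omega>)"
    using borel_measurable_continuous_on_indicator[OF _ fcont] measurable_cong_sets[OF M(1) refl] by auto
  have int: "integrable (Mmu \<omega>) (\<lambda>u. indicator {0..1} u *\<^sub>R f u)"
    using B nn by (intro integrable_const_bound[of _ B] m AE_I2) (auto simp: indicator_def)
  have "- {0..1} \<in> sets (Mmu \<omega>)" unfolding M(1) by auto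
  then have "- {0..1} \<in> null_sets (Mmu \<omega>)" using M(3) by auto
  then have "AE u in Mmu \<omega>. u \<in> {0..1}" by (rule AE_I') auto
  then have "AE u in Mmu \<omega>. ennreal (f u) = ennreal (indicator {0..1} u *\<^sub>R f u)"
    by eventually_elim auto
  then have "(\<integral>\<^sup>+t. ennreal (f t) \<partial>Mmu \<omega>) = (\<integral>\<^sup>+u. ennreal (indicator {0..1} u *\<^sub>R f u) \<partial>Mmu \<omega>)"
    by (rule nn_integral_cong_AE)
  also have "\<dots> = ennreal (LINT u:{0..1}|Mmu \<omega>. f u)"
    unfolding set_lebesgue_integral_def by (intro nn_integral_eq_integral int AE_I2 nn)
  finally show "(\<integral>\<^sup>+t. ennreal (f t) \<partial>Mmu \<omega>) = ennreal (LINT u:{0..1}|Mmu \<omega>. f u)" .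
qed

lemma moment_eq_full_moment: "(\<integral>\<^sup>+\<omega>. (\<integral>\<^sup>+t. ennreal (f t) \<partial>Mmu \<omega>) ^ n \<partial>Pr) = full_moment"
proof -
  \<comment> \<open>As a limit of measurable functions \<open>Z\<close> is measurable, and almost
    surely it equals the integral of \<open>f\<close> against the limit measure.\<close>
  define Z where "Z \<omega> = lim (\<lambda>j. approx_real j \<omega>)" for \<omega>
  have [measurable]: "Z \<in> borel_measurable Pr"
    unfolding Z_def[abs_def] by (rule borel_measurable_lim_metric) measurable
  have "scale \<longlonglongrightarrow> 0" unfolding scale_def[abs_def] by real_asymp
  then have e0: "filterlim scale (at_right 0) sequentially"
    by (rule tendsto_imp_filterlim_at_right) (simp add: scale)
  have "AE \<omega> in Pr. \<forall>g. continuous_on {0..1} g \<longrightarrow>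
      ((\<lambda>\<epsilon>. LBINT u:{0..1}. g u * exp (P (cone_set \<epsilon> u) \<omega>)) \<longlongrightarrow> (LINT u:{0..1}|Mmu \<omega>. g u)) (at_right 0)"
    using lim unfolding limit_logID_measure_def by blast
  then have conv: "AE \<omega> in Pr. (\<lambda>j. approx_real j \<omega>) \<longlonglongrightarrow> (LINT u:{0..1}|Mmu \<omega>. f u)"
    using AE_space
  proof eventually_elim
    case (elim \<omega>)
    from elim(1) fcont have "((\<lambda>\<epsilon>. LBINT u:{0..1}. f u * exp (P (cone_set \<epsilon> u) \<omega>)) \<longlongrightarrow> (LINT u:{0..1}|Mmu \<omega>. f u)) (at_right 0)"
      by blast
    from filterlim_compose[OF this e0] show ?case
      by (simp only: approx_real_eq_integral[OF elim(2)])
  qed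
  have "(\<integral>\<^sup>+\<omega>. (\<integral>\<^sup>+t. ennreal (f t) \<partial>Mmu \<omega>) ^ n \<partial>Pr) = (\<integral>\<^sup>+\<omega>. ennreal (Z \<omega> ^ n) \<partial>Pr)"
  proof (rule nn_integral_cong_AE)
    show "AE \<omega> in Pr. (\<integral>\<^sup>+t. ennreal (f t) \<partial>Mmu \<omega>) ^ n = ennreal (Z \<omega> ^ n)"
      using conv AE_space
    proof eventually_elim
      case (elim \<omega>)
      have "Z \<omega> = (LINT u:{0..1}|Mmu \<omega>. f u)" unfolding Z_def by (rule limI) (rule elim(1))
      then show ?case using nn_integral_Mmu[OF elim(2)] by (simp add: ennreal_power)
    qed
  qed
  also have "\<dots> = full_moment"
  proof (rule limit_moment)
    show "AE \<omega> in Pr. (\<lambda>j. approx_real j \<omega>) \<longlonglongrightarrow> Z \<omega>"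
      using conv
    proof eventually_elim
      case (elim \<omega>)
      have "Z \<omega> = (LINT u:{0..1}|Mmu \<omega>. f u)" unfolding Z_def by (rule limI) (rule elim)
      with elim show ?case by simp
    qed
  qed measurable
  finally show ?thesis .
qed

lemma full_moment_eq_simplex_integral:
  "full_moment = ennreal (fact n) * (\<integral>\<^sup>+t. indicator (sorted_cube n) t *
      ennreal ((\<Prod>i\<in>{1..n}. f (t i)) * (\<Prod>p\<in>{1..n}. \<Prod>k\<in>{1..<p}. \<bar>t p - t k\<bar> powr (- \<mu> * dfun s2 nu (p - k)))) \<partial>lebn n)"
proof -
  have "indicator (sorted_cube n) t * density_fun t = indicator (sorted_cube n) t *
      ennreal ((\<Prod>i\<in>{1..n}. f (t i)) * (\<Prod>p\<in>{1..n}. \<Prod>k\<in>{1..<p}. \<bar>t p - t k\<bar> powr (- \<mu> * dfun s2 nu (p - k))))" for t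
  proof (cases "t \<in> sorted_cube n")
    case True
    have "(\<Prod>p\<in>{1..n}. \<Prod>k\<in>{1..<p}. \<bar>t p - t k\<bar> powr (- \<mu> * dfun s2 nu (p - k)))
        = (\<Prod>p\<in>{1..n}. \<Prod>k\<in>{1..<p}. exp (\<mu> * (dfun s2 nu (p - k) * - ln (t p - t k))))"
    proof (intro prod.cong refl)
      fix p k assume "p \<in> {1..n}" "k \<in> {1..<p}"
      then have "t k < t p" using sorted_cube_less[OF True, of k p] by auto
      then show "\<bar>t p - t k\<bar> powr (- \<mu> * dfun s2 nu (p - k)) = exp (\<mu> * (dfun s2 nu (p - k) * - ln (t p - t k)))"
        by (simp add: powr_def)
    qed
    also have "\<dots> = exp (\<mu> * (\<Sum>p\<in>{1..n}. \<Sum>k\<in>{1..<p}. dfun s2 nu (p - k) * - ln (t p - t k)))"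
      by (simp only: exp_sum[symmetric] finite_atLeastAtMost finite_atLeastLessThan sum_distrib_left)
    finally show ?thesis unfolding density_fun_sorted[OF True] by simp
  qed simp
  then show ?thesis unfolding full_moment_eq by simp
qed

end

theorem theorem1:
  fixes s2 \<mu> :: real and M :: "real \<Rightarrow> real" and nu :: "real measure"
    and Pr :: "'w measure" and P :: "(real \<times> real) set \<Rightarrow> 'w \<Rightarrow> real"
    and Mmu :: "'w \<Rightarrow> real measure" and n :: nat and f :: "real \<Rightarrow> real"
  assumes "s2 \<ge> 0"
    and "spectral_function M nu"
    and "spectral_integrable nu n"
    and "\<mu> > 0"
    and "1 - \<mu> * (s2 / 2 + (\<integral>u. u * exp u - exp u + 1 \<partial>nu)) > 0"
    and "prob_space Pr"
    and "ID_scattered Pr \<mu> s2 nu P"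
    and "limit_logID_measure Pr P Mmu"
    and "real n - \<mu> * Re (phi s2 nu (- \<i> * of_nat n)) > 1"
    and "continuous_on {0..1} f"
    and "\<forall>t\<in>{0..1}. f t \<ge> 0"
  shows "(\<integral>\<^sup>+ \<omega>. (\<integral>\<^sup>+ t. ennreal (f t) \<partial>(Mmu \<omega>)) ^ n \<partial>Pr)
       = ennreal (fact n) *
         (\<integral>\<^sup>+ t. indicator {t. (\<forall>i\<in>{1..n}. 0 < t i \<and> t i < 1) \<and> (\<forall>i\<in>{1..<n}. t i < t (Suc i))} t *
              ennreal ((\<Prod>i\<in>{1..n}. f (t i)) *
                (\<Prod>p\<in>{1..n}. \<Prod>k\<in>{1..<p}. \<bar>t p - t k\<bar> powr (- \<mu> * dfun s2 nu (p - k))))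
            \<partial>(PiM {1..n} (\<lambda>_. lborel)))"
proof -
  \<comment> \<open>\<phi> vanishes at 0 and at - i, so for n = 0 and n = 1 the moment condition
    would read 0 > 1 and 1 > 1.\<close>
  have n2: "n \<ge> 2"
  proof (rule ccontr)
    assume "\<not> n \<ge> 2"
    then have "n = 0 \<or> n = 1" by auto
    moreover have "phi s2 nu (- \<i> * of_nat 0) = 0" "phi s2 nu (- \<i> * of_nat 1) = 0"
      unfolding phi_def phi_integrand_imag[abs_def] by (simp_all add: power2_eq_square)
    ultimately show False using assms(9) by auto
  qed
  interpret spectral s2 M nu n
    by (rule spectral.intro[OF assms(1-3) n2])
  have "Re (phi s2 nu (- \<i> * of_nat n)) = \<Phi> n"
    unfolding phi_eq_\<Phi>[OF order_refl] by simp
  with assms(9) have cond: "real n - \<mu> * \<Phi> n > 1" by simp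
  have fpos: "f t \<ge> 0" if "t \<in> {0..1}" for t using assms(11) that by blast
  interpret log_id s2 M nu n \<mu> Pr P
    by (rule log_id.intro[OF spectral_axioms log_id_axioms.intro[OF assms(4,6,7)]])
  interpret log_id_moment s2 M nu n \<mu> Pr P Mmu f
    by (rule log_id_moment.intro[OF log_id_axioms log_id_moment_axioms.intro[OF assms(8) cond assms(10) fpos]])
  show ?thesis
    unfolding moment_eq_full_moment full_moment_eq_simplex_integral sorted_cube_def ..
qed

end
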